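(* Let $M$ be a smooth manifold immersed in $\mathbb{R}^m$ with parallel mean curvature vector. Let $\eta$ be a parallel unit normal section of $M$. Then the following are equivalent: (1) the Gauss map $\gamma_\eta\in C^\infty(M,\mathbb{S}^{m-1})$, $\gamma_\eta(p)=\eta(p)$, is harmonic; (2) $\eta$ is a harmonic section; (3) $\eta$ is an eigenvector of the Simons operator $\tilde{\mathcal{B}}$.
   Context: Parallel means parallel in the normal connection $\nabla^\perp$ of $M$. A map $f:M\to\mathbb{S}^{m-1}$ is harmonic if it is a critical point of $\int_D\|df\|^2$ on compact subdomains $D\subset M$ among maps into $\mathbb{S}^{m-1}$ (equivalently $\Delta f=-\|df\|^2 f$). A unit normal section $\eta$ is harmonic if, on compact subdomains $D$ of $M$, it is a critical point of $\mathcal{N}(\eta)=\int_D\|\nabla\eta\|^2$ among unit normal sections, where $\nabla$ is the Riemannian connection of the ambient space and $\|\nabla\eta\|^2=\sum_i\|\nabla_{E_i}\eta\|^2$ for a local orthonormal frame $\{E_i\}$ of $M$. For a normal section $\eta$, $S_\eta$ is the shape operator, $S_\eta(X)=-(\nabla_X\eta)^\top$. The Simons operator $\tilde{\mathcal{B}}$ is the section of $\mathrm{Hom}(TM^\perp,TM^\perp)$ defined by $\langle\tilde{\mathcal{B}}(\eta_1),\eta_2\rangle=\langle S_{\eta_1},S_{\eta_2}\rangle=\sum_i\langle S_{\eta_1}(E_i),S_{\eta_2}(E_i)\rangle$. A section $\eta$ is an eigenvector of $\tilde{\mathcal{B}}$ if $\tilde{\mathcal{B}}(\eta)=\lambda\eta$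 for some function $\lambda$ on $M$. *)

theory Defs
  imports "HOL-Analysis.Analysis"
begin

section \<open>Smoothness on open subsets of Euclidean space\<close>

text \<open>Meant for open \<open>S\<close>: the derivatives are taken at the points of \<open>S\<close>, not within \<open>S\<close>.\<close>

primrec Ck_on ::
  "nat \<Rightarrow> 'a::euclidean_space set \<Rightarrow> ('a \<Rightarrow> 'b::euclidean_space) \<Rightarrow> bool" where
  "Ck_on 0 S f \<longleftrightarrow> continuous_on S f"
| "Ck_on (Suc k) S f \<longleftrightarrow>
     (\<forall>x\<in>S. f differentiable (at x)) \<and>
     (\<forall>v. Ck_on k S (\<lambda>x. frechet_derivative f (at x) v))"

definition smooth_on :: "'a::euclidean_space set \<Rightarrow> ('a \<Rightarrow> 'b::euclidean_space) \<Rightarrow> bool" where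
  "smooth_on S f \<longleftrightarrow> (\<forall>k. Ck_on k S f)"


section \<open>Smooth manifolds\<close>

text \<open>
  The manifold is a whole type \<open>'p\<close>, Hausdorff and second countable by its type classes, and
  the atlas need not be maximal. A chart is a pair of its domain and its coordinate map; the
  coordinate map is irrelevant outside the domain.
\<close>

type_synonym ('p, 'n) chart = "'p set \<times> ('p \<Rightarrow> real ^ 'n)"

definition chart_inv :: "('p, 'n::finite) chart \<Rightarrow> real ^ 'n \<Rightarrow> 'p" where
  "chart_inv c = inv_into (fst c) (snd c)"

definition smooth_atlas ::
  "('p::{t2_space, second_countable_topology}, 'n::finite) chart set \<Rightarrow> bool" where
  "smooth_atlas A \<longleftrightarrow>
     (\<Union>c\<in>A. fst c) = UNIV \<and>
     (\<forall>c\<in>A. open (fst c) \<and> open (snd c ` fst c) \<and>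
        homeomorphism (fst c) (snd c ` fst c) (snd c) (chart_inv c)) \<and>
     (\<forall>c\<in>A. \<forall>d\<in>A. smooth_on (snd c ` (fst c \<inter> fst d)) (snd d \<circ> chart_inv c))"

definition smooth_map_on ::
  "('p::{t2_space, second_countable_topology}, 'n::finite) chart set \<Rightarrow> 'p set \<Rightarrow>
   ('p \<Rightarrow> 'b::euclidean_space) \<Rightarrow> bool" where
  "smooth_map_on A W f \<longleftrightarrow> (\<forall>c\<in>A. smooth_on (snd c ` (fst c \<inter> W)) (f \<circ> chart_inv c))"

abbreviation smooth_map ::
  "('p::{t2_space, second_countable_topology}, 'n::finite) chart set \<Rightarrow>
   ('p \<Rightarrow> 'b::euclidean_space) \<Rightarrow> bool" where
  "smooth_map A f \<equiv> smooth_map_on A UNIV f"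

text \<open>
  Differential at \<open>p\<close> of \<open>f\<close> in the chart \<open>c\<close>, applied to the tangent vector with
  coordinates \<open>v\<close>.
\<close>

definition chart_diff ::
  "('p, 'n::finite) chart \<Rightarrow> ('p \<Rightarrow> 'b::euclidean_space) \<Rightarrow> 'p \<Rightarrow> real ^ 'n \<Rightarrow> 'b" where
  "chart_diff c f p v = frechet_derivative (f \<circ> chart_inv c) (at (snd c p)) v"

definition immersion ::
  "('p::{t2_space, second_countable_topology}, 'n::finite) chart set \<Rightarrow>
   ('p \<Rightarrow> 'b::euclidean_space) \<Rightarrow> bool" where
  "immersion A F \<longleftrightarrow>
     smooth_map A F \<and> (\<forall>c\<in>A. \<forall>p\<in>fst c. inj (chart_diff c F p))"

definition chart_at :: "('p, 'n::finite) chart set \<Rightarrow> 'p \<Rightarrow> ('p, 'n) chart" where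
  "chart_at A p = (SOME c. c \<in> A \<and> p \<in> fst c)"


section \<open>Geometry of an immersed manifold\<close>

text \<open>
  Below, \<open>F\<close> is an immersion into \<open>\<real>\<^sup>m\<close> and a tangent vector \<open>X\<close> of \<open>M\<close> at \<open>p\<close> is identified
  with \<open>dF(X)\<close>, so that tangent and normal spaces at \<open>p\<close> are subspaces of \<open>real ^ 'm\<close>. Vector
  fields along \<open>F\<close> are maps \<open>'p \<Rightarrow> real ^ 'm\<close>, and \<open>M\<close> carries the metric induced by \<open>F\<close>.
\<close>

context
  fixes A :: "('p::{t2_space, second_countable_topology}, 'n::finite) chart set"
    and F :: "'p \<Rightarrow> real ^ 'm::finite"
begin

definition tangent_space :: "'p \<Rightarrow> (real ^ 'm) set" where
  "tangent_space p = range (chart_diff (chart_at A p) F p)"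

definition normal_space :: "'p \<Rightarrow> (real ^ 'm) set" where
  "normal_space p = orthogonal_comp (tangent_space p)"

definition coords :: "'p \<Rightarrow> real ^ 'm \<Rightarrow> real ^ 'n" where
  "coords p X = (THE v. chart_diff (chart_at A p) F p v = X)"

text \<open>
  The derivative of \<open>f\<close> at \<open>p\<close> along the tangent vector \<open>X\<close>. Since the ambient space is flat,
  this is both \<open>df(X)\<close>, for a map \<open>f\<close> into \<open>\<real>\<^sup>m\<close>, and \<open>\<nabla>\<^sub>X f\<close> for the ambient Riemannian
  connection, for a vector field \<open>f\<close> along \<open>F\<close>.
\<close>

definition nabla :: "real ^ 'm \<Rightarrow> ('p \<Rightarrow> real ^ 'm) \<Rightarrow> 'p \<Rightarrow> real ^ 'm" where
  "nabla X f p = chart_diff (chart_at A p) f p (coords p X)"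

text \<open>
  An orthonormal basis of the tangent space. It is only used in traces and orthogonal
  projections, which do not depend on the choice.
\<close>

definition frame :: "'p \<Rightarrow> (real ^ 'm) set" where
  "frame p = (SOME B. B \<subseteq> tangent_space p \<and> pairwise orthogonal B \<and>
     (\<forall>b\<in>B. norm b = 1) \<and> span B = tangent_space p)"

definition tan_part :: "'p \<Rightarrow> real ^ 'm \<Rightarrow> real ^ 'm" where
  "tan_part p w = (\<Sum>b\<in>frame p. (w \<bullet> b) *\<^sub>R b)"

definition nor_part :: "'p \<Rightarrow> real ^ 'm \<Rightarrow> real ^ 'm" where
  "nor_part p w = w - tan_part p w"

definition normal_section_on :: "'p set \<Rightarrow> ('p \<Rightarrow> real ^ 'm) \<Rightarrow> bool" where
  "normal_section_on W \<xi> \<longleftrightarrow> smooth_map_on A W \<xi> \<and> (\<forall>p\<in>W. \<xi> p \<in> normal_space p)"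

definition unit_normal_section :: "('p \<Rightarrow> real ^ 'm) \<Rightarrow> bool" where
  "unit_normal_section \<xi> \<longleftrightarrow> normal_section_on UNIV \<xi> \<and> (\<forall>p. norm (\<xi> p) = 1)"

definition normal_connection :: "real ^ 'm \<Rightarrow> ('p \<Rightarrow> real ^ 'm) \<Rightarrow> 'p \<Rightarrow> real ^ 'm" where
  "normal_connection X \<xi> p = nor_part p (nabla X \<xi> p)"

definition parallel_section :: "('p \<Rightarrow> real ^ 'm) \<Rightarrow> bool" where
  "parallel_section \<xi> \<longleftrightarrow> (\<forall>p. \<forall>X\<in>tangent_space p. normal_connection X \<xi> p = 0)"

text \<open>
  The local extension of a tangent vector \<open>Y\<close> at \<open>p\<close> that has constant coordinates in the
  chart at \<open>p\<close>. The normal part of \<open>\<nabla>\<^sub>X Y\<close> is tensorial in \<open>Y\<close>, so any other tangent extension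
  would give the same second fundamental form.
\<close>

definition extension :: "'p \<Rightarrow> real ^ 'm \<Rightarrow> 'p \<Rightarrow> real ^ 'm" where
  "extension p Y q = chart_diff (chart_at A p) F q (coords p Y)"

definition second_fundamental_form :: "'p \<Rightarrow> real ^ 'm \<Rightarrow> real ^ 'm \<Rightarrow> real ^ 'm" where
  "second_fundamental_form p X Y = nor_part p (nabla X (extension p Y) p)"

definition mean_curvature :: "'p \<Rightarrow> real ^ 'm" where
  "mean_curvature p =
     (1 / real CARD('n)) *\<^sub>R (\<Sum>b\<in>frame p. second_fundamental_form p b b)"

definition shape_operator :: "('p \<Rightarrow> real ^ 'm) \<Rightarrow> 'p \<Rightarrow> real ^ 'm \<Rightarrow> real ^ 'm" where
  "shape_operator \<xi> p X = - tan_part p (nabla X \<xi> p)"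

definition shape_inner :: "('p \<Rightarrow> real ^ 'm) \<Rightarrow> ('p \<Rightarrow> real ^ 'm) \<Rightarrow> 'p \<Rightarrow> real" where
  "shape_inner \<xi> \<zeta> p = (\<Sum>b\<in>frame p. shape_operator \<xi> p b \<bullet> shape_operator \<zeta> p b)"

text \<open>
  The test sections \<open>\<zeta>\<close> are local, so that they visibly attain every normal vector at \<open>p\<close>.
\<close>

definition simons :: "('p \<Rightarrow> real ^ 'm) \<Rightarrow> 'p \<Rightarrow> real ^ 'm" where
  "simons \<xi> p = (THE w. w \<in> normal_space p \<and>
     (\<forall>W \<zeta>. open W \<longrightarrow> p \<in> W \<longrightarrow> normal_section_on W \<zeta> \<longrightarrow>
        w \<bullet> \<zeta> p = shape_inner \<xi> \<zeta> p))"

definition simons_eigenvector :: "('p \<Rightarrow> real ^ 'm) \<Rightarrow> bool" where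
  "simons_eigenvector \<xi> \<longleftrightarrow> (\<exists>l::'p \<Rightarrow> real. \<forall>p. simons \<xi> p = l p *\<^sub>R \<xi> p)"

definition gram :: "('p, 'n) chart \<Rightarrow> 'p \<Rightarrow> real ^ 'n ^ 'n" where
  "gram c p = (\<chi> i j. chart_diff c F p (axis i 1) \<bullet> chart_diff c F p (axis j 1))"

text \<open>
  The Riemannian volume measure of the induced metric. It is the only Borel measure with this
  property, since countably many charts cover \<open>M\<close>.
\<close>

definition volume :: "'p measure" where
  "volume = (SOME \<mu>. sets \<mu> = sets borel \<and>
     (\<forall>c\<in>A. \<forall>B\<in>sets borel. B \<subseteq> fst c \<longrightarrow>
        emeasure \<mu> B =
          (\<integral>\<^sup>+x\<in>snd c ` B. ennreal (sqrt (det (gram c (chart_inv c x)))) \<partial>lborel)))"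

text \<open>
  \<open>energy D f\<close> is the integral of \<open>\<parallel>df\<parallel>\<^sup>2\<close> over \<open>D\<close> if \<open>f\<close> is a map into a sphere, and the
  integral of \<open>\<parallel>\<nabla>f\<parallel>\<^sup>2\<close> over \<open>D\<close> if \<open>f\<close> is a normal section.
\<close>

definition energy_density :: "('p \<Rightarrow> real ^ 'm) \<Rightarrow> 'p \<Rightarrow> real" where
  "energy_density f p = (\<Sum>b\<in>frame p. (norm (nabla b f p))\<^sup>2)"

definition energy :: "'p set \<Rightarrow> ('p \<Rightarrow> real ^ 'm) \<Rightarrow> real" where
  "energy D f = (LINT p:D|volume. energy_density f p)"

definition smooth_family :: "real \<Rightarrow> (real \<Rightarrow> 'p \<Rightarrow> real ^ 'm) \<Rightarrow> bool" where
  "smooth_family \<epsilon> \<Phi> \<longleftrightarrow>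
     (\<forall>c\<in>A. smooth_on ({-\<epsilon><..<\<epsilon>} \<times> snd c ` fst c) (\<lambda>(t, x). \<Phi> t (chart_inv c x)))"

text \<open>
  \<open>f\<close> is a critical point of the energy on compact subdomains \<open>D\<close>, among the maps in the
  class \<open>C\<close>. Variations stay in \<open>C\<close> and agree with \<open>f\<close> outside \<open>D\<close>.
\<close>

definition critical_among :: "('p \<Rightarrow> real ^ 'm) set \<Rightarrow> ('p \<Rightarrow> real ^ 'm) \<Rightarrow> bool" where
  "critical_among C f \<longleftrightarrow>
     (\<forall>D \<epsilon> \<Phi>. compact D \<longrightarrow> closure (interior D) = D \<longrightarrow> \<epsilon> > 0 \<longrightarrow>
        smooth_family \<epsilon> \<Phi> \<longrightarrow> (\<forall>t\<in>{-\<epsilon><..<\<epsilon>}. \<Phi> t \<in> C) \<longrightarrow> \<Phi> 0 = f \<longrightarrow>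
        (\<forall>t\<in>{-\<epsilon><..<\<epsilon>}. \<forall>p. p \<notin> D \<longrightarrow> \<Phi> t p = f p) \<longrightarrow>
        ((\<lambda>t. energy D (\<Phi> t)) has_real_derivative 0) (at 0))"

definition sphere_maps :: "('p \<Rightarrow> real ^ 'm) set" where
  "sphere_maps = {f. smooth_map A f \<and> range f \<subseteq> sphere 0 1}"

definition harmonic_sphere_map :: "('p \<Rightarrow> real ^ 'm) \<Rightarrow> bool" where
  "harmonic_sphere_map f \<longleftrightarrow> f \<in> sphere_maps \<and> critical_among sphere_maps f"

definition harmonic_unit_normal_section :: "('p \<Rightarrow> real ^ 'm) \<Rightarrow> bool" where
  "harmonic_unit_normal_section \<xi> \<longleftrightarrow>
     unit_normal_section \<xi> \<and> critical_among {\<zeta>. unit_normal_section \<zeta>} \<xi>"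

text \<open>Normal vectors are translated to the origin of \<open>\<real>\<^sup>m\<close>, which is already built in here.\<close>

definition gauss_map :: "('p \<Rightarrow> real ^ 'm) \<Rightarrow> 'p \<Rightarrow> real ^ 'm" where
  "gauss_map \<xi> p = \<xi> p"

end

end

theory Submission
  imports Defs
begin

text \<open>
  Everything rests on the identity \<open>\<Delta>\<eta> = - B\<close>, where \<open>\<Delta>\<close> is the Laplacian of \<open>M\<close> applied to the
  components of \<open>\<eta>\<close> and \<open>B\<close> is the image of \<open>\<eta>\<close> under the Simons operator. As \<open>\<eta>\<close> is parallel,
  \<open>\<nabla>\<eta> = - S\<^sub>\<eta>\<close> is tangential. Taking the inner product with a normal section \<open>\<zeta>\<close> gives
  \<open>\<langle>\<Delta>\<eta>, \<zeta>\<rangle> = - \<langle>\<nabla>\<eta>, \<nabla>\<zeta>\<rangle> = - \<langle>S\<^sub>\<eta>, S\<^sub>\<zeta>\<rangle>\<close>, so the normal part of \<open>\<Delta>\<eta>\<close> is \<open>- B\<close>. The tangential part is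
  the divergence of \<open>S\<^sub>\<eta>\<close> up to sign, which by the Codazzi equation is the gradient of the trace
  \<open>n \<langle>H, \<eta>\<rangle>\<close>. This function is locally constant because \<open>H\<close> and \<open>\<eta>\<close> are parallel. The computation is
  done in coordinates (\<open>laplacian_normal\<close>, \<open>laplacian_inner_normal\<close>) and transferred to the manifold
  in \<open>simons_chart\<close>.

  Integration by parts (\<open>green\<close>) then yields, for a map \<open>W\<close> with support in a compact set \<open>D\<close>,
  \<open>energy (\<eta> + W) = energy \<eta> + \<integral> (2 \<langle>B, W\<rangle> + \<parallel>dW\<parallel>\<^sup>2)\<close> (\<open>energy_expand\<close>). The three conditions are
  compared in a circle.

  \<^item> A harmonic sphere map is critical among more variations than a harmonic unit normal section.

  \<^item> If \<open>B\<close> is not a multiple of \<open>\<eta>\<close> at some point, its component orthogonal to \<open>\<eta>\<close>, cut off by a bump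
    function, is the direction of a variation through unit normal sections along which the first
    variation of the energy is positive (\<open>eigenvector_if_critical\<close>).

  \<^item> If \<open>B = l \<eta>\<close>, and \<open>\<eta> + W\<close> is a unit vector field, then \<open>2 \<langle>B, W\<rangle> = - l \<parallel>W\<parallel>\<^sup>2\<close>. Along a variation
    \<open>W\<close> and \<open>dW\<close> are \<open>O(t)\<close>, so the energy changes by \<open>O(t\<^sup>2)\<close> (\<open>critical_if_eigenvector\<close>). Thus no
    derivative has to be taken under the integral.

  The volume is characterized by its values on the domains of the charts; that such a measure exists
  (\<open>ex_volume\<close>) is a consequence of the change of variables formula.
\<close>

section \<open>Calculus of smooth maps\<close>

lemma Ck_on_cong:
  assumes "open S" "\<And>x. x \<in> S \<Longrightarrow> f x = g x" "Ck_on k S f"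
  shows "Ck_on k S g"
  using assms(2,3)
proof (induction k arbitrary: f g)
  case 0
  then show ?case by (metis Ck_on.simps(1) continuous_on_cong)
next
  case (Suc k)
  have D: "f differentiable at x" if "x \<in> S" for x using Suc.prems that by auto
  have d: "(g has_derivative frechet_derivative f (at x)) (at x)" if "x \<in> S" for x
    using has_derivative_transform_within_open[OF _ assms(1) that Suc.prems(1)] D[OF that]
    by (simp add: frechet_derivative_works)
  have e: "frechet_derivative g (at x) = frechet_derivative f (at x)" if "x \<in> S" for x
    using frechet_derivative_at[OF d[OF that]] by simp
  have "Ck_on k S (\<lambda>x. frechet_derivative g (at x) v)" for v
    by (rule Suc.IH[of "\<lambda>x. frechet_derivative f (at x) v"]) (use Suc.prems e in auto)
  with d show ?case by (auto simp: differentiable_def)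
qed

lemma Ck_on_SucD: "Ck_on (Suc k) S f \<Longrightarrow> Ck_on k S f"
proof (induction k arbitrary: f)
  case 0
  then show ?case
    by (auto intro!: differentiable_imp_continuous_on
        simp: differentiable_on_def differentiable_at_withinI)
next
  case (Suc k)
  have "Ck_on k S (\<lambda>x. frechet_derivative f (at x) v)" for v
    by (rule Suc.IH) (use Suc.prems in \<open>simp only: Ck_on.simps(2)[of "Suc k"]\<close>)
  then show ?case using Suc.prems unfolding Ck_on.simps(2)[of "Suc k"] Ck_on.simps(2)[of k] by blast
qed

lemma Ck_on_subset: "Ck_on k S f \<Longrightarrow> T \<subseteq> S \<Longrightarrow> Ck_on k T f"
  by (induction k arbitrary: f) (auto intro: continuous_on_subset)

lemma Ck_on_continuous: "Ck_on k S f \<Longrightarrow> continuous_on S f"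
proof (induction k)
  case (Suc k)
  show ?case by (rule Suc.IH[OF Ck_on_SucD[OF Suc.prems]])
qed simp

text \<open>Closure properties follow from this by induction on the order, once a derivative is exhibited.\<close>

lemma Ck_on_SucI:
  assumes "open S" "\<And>x. x \<in> S \<Longrightarrow> (f has_derivative f' x) (at x)"
    and "\<And>v. Ck_on k S (\<lambda>x. f' x v)"
  shows "Ck_on (Suc k) S f"
proof -
  have e: "f' x = frechet_derivative f (at x)" if "x \<in> S" for x
    using frechet_derivative_at[OF assms(2)[OF that]] by simp
  have "Ck_on k S (\<lambda>x. frechet_derivative f (at x) v)" for v
    by (rule Ck_on_cong[OF assms(1) _ assms(3)[of v]]) (simp add: e)
  then show ?thesis using assms(2) by (auto simp: differentiable_def)
qed

lemma Ck_on_has_derivative: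
  "Ck_on (Suc k) S f \<Longrightarrow> x \<in> S \<Longrightarrow> (f has_derivative frechet_derivative f (at x)) (at x)"
  by (auto simp: frechet_derivative_works)

lemma Ck_on_const: "open S \<Longrightarrow> Ck_on k S (\<lambda>x. c)"
  by (induction k arbitrary: c) (auto simp: )

lemma Ck_on_linear: "open S \<Longrightarrow> bounded_linear L \<Longrightarrow> Ck_on k S L"
proof (cases k)
  case (Suc j)
  assume "open S" "bounded_linear L"
  then show ?thesis unfolding Suc
    by (intro Ck_on_SucI[where f'="\<lambda>x. L"] Ck_on_const) (auto intro: bounded_linear_imp_has_derivative)
qed (auto intro: linear_continuous_on)

lemma Ck_on_add:
  "open S \<Longrightarrow> Ck_on k S f \<Longrightarrow> Ck_on k S g \<Longrightarrow> Ck_on k S (\<lambda>x. f x + g x)"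
proof (induction k arbitrary: f g)
  case (Suc k)
  show ?case
  proof (rule Ck_on_SucI[where f'="\<lambda>x v. frechet_derivative f (at x) v + frechet_derivative g (at x) v"])
    show "Ck_on k S (\<lambda>x. frechet_derivative f (at x) v + frechet_derivative g (at x) v)" for v
      by (rule Suc.IH) (use Suc.prems in auto)
  qed (use Suc.prems in \<open>auto intro!: has_derivative_add Ck_on_has_derivative simp del: Ck_on.simps(2)\<close>)
qed (auto intro: continuous_intros)

lemma Ck_on_sum:
  "open S \<Longrightarrow> (\<And>i. i \<in> I \<Longrightarrow> Ck_on k S (f i)) \<Longrightarrow> Ck_on k S (\<lambda>x. \<Sum>i\<in>I. f i x)"
  by (induction I rule: infinite_finite_induct) (auto intro!: Ck_on_const Ck_on_add)

lemma Ck_on_bilinear: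
  assumes "bounded_bilinear prd" "open S"
  shows "Ck_on k S f \<Longrightarrow> Ck_on k S g \<Longrightarrow> Ck_on k S (\<lambda>x. prd (f x) (g x))"
proof (induction k arbitrary: f g)
  case 0
  then show ?case using bounded_bilinear.continuous_on[OF assms(1)] by auto
next
  case (Suc k)
  show ?case
  proof (rule Ck_on_SucI[where f'="\<lambda>x v. prd (f x) (frechet_derivative g (at x) v)
      + prd (frechet_derivative f (at x) v) (g x)"])
    fix v
    show "Ck_on k S (\<lambda>x. prd (f x) (frechet_derivative g (at x) v)
      + prd (frechet_derivative f (at x) v) (g x))"
      by (intro Ck_on_add Suc.IH assms)
        (use Suc.prems Ck_on_SucD[OF Suc.prems(1)] Ck_on_SucD[OF Suc.prems(2)] in auto)
  qed (use Suc.prems assms in \<open>auto intro!: bounded_bilinear.FDERIV Ck_on_has_derivative simp del: Ck_on.simps(2)\<close>)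
qed

lemma Ck_on_compose:
  fixes f :: "'a::euclidean_space \<Rightarrow> 'b::euclidean_space" and g :: "'b \<Rightarrow> 'c::euclidean_space"
  assumes "open S" "open T"
  shows "Ck_on k S f \<Longrightarrow> Ck_on k T g \<Longrightarrow> f ` S \<subseteq> T \<Longrightarrow> Ck_on k S (\<lambda>x. g (f x))"
proof (induction k arbitrary: f g)
  case 0
  then show ?case by (auto intro: continuous_on_compose2)
next
  case (Suc k)
  let ?f = "\<lambda>x. frechet_derivative f (at x)" and ?g = "\<lambda>x. frechet_derivative g (at x)"
  have gl: "bounded_linear (?g (f x))" if "x \<in> S" for x
    using Ck_on_has_derivative[OF Suc.prems(2)] that Suc.prems(3) has_derivative_bounded_linear by blast
  \<comment> \<open>The chain rule, with \<open>Dg\<close> expanded in a basis to expose a sum of products.\<close>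
  have e: "?g (f x) (?f x v) = (\<Sum>b\<in>Basis. (?f x v \<bullet> b) *\<^sub>R ?g (f x) b)" if "x \<in> S" for x v
    using gl[OF that] by (subst euclidean_representation[of "?f x v", symmetric])
      (simp add: linear_sum linear_cmul bounded_linear.linear del: euclidean_representation)
  show ?case
  proof (rule Ck_on_SucI[where f'="\<lambda>x v. ?g (f x) (?f x v)"])
    fix x assume "x \<in> S"
    then show "((\<lambda>x. g (f x)) has_derivative (\<lambda>v. ?g (f x) (?f x v))) (at x)"
      using has_derivative_compose[of f "?f x" x UNIV g "?g (f x)"] Suc.prems
      by (blast intro: Ck_on_has_derivative)
  next
    fix v
    show "Ck_on k S (\<lambda>x. ?g (f x) (?f x v))"
    proof (rule Ck_on_cong[OF assms(1)])
      show "Ck_on k S (\<lambda>x. \<Sum>b\<in>Basis. (?f x v \<bullet> b) *\<^sub>R ?g (f x) b)"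
        by (intro Ck_on_sum assms Ck_on_bilinear[OF bounded_bilinear_scaleR]
            Ck_on_bilinear[OF bounded_bilinear_inner] Ck_on_const Suc.IH)
          (use Suc.prems Ck_on_SucD[OF Suc.prems(1)] in auto)
    qed (simp add: e)
  qed (rule assms)
qed

lemma Ck_on_Union:
  assumes "\<And>T. T \<in> \<T> \<Longrightarrow> open T \<and> Ck_on k T f"
  shows "Ck_on k (\<Union>\<T>) f"
  using assms
proof (induction k arbitrary: f)
  case 0
  then show ?case
    by (simp add: continuous_on_open_Union)
next
  case (Suc k)
  then show ?case by (simp; blast)
qed

lemma Ck_on_inverse: "Ck_on k {x::real. x \<noteq> 0} inverse"
proof (induction k)
  case (Suc k)
  have o: "open {x::real. x \<noteq> 0}" by (rule open_Collect_neq) (auto intro: continuous_intros)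
  show ?case
  proof (rule Ck_on_SucI[where f'="\<lambda>x v. - (inverse x * v * inverse x)"])
    fix v
    have "Ck_on k {x::real. x \<noteq> 0} (\<lambda>x. inverse x * (- v) * inverse x)"
      by (intro Ck_on_bilinear[OF bounded_bilinear_mult] Ck_on_const o Suc)
    then show "Ck_on k {x::real. x \<noteq> 0} (\<lambda>x. - (inverse x * v * inverse x))" by simp
  qed (use o in \<open>auto intro!: has_derivative_inverse'\<close>)
qed (auto intro!: continuous_intros)

lemma Ck_on_sqrt: "Ck_on k {0<..} sqrt"
proof (induction k)
  case (Suc k)
  have o: "open {x::real. x \<noteq> 0}" by (rule open_Collect_neq) (auto intro: continuous_intros)
  show ?case
  proof (rule Ck_on_SucI[where f'="\<lambda>x v. v * (inverse (sqrt x) * (1/2))"])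
    fix x :: real assume "x \<in> {0<..}"
    then show "(sqrt has_derivative (\<lambda>v. v * (inverse (sqrt x) * (1/2)))) (at x)"
      using DERIV_real_sqrt[of x] by (simp add: has_field_derivative_def field_simps)
        (metis (no_types, lifting) ext mult.commute times_divide_eq_left mult_1)
  next
    fix v
    show "Ck_on k {0<..} (\<lambda>x. v * (inverse (sqrt x) * (1 / 2)))"
      by (intro Ck_on_bilinear[OF bounded_bilinear_mult] Ck_on_const
          Ck_on_compose[OF _ o Suc.IH Ck_on_inverse]) auto
  qed simp
qed (auto intro!: continuous_intros)

named_theorems smooth_intros

lemma smooth_on_cong:
  "open S \<Longrightarrow> smooth_on S f \<Longrightarrow> (\<And>x. x \<in> S \<Longrightarrow> f x = g x) \<Longrightarrow> smooth_on S g"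
  unfolding smooth_on_def using Ck_on_cong by blast

lemma smooth_on_subset: "smooth_on S f \<Longrightarrow> T \<subseteq> S \<Longrightarrow> smooth_on T f"
  unfolding smooth_on_def using Ck_on_subset by blast

lemma smooth_on_continuous: "smooth_on S f \<Longrightarrow> continuous_on S f"
  unfolding smooth_on_def using Ck_on_continuous by blast

lemma smooth_on_has_derivative:
  "smooth_on S f \<Longrightarrow> x \<in> S \<Longrightarrow> (f has_derivative frechet_derivative f (at x)) (at x)"
  unfolding smooth_on_def using Ck_on_has_derivative by blast

lemma smooth_on_differentiable: "smooth_on S f \<Longrightarrow> x \<in> S \<Longrightarrow> f differentiable (at x)"
  using smooth_on_has_derivative differentiable_def by blast

lemma smooth_on_frechet_derivative [smooth_intros]:
  "smooth_on S f \<Longrightarrow> smooth_on S (\<lambda>x. frechet_derivative f (at x) v)"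
  unfolding smooth_on_def
proof
  fix k
  assume "\<forall>k. Ck_on k S f"
  then have "Ck_on (Suc k) S f" by blast
  then show "Ck_on k S (\<lambda>x. frechet_derivative f (at x) v)" by simp
qed

lemma smooth_on_const [smooth_intros]: "open S \<Longrightarrow> smooth_on S (\<lambda>x. c)"
  unfolding smooth_on_def using Ck_on_const by blast

lemma smooth_on_bounded_linear: "open S \<Longrightarrow> bounded_linear L \<Longrightarrow> smooth_on S L"
  unfolding smooth_on_def using Ck_on_linear by blast

lemma smooth_on_ident [smooth_intros]: "open S \<Longrightarrow> smooth_on S (\<lambda>x. x)"
  by (rule smooth_on_bounded_linear) (auto intro: bounded_linear_ident)

lemma smooth_on_add [smooth_intros]:
  "open S \<Longrightarrow> smooth_on S f \<Longrightarrow> smooth_on S g \<Longrightarrow> smooth_on S (\<lambda>x. f x + g x)"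
  by (simp add: smooth_on_def Ck_on_add)

lemma smooth_on_sum [smooth_intros]:
  "open S \<Longrightarrow> (\<And>i. i \<in> I \<Longrightarrow> smooth_on S (f i)) \<Longrightarrow> smooth_on S (\<lambda>x. \<Sum>i\<in>I. f i x)"
  by (simp add: smooth_on_def Ck_on_sum)

lemma smooth_on_bilinear:
  "bounded_bilinear prd \<Longrightarrow> open S \<Longrightarrow> smooth_on S f \<Longrightarrow> smooth_on S g \<Longrightarrow>
    smooth_on S (\<lambda>x. prd (f x) (g x))"
  by (simp add: smooth_on_def Ck_on_bilinear)

lemmas smooth_on_mult [smooth_intros] =
    smooth_on_bilinear[OF bounded_bilinear_mult[where 'a=real]]
  and smooth_on_scaleR [smooth_intros] = smooth_on_bilinear[OF bounded_bilinear_scaleR]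
  and smooth_on_inner [smooth_intros] = smooth_on_bilinear[OF bounded_bilinear_inner]

lemma smooth_on_compose:
  fixes f :: "'a::euclidean_space \<Rightarrow> 'b::euclidean_space" and g :: "'b \<Rightarrow> 'c::euclidean_space"
  shows "open S \<Longrightarrow> open T \<Longrightarrow> smooth_on T g \<Longrightarrow> smooth_on S f \<Longrightarrow> f ` S \<subseteq> T \<Longrightarrow>
    smooth_on S (\<lambda>x. g (f x))"
  by (simp add: smooth_on_def Ck_on_compose[of S T])

lemma smooth_on_linear_compose:
  fixes f :: "'a::euclidean_space \<Rightarrow> 'b::euclidean_space" and L :: "'b \<Rightarrow> 'c::euclidean_space"
  shows "bounded_linear L \<Longrightarrow> open S \<Longrightarrow> smooth_on S f \<Longrightarrow> smooth_on S (\<lambda>x. L (f x))"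
  by (rule smooth_on_compose[where T=UNIV]) (auto intro: smooth_on_bounded_linear)

lemma smooth_on_minus [smooth_intros]: "open S \<Longrightarrow> smooth_on S f \<Longrightarrow> smooth_on S (\<lambda>x. - f x)"
  using smooth_on_linear_compose[OF bounded_linear_minus[OF bounded_linear_ident]] .

lemma smooth_on_diff [smooth_intros]:
  "open S \<Longrightarrow> smooth_on S f \<Longrightarrow> smooth_on S g \<Longrightarrow> smooth_on S (\<lambda>x. f x - g x)"
  using smooth_on_add[of S f "\<lambda>x. - g x"] by (simp add: smooth_on_minus)

lemma smooth_on_Pair [smooth_intros]:
  fixes f :: "'a::euclidean_space \<Rightarrow> 'b::euclidean_space" and g :: "'a \<Rightarrow> 'c::euclidean_space"
  assumes "open S" "smooth_on S f" "smooth_on S g"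
  shows "smooth_on S (\<lambda>x. (f x, g x))"
proof -
  have "smooth_on S (\<lambda>x. (f x, 0) + (0, g x))"
    by (intro smooth_on_add assms smooth_on_linear_compose[where L="\<lambda>y. (y, 0)"]
        smooth_on_linear_compose[where L="\<lambda>y. (0, y)"] bounded_linear_Pair
        bounded_linear_ident bounded_linear_zero)
  then show ?thesis by simp
qed

lemma smooth_on_prod [smooth_intros]:
  fixes f :: "'i \<Rightarrow> 'a::euclidean_space \<Rightarrow> real"
  shows "open S \<Longrightarrow> (\<And>i. i \<in> I \<Longrightarrow> smooth_on S (f i)) \<Longrightarrow> smooth_on S (\<lambda>x. \<Prod>i\<in>I. f i x)"
  by (induction I rule: infinite_finite_induct) (auto intro!: smooth_intros)

lemma smooth_on_inverse [smooth_intros]: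
  fixes f :: "'a::euclidean_space \<Rightarrow> real"
  shows "open S \<Longrightarrow> smooth_on S f \<Longrightarrow> (\<And>x. x \<in> S \<Longrightarrow> f x \<noteq> 0) \<Longrightarrow>
    smooth_on S (\<lambda>x. inverse (f x))"
  by (rule smooth_on_compose[where T="{x. x \<noteq> 0}"])
    (use Ck_on_inverse in \<open>auto simp: smooth_on_def open_Collect_neq\<close>)

lemma smooth_on_divide [smooth_intros]:
  fixes f g :: "'a::euclidean_space \<Rightarrow> real"
  shows "open S \<Longrightarrow> smooth_on S f \<Longrightarrow> smooth_on S g \<Longrightarrow> (\<And>x. x \<in> S \<Longrightarrow> g x \<noteq> 0) \<Longrightarrow>
    smooth_on S (\<lambda>x. f x / g x)"
  unfolding divide_inverse by (intro smooth_intros)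

lemma smooth_on_sqrt [smooth_intros]:
  fixes f :: "'a::euclidean_space \<Rightarrow> real"
  shows "open S \<Longrightarrow> smooth_on S f \<Longrightarrow> (\<And>x. x \<in> S \<Longrightarrow> f x > 0) \<Longrightarrow> smooth_on S (\<lambda>x. sqrt (f x))"
  by (rule smooth_on_compose[where T="{0<..}"]) (use Ck_on_sqrt in \<open>auto simp: smooth_on_def\<close>)

lemma smooth_on_det [smooth_intros]:
  fixes f :: "'n::finite \<Rightarrow> 'n \<Rightarrow> 'a::euclidean_space \<Rightarrow> real"
  assumes "open S" "\<And>i j. smooth_on S (f i j)"
  shows "smooth_on S (\<lambda>x. det (\<chi> i j. f i j x))"
  unfolding det_def using assms by (auto intro!: smooth_intros)

lemma smooth_on_Union:
  "(\<And>T. T \<in> \<T> \<Longrightarrow> open T \<and> smooth_on T f) \<Longrightarrow> smooth_on (\<Union>\<T>) f"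
  by (simp add: smooth_on_def Ck_on_Union)

lemma smooth_on_Un:
  "open S \<Longrightarrow> open T \<Longrightarrow> smooth_on S f \<Longrightarrow> smooth_on T f \<Longrightarrow> smooth_on (S \<union> T) f"
  using smooth_on_Union[of "{S, T}" f] by auto

lemma smooth_on_locally:
  assumes "\<And>x. x \<in> S \<Longrightarrow> \<exists>T. open T \<and> x \<in> T \<and> smooth_on T f"
  shows "smooth_on S f"
proof -
  have "smooth_on (\<Union>{T. open T \<and> smooth_on T f}) f" by (rule smooth_on_Union) auto
  then show ?thesis by (rule smooth_on_subset) (use assms in blast)
qed

subsection \<open>Bump functions\<close>

text \<open>
  The derivatives of \<open>exp (- 1 / x)\<close>, continued by \<open>0\<close>, are combinations of these functions, so
  all of them are smooth by a simultaneous induction.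
\<close>

definition flat :: "nat \<Rightarrow> real \<Rightarrow> real" where
  "flat n x = (if x > 0 then inverse x ^ n * exp (- inverse x) else 0)"

lemma flat_tendsto_0: "(flat n \<longlongrightarrow> 0) (at 0)"
proof (rule filterlim_split_at)
  have "((\<lambda>x. 0::real) \<longlongrightarrow> 0) (at_left 0)" by simp
  then show "(flat n \<longlongrightarrow> 0) (at_left 0)"
    by (rule Lim_transform_eventually) (auto simp: eventually_at_left_field flat_def intro!: exI[of _ "-1"])
next
  have "((\<lambda>x::real. inverse x ^ n / exp (inverse x)) \<longlongrightarrow> 0) (at_right 0)"
    by (rule filterlim_compose[OF tendsto_power_div_exp_0 filterlim_inverse_at_top_right])
  then show "(flat n \<longlongrightarrow> 0) (at_right 0)"
    by (rule Lim_transform_eventually)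
      (auto simp: eventually_at_right_field flat_def exp_minus divide_inverse intro!: exI[of _ 1])
qed

lemma flat_has_derivative:
  "(flat n has_derivative (\<lambda>v. (flat (n + 2) x - n * flat (Suc n) x) * v)) (at x)"
proof (cases "x = 0")
  case True
  have "((\<lambda>h. (flat n (0 + h) - flat n 0) / h) \<longlongrightarrow> 0) (at 0)"
    by (rule Lim_transform_eventually[OF flat_tendsto_0[of "Suc n"]])
      (auto simp: flat_def eventually_at_filter divide_inverse)
  then have "DERIV (flat n) 0 :> 0" by (simp add: DERIV_def)
  then show ?thesis using True by (simp add: has_field_derivative_def flat_def lambda_zero)
next
  case False
  show ?thesis
  proof (cases "x > 0")
    case True
    have "((\<lambda>x. inverse x ^ n * exp (- inverse x)) has_real_derivative
        (real n * ((- (inverse x ^ Suc (Suc 0))) * inverse x ^ (n - Suc 0))) * exp (- inverse x)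
        + (exp (- inverse x) * (- (- (inverse x ^ Suc (Suc 0))))) * inverse x ^ n) (at x)"
      using True by (intro DERIV_mult DERIV_power DERIV_fun_exp DERIV_minus DERIV_inverse) auto
    also have "(real n * ((- (inverse x ^ Suc (Suc 0))) * inverse x ^ (n - Suc 0))) * exp (- inverse x)
        + (exp (- inverse x) * (- (- (inverse x ^ Suc (Suc 0))))) * inverse x ^ n
        = flat (n + 2) x - n * flat (Suc n) x"
      using True by (cases n) (simp_all add: flat_def algebra_simps)
    finally have "((\<lambda>x. inverse x ^ n * exp (- inverse x)) has_real_derivative
        (flat (n + 2) x - n * flat (Suc n) x)) (at x)" .
    then have "(flat n has_real_derivative (flat (n + 2) x - n * flat (Suc n) x)) (at x)"
      by (rule has_field_derivative_transform_within_open[of _ _ _ "{0<..}"])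
        (use True in \<open>auto simp: flat_def\<close>)
    then show ?thesis by (simp add: has_field_derivative_def)
  next
    case neg: False
    have "((\<lambda>x. 0) has_real_derivative (flat (n + 2) x - n * flat (Suc n) x)) (at x)"
      using neg by (simp add: flat_def)
    then have "(flat n has_real_derivative (flat (n + 2) x - n * flat (Suc n) x)) (at x)"
      by (rule has_field_derivative_transform_within_open[of _ _ _ "{..<0}"])
        (use False neg in \<open>auto simp: flat_def\<close>)
    then show ?thesis by (simp add: has_field_derivative_def)
  qed
qed

lemma smooth_on_flat: "smooth_on UNIV (flat n)"
proof -
  have "Ck_on k UNIV (flat n)" for k n
  proof (induction k arbitrary: n)
    case 0
    show ?case
      using has_derivative_continuous[OF flat_has_derivative]
      by (simp add: continuous_on_eq_continuous_at)
  next
    case (Suc k)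
    show ?case
    proof (rule Ck_on_SucI[OF open_UNIV flat_has_derivative])
      fix v
      have "Ck_on k UNIV (\<lambda>x. (flat (n + 2) x + (- real n) * flat (Suc n) x) * v)"
        by (intro Ck_on_bilinear[OF bounded_bilinear_mult] Ck_on_add Ck_on_const Suc open_UNIV)
      then show "Ck_on k UNIV (\<lambda>x. (flat (n + 2) x - real n * flat (Suc n) x) * v)" by simp
    qed
  qed
  then show ?thesis by (simp add: smooth_on_def)
qed

definition bump :: "'a::euclidean_space \<Rightarrow> real \<Rightarrow> 'a \<Rightarrow> real" where
  "bump a r x = flat 0 (r\<^sup>2 - (x - a) \<bullet> (x - a))"

lemma smooth_on_bump: "smooth_on UNIV (bump a r)"
  unfolding bump_def
  by (intro smooth_on_compose[OF _ _ smooth_on_flat] smooth_intros open_UNIV subset_UNIV)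

lemma bump_nonneg: "bump a r x \<ge> 0"
  by (simp add: bump_def flat_def)

lemma bump_pos: "x \<in> ball a r \<Longrightarrow> bump a r x > 0"
  by (auto simp: bump_def flat_def dist_norm dot_square_norm norm_minus_commute
      intro!: power_strict_mono)

lemma bump_zero: "r > 0 \<Longrightarrow> x \<notin> ball a r \<Longrightarrow> bump a r x = 0"
  by (auto simp: bump_def flat_def dist_norm dot_square_norm norm_minus_commute not_less
      intro!: power_mono)

subsection \<open>Symmetry of second derivatives\<close>

text \<open>
  The mean value theorem is applied in direction \<open>u\<close>, then in direction \<open>v\<close>. The left-hand side is
  symmetric in \<open>u\<close> and \<open>v\<close>, so the second derivatives in either order take a common value at
  points arbitrarily close to \<open>x\<close>.
\<close>

lemma second_difference_mean_value:
  fixes f :: "'a::euclidean_space \<Rightarrow> real"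
  assumes f: "smooth_on (ball x r) f" and d: "d > 0" "d * (norm u + norm v) < r"
  shows "\<exists>y\<in>ball x r. f (x + d *\<^sub>R u + d *\<^sub>R v) - f (x + d *\<^sub>R u) - f (x + d *\<^sub>R v) + f x =
      d * d * frechet_derivative (\<lambda>y. frechet_derivative f (at y) u) (at y) v"
proof -
  let ?D = "\<lambda>y. frechet_derivative f (at y)"
  let ?DD = "\<lambda>y. frechet_derivative (\<lambda>y. ?D y u) (at y)"
  have in_ball: "x + s *\<^sub>R u + t *\<^sub>R v \<in> ball x r" if "0 \<le> s" "s \<le> d" "0 \<le> t" "t \<le> d" for s t
  proof -
    have "norm (s *\<^sub>R u + t *\<^sub>R v) \<le> s * norm u + t * norm v"
      using norm_triangle_ineq[of "s *\<^sub>R u" "t *\<^sub>R v"] that by simp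
    also have "\<dots> \<le> d * norm u + d * norm v"
      by (intro add_mono mult_right_mono that) auto
    finally have "norm (s *\<^sub>R u + t *\<^sub>R v) < r" using d by (simp add: algebra_simps)
    moreover have "dist x (x + s *\<^sub>R u + t *\<^sub>R v) = norm (s *\<^sub>R u + t *\<^sub>R v)"
      by (metis add.assoc add_diff_cancel_left' dist_commute dist_norm)
    ultimately show ?thesis by simp
  qed
  have in0: "x + s *\<^sub>R u \<in> ball x r" if "0 \<le> s" "s \<le> d" for s
    using in_ball[OF that, of 0] d by simp
  have curve: "((\<lambda>s. g (p + s *\<^sub>R w)) has_real_derivative frechet_derivative g (at (p + s *\<^sub>R w)) w) (at s)"
    if g: "smooth_on (ball x r) g" and p: "p + s *\<^sub>R w \<in> ball x r" for g :: "'a \<Rightarrow> real" and p w s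
  proof -
    have G: "(g has_derivative frechet_derivative g (at (p + s *\<^sub>R w))) (at (p + s *\<^sub>R w))"
      using smooth_on_has_derivative[OF g p] .
    have c: "((\<lambda>s. p + s *\<^sub>R w) has_derivative (\<lambda>h. h *\<^sub>R w)) (at s)"
      by (auto intro!: derivative_eq_intros)
    have "((\<lambda>s. g (p + s *\<^sub>R w)) has_derivative
        (\<lambda>h. frechet_derivative g (at (p + s *\<^sub>R w)) (h *\<^sub>R w))) (at s)"
      using has_derivative_compose[OF c G] .
    then show ?thesis
      by (simp add: has_field_derivative_def linear_cmul[OF has_derivative_linear[OF G]] mult_commute_abs)
  qed
  have A: "((\<lambda>s. f ((x + d *\<^sub>R v) + s *\<^sub>R u) - f (x + s *\<^sub>R u)) has_real_derivative
      ?D ((x + d *\<^sub>R v) + s *\<^sub>R u) u - ?D (x + s *\<^sub>R u) u) (at s)" if "0 \<le> s" "s \<le> d" for s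
    by (rule DERIV_diff; rule curve[OF f])
      (use in_ball[OF that, of d] in0[OF that] d in \<open>auto simp: algebra_simps\<close>)
  obtain s where s: "0 < s" "s < d" and
    s': "(f ((x + d *\<^sub>R v) + d *\<^sub>R u) - f (x + d *\<^sub>R u)) - (f ((x + d *\<^sub>R v) + 0 *\<^sub>R u) - f (x + 0 *\<^sub>R u))
      = (d - 0) * (?D ((x + d *\<^sub>R v) + s *\<^sub>R u) u - ?D (x + s *\<^sub>R u) u)"
    using MVT2[OF d(1), OF A] by auto
  have B: "((\<lambda>t. ?D ((x + s *\<^sub>R u) + t *\<^sub>R v) u) has_real_derivative
      ?DD ((x + s *\<^sub>R u) + t *\<^sub>R v) v) (at t)" if "0 \<le> t" "t \<le> d" for t
    by (rule curve[OF smooth_on_frechet_derivative[OF f]]) (use in_ball[of s t] s that in auto)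
  obtain t where t: "0 < t" "t < d" and
    t': "?D ((x + s *\<^sub>R u) + d *\<^sub>R v) u - ?D ((x + s *\<^sub>R u) + 0 *\<^sub>R v) u
      = (d - 0) * ?DD ((x + s *\<^sub>R u) + t *\<^sub>R v) v"
    using MVT2[OF d(1), OF B] by auto
  have "?D ((x + d *\<^sub>R v) + s *\<^sub>R u) u - ?D (x + s *\<^sub>R u) u = d * ?DD (x + s *\<^sub>R u + t *\<^sub>R v) v"
    using t' by (simp add: algebra_simps)
  with s' have "f (x + d *\<^sub>R u + d *\<^sub>R v) - f (x + d *\<^sub>R u) - f (x + d *\<^sub>R v) + f x
      = d * d * ?DD (x + s *\<^sub>R u + t *\<^sub>R v) v"
    by (simp add: algebra_simps)
  moreover have "x + s *\<^sub>R u + t *\<^sub>R v \<in> ball x r" using in_ball s t by simp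
  ultimately show ?thesis by blast
qed

lemma second_derivative_symmetric_real:
  fixes f :: "'a::euclidean_space \<Rightarrow> real"
  assumes f: "smooth_on S f" and S: "open S" "x \<in> S"
  shows "frechet_derivative (\<lambda>y. frechet_derivative f (at y) u) (at x) v =
    frechet_derivative (\<lambda>y. frechet_derivative f (at y) v) (at x) u"
proof -
  define P where "P = (\<lambda>y. frechet_derivative (\<lambda>y. frechet_derivative f (at y) u) (at y) v)"
  define R where "R = (\<lambda>y. frechet_derivative (\<lambda>y. frechet_derivative f (at y) v) (at y) u)"
  obtain r0 where r0: "r0 > 0" "ball x r0 \<subseteq> S" using S openE by blast
  have "\<exists>y z. y \<in> ball x r \<and> z \<in> ball x r \<and> P y = R z" if "r > 0" "r \<le> r0" for r
  proof -
    have fr: "smooth_on (ball x r) f"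
      using f r0 that by (meson smooth_on_subset order_trans subset_ball)
    define d where "d = (r / 2) / (norm u + norm v + 1)"
    have den: "norm u + norm v + 1 > 0" by (simp add: add_nonneg_pos)
    have d: "d > 0" using den that by (simp add: d_def)
    have "d * (norm u + norm v) \<le> d * (norm u + norm v + 1)" using d by simp
    also have "\<dots> = r / 2"
      using den nonzero_eq_divide_eq[of "norm u + norm v + 1" d "r / 2"] by (simp only: d_def) simp
    finally have d2: "d * (norm u + norm v) < r" using that by simp
    obtain y z where yz: "y \<in> ball x r" "z \<in> ball x r" and
      y: "f (x + d *\<^sub>R u + d *\<^sub>R v) - f (x + d *\<^sub>R u) - f (x + d *\<^sub>R v) + f x = d * d * P y" and
      z: "f (x + d *\<^sub>R v + d *\<^sub>R u) - f (x + d *\<^sub>R v) - f (x + d *\<^sub>R u) + f x = d * d * R z"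
      using second_difference_mean_value[OF fr d d2]
        second_difference_mean_value[OF fr d, of v u] d2
      unfolding P_def R_def by (auto simp: add.commute)
    have "d * d * P y = d * d * R z" using y z by (simp add: algebra_simps)
    then show ?thesis using yz d by auto
  qed
  then have "\<exists>y z. y \<in> ball x (r0 / real (Suc n)) \<and> z \<in> ball x (r0 / real (Suc n)) \<and> P y = R z" for n
    using r0 by (simp add: divide_le_eq algebra_simps)
  then obtain y z where yz: "\<And>n. y n \<in> ball x (r0 / real (Suc n))" "\<And>n. z n \<in> ball x (r0 / real (Suc n))"
    "\<And>n. P (y n) = R (z n)" by metis
  have lim: "w \<longlonglongrightarrow> x" if "\<And>n. w n \<in> ball x (r0 / real (Suc n))" for w
  proof (rule metric_tendsto_imp_tendsto)
    show "(\<lambda>n. r0 / real (Suc n)) \<longlonglongrightarrow> 0" using LIMSEQ_Suc[OF lim_const_over_n] .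
    show "\<forall>\<^sub>F n in sequentially. dist (w n) x \<le> dist (r0 / real (Suc n)) 0"
      using that r0 by (intro always_eventually) (auto simp: dist_commute less_imp_le)
  qed
  have c: "isCont P x" "isCont R x" unfolding P_def R_def
    using f S by (auto intro!: continuous_on_interior[of S] smooth_on_continuous smooth_intros
        simp: interior_open)
  have "(\<lambda>n. P (y n)) \<longlonglongrightarrow> P x" "(\<lambda>n. R (z n)) \<longlonglongrightarrow> R x"
    using c lim[OF yz(1)] lim[OF yz(2)] by (auto intro: isCont_tendsto_compose)
  then have "P x = R x" using yz(3) LIMSEQ_unique by fastforce
  then show ?thesis by (simp add: P_def R_def)
qed

lemma frechet_derivative_inner_const:
  assumes "f differentiable (at x)"
  shows "frechet_derivative (\<lambda>y. f y \<bullet> c) (at x) v = frechet_derivative f (at x) v \<bullet> c"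
  using has_derivative_inner_left[of f "frechet_derivative f (at x)" "at x" c] assms
  by (metis frechet_derivative_at frechet_derivative_works)

lemma second_derivative_symmetric:
  fixes f :: "'a::euclidean_space \<Rightarrow> 'b::euclidean_space"
  assumes f: "smooth_on S f" and S: "open S" "x \<in> S"
  shows "frechet_derivative (\<lambda>y. frechet_derivative f (at y) u) (at x) v =
    frechet_derivative (\<lambda>y. frechet_derivative f (at y) v) (at x) u"
proof (rule euclidean_eqI)
  fix b :: 'b
  have *: "frechet_derivative (\<lambda>y. frechet_derivative (\<lambda>y. f y \<bullet> b) (at y) u) (at x) v
    = frechet_derivative (\<lambda>y. frechet_derivative f (at y) u) (at x) v \<bullet> b" for u v
  proof -
    have e: "frechet_derivative (\<lambda>y. f y \<bullet> b) (at y) u = frechet_derivative f (at y) u \<bullet> b"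
      if "y \<in> S" for y
      using frechet_derivative_inner_const smooth_on_differentiable[OF f that] by blast
    have "smooth_on S (\<lambda>y. frechet_derivative (\<lambda>y. f y \<bullet> b) (at y) u)"
      by (intro smooth_intros S f)
    then have "frechet_derivative (\<lambda>y. frechet_derivative (\<lambda>y. f y \<bullet> b) (at y) u) (at x)
      = frechet_derivative (\<lambda>y. frechet_derivative f (at y) u \<bullet> b) (at x)"
      by (intro frechet_derivative_transform_within_open[OF _ S e]) (rule smooth_on_differentiable[OF _ S(2)])
    then show ?thesis
      using smooth_on_differentiable[OF smooth_on_frechet_derivative[OF f] S(2)]
      by (simp add: frechet_derivative_inner_const)
  qed
  have "smooth_on S (\<lambda>y. f y \<bullet> b)" by (intro smooth_intros S f)
  from second_derivative_symmetric_real[OF this S, of u v]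
  show "frechet_derivative (\<lambda>y. frechet_derivative f (at y) u) (at x) v \<bullet> b =
    frechet_derivative (\<lambda>y. frechet_derivative f (at y) v) (at x) u \<bullet> b"
    by (simp add: *)
qed

section \<open>Determinants and Gram matrices\<close>

text \<open>
  The segment from the identity to \<open>M\<close> consists of positive definite, hence invertible matrices, so
  the determinant does not change sign on it.
\<close>

lemma det_pos_of_posdef:
  fixes M :: "real ^ 'n::finite ^ 'n"
  assumes pos: "\<And>v. v \<noteq> 0 \<Longrightarrow> v \<bullet> (M *v v) > 0"
  shows "det M > 0"
proof (rule ccontr)
  assume neg: "\<not> det M > 0"
  define N where "N = (\<lambda>t::real. \<chi> i j. (1 - t) * (if i = j then 1 else 0) + t * M $ i $ j)"
  have N: "N t *v v = (1 - t) *\<^sub>R v + t *\<^sub>R (M *v v)" for t v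
    by (simp add: vec_eq_iff N_def matrix_vector_mult_def sum.distrib distrib_right
        sum_distrib_left mult.assoc if_distrib [of "\<lambda>a. a * _"] if_distrib [of "\<lambda>a. _ * a"]
        cong: if_cong)
  have "smooth_on UNIV (\<lambda>t. det (N t))" unfolding N_def by (intro smooth_intros open_UNIV)
  then have "continuous_on {0..1} (\<lambda>t. det (N t))"
    using smooth_on_continuous continuous_on_subset by blast
  moreover have "det (N 1) \<le> 0" "0 \<le> det (N 0)"
    using neg by (simp_all add: N_def not_less flip: mat_def)
  ultimately obtain t where t: "0 \<le> t" "t \<le> 1" "det (N t) = 0"
    using IVT2'[of "\<lambda>t. det (N t)" 1 0 0] by auto
  then obtain v where v: "v \<noteq> 0" "N t *v v = 0"
    using invertible_det_nz[of "N t"] matrix_left_invertible_ker[of "N t"]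
    by (auto simp: invertible_left_inverse)
  have "0 = v \<bullet> (N t *v v)" using v by simp
  also have "\<dots> = (1 - t) * (v \<bullet> v) + t * (v \<bullet> (M *v v))"
    by (simp add: N inner_add_right)
  also have "\<dots> > 0"
    using pos[OF v(1)] v(1) t by (cases "t = 0") (auto intro!: add_nonneg_pos)
  finally show False by simp
qed

lemma det_combine_rows:
  fixes M :: "'n::finite \<Rightarrow> real ^ 'n"
  shows "det (\<chi> j. if j = i then (\<Sum>k\<in>UNIV. c k *s M k) else M j) = c i * det (\<chi> j. M j)"
proof -
  have "det (\<chi> j. if j = i then (\<Sum>k\<in>UNIV. c k *s M k) else M j)
      = (\<Sum>k\<in>UNIV. det (\<chi> j. if j = i then c k *s M k else M j))"
    using det_linear_row_sum[of UNIV i "\<lambda>_ k. c k *s M k" M] by simp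
  also have "\<dots> = (\<Sum>k\<in>UNIV. c k * det (\<chi> j. if j = i then M k else M j))"
    using det_row_mul[of i "c k" "\<lambda>_. M k" M for k] by simp
  also have "\<dots> = (\<Sum>k\<in>UNIV. if k = i then c i * det (\<chi> j. M j) else 0)"
  proof (intro sum.cong refl)
    fix k
    show "c k * det (\<chi> j. if j = i then M k else M j) = (if k = i then c i * det (\<chi> j. M j) else 0)"
    proof (cases "k = i")
      case True
      then have "(\<chi> j. if j = i then M k else M j) = (\<chi> j. M j)" by (simp add: vec_eq_iff)
      with True show ?thesis by simp
    next
      case False
      then have "det (\<chi> j. if j = i then M k else M j) = 0"
        by (intro det_identical_rows[of k i]) (auto simp: row_def vec_eq_iff)
      with False show ?thesis by simp
    qed
  qed
  also have "\<dots> = c i * det (\<chi> j. M j)" by simp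
  finally show ?thesis .
qed

lemma has_derivative_det_rows:
  fixes M :: "'n::finite \<Rightarrow> 'n \<Rightarrow> 'a::euclidean_space \<Rightarrow> real"
  assumes "\<And>i j. (M i j has_derivative M' i j) (at x)"
  shows "((\<lambda>x. det (\<chi> i j. M i j x)) has_derivative
    (\<lambda>v. \<Sum>i\<in>UNIV. det (\<chi> j. if j = i then (\<chi> k. M' i k v) else (\<chi> k. M j k x)))) (at x)"
proof -
  let ?P = "{p. p permutes (UNIV :: 'n set)}"
  have P: "finite ?P" by (rule finite_permutations) simp
  have prod_row: "(\<Prod>j\<in>UNIV. (\<chi> j. if j = i then (\<chi> k. M' i k v) else (\<chi> k. M j k x)) $ j $ p j)
      = M' i (p i) v * (\<Prod>j\<in>UNIV - {i}. M j (p j) x)" for i v p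
    by (subst prod.remove[of _ i]) (auto intro!: prod.cong)
  have "((\<lambda>x. \<Sum>p\<in>?P. of_int (sign p) * (\<Prod>i\<in>UNIV. M i (p i) x)) has_derivative
      (\<lambda>v. \<Sum>p\<in>?P. of_int (sign p) * (\<Sum>i\<in>UNIV. M' i (p i) v * (\<Prod>j\<in>UNIV - {i}. M j (p j) x)))) (at x)"
    by (intro has_derivative_sum has_derivative_mult_right has_derivative_prod assms)
  moreover have "(\<Sum>p\<in>?P. of_int (sign p) * (\<Sum>i\<in>UNIV. M' i (p i) v * (\<Prod>j\<in>UNIV - {i}. M j (p j) x)))
    = (\<Sum>i\<in>UNIV. det (\<chi> j. if j = i then (\<chi> k. M' i k v) else (\<chi> k. M j k x)))" for v
    unfolding det_def prod_row sum_distrib_left by (rule sum.swap)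
  moreover have "(\<lambda>x. \<Sum>p\<in>?P. of_int (sign p) * (\<Prod>i\<in>UNIV. M i (p i) x)) = (\<lambda>x. det (\<chi> i j. M i j x))"
    by (simp add: det_def)
  ultimately show ?thesis by (simp only:)
qed

text \<open>Jacobi's formula: if \<open>dM = C M\<close>, then \<open>d (det M) = tr C det M\<close>.\<close>

lemma has_derivative_det:
  fixes M :: "'n::finite \<Rightarrow> 'n \<Rightarrow> 'a::euclidean_space \<Rightarrow> real"
  assumes M: "\<And>i j. (M i j has_derivative M' i j) (at x)"
    and C: "\<And>i j v. M' i j v = (\<Sum>k\<in>UNIV. C i k v * M k j x)"
  shows "((\<lambda>x. det (\<chi> i j. M i j x)) has_derivative
    (\<lambda>v. (\<Sum>i\<in>UNIV. C i i v) * det (\<chi> i j. M i j x))) (at x)"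
proof -
  have "(\<chi> k. M' i k v) = (\<Sum>k\<in>UNIV. C i k v *s (\<chi> j. M k j x))" for i v
    by (simp add: vec_eq_iff C)
  then have "det (\<chi> j. if j = i then (\<chi> k. M' i k v) else (\<chi> k. M j k x))
      = C i i v * det (\<chi> i j. M i j x)" for i v
    by (simp only: det_combine_rows)
  then show ?thesis using has_derivative_det_rows[of M M', OF M] by (simp add: sum_distrib_right)
qed

section \<open>Parametrized immersions\<close>

definition pd :: "(real ^ 'n::finite \<Rightarrow> 'b::euclidean_space) \<Rightarrow> 'n \<Rightarrow> real ^ 'n \<Rightarrow> 'b" where
  "pd f i x = frechet_derivative f (at x) (axis i 1)"

lemma smooth_on_pd [smooth_intros]: "smooth_on S f \<Longrightarrow> smooth_on S (pd f i)"
  unfolding pd_def[abs_def] by (rule smooth_on_frechet_derivative)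

lemma pd_eqI: "(f has_derivative f') (at x) \<Longrightarrow> pd f i x = f' (axis i 1)"
  using frechet_derivative_at[of f f' x] by (simp add: pd_def)

lemma frechet_derivative_pd:
  assumes "f differentiable (at x)"
  shows "frechet_derivative f (at x) v = (\<Sum>i\<in>UNIV. v $ i *\<^sub>R pd f i x)"
proof -
  have "linear (frechet_derivative f (at x))" using linear_frechet_derivative[OF assms] .
  then show ?thesis
    by (subst basis_expansion[of v, symmetric])
      (simp add: linear_sum linear_cmul pd_def scalar_mult_eq_scaleR)
qed

lemma pd_cong:
  assumes "open S" "x \<in> S" "\<And>y. y \<in> S \<Longrightarrow> f y = g y" "f differentiable (at x)"
  shows "pd f i x = pd g i x"
  unfolding pd_def using frechet_derivative_transform_within_open[OF assms(4,1,2,3)] by simp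

lemma pd_const: "pd (\<lambda>x. c) i x = 0"
  by (simp add: pd_def)

lemma pd_bilinear:
  assumes "bounded_bilinear prd" "f differentiable (at x)" "g differentiable (at x)"
  shows "pd (\<lambda>x. prd (f x) (g x)) i x = prd (f x) (pd g i x) + prd (pd f i x) (g x)"
  using bounded_bilinear.FDERIV[OF assms(1), of f _ x UNIV g] assms(2,3)
  by (subst pd_eqI) (auto simp: pd_def frechet_derivative_works)

lemmas pd_mult = pd_bilinear[OF bounded_bilinear_mult[where 'a=real]]
  and pd_scaleR = pd_bilinear[OF bounded_bilinear_scaleR]
  and pd_inner = pd_bilinear[OF bounded_bilinear_inner]

lemma pd_sum:
  assumes "\<And>j. j \<in> J \<Longrightarrow> f j differentiable (at x)"
  shows "pd (\<lambda>x. \<Sum>j\<in>J. f j x) i x = (\<Sum>j\<in>J. pd (f j) i x)"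
  using has_derivative_sum[of J f _ "at x"] assms
  by (subst pd_eqI) (auto simp: pd_def frechet_derivative_works)

lemma pd_symmetric:
  "smooth_on S f \<Longrightarrow> open S \<Longrightarrow> x \<in> S \<Longrightarrow> pd (pd f i) j x = pd (pd f j) i x"
  unfolding pd_def[abs_def] by (rule second_derivative_symmetric)

locale parametrization =
  fixes U :: "(real ^ 'n::finite) set" and f :: "real ^ 'n \<Rightarrow> real ^ 'm::finite"
  assumes open_U: "open U" and smooth_f: "smooth_on U f"
    and inj_f: "\<And>x. x \<in> U \<Longrightarrow> inj (frechet_derivative f (at x))"
begin

definition G :: "real ^ 'n \<Rightarrow> real ^ 'n ^ 'n" where
  "G x = (\<chi> i j. pd f i x \<bullet> pd f j x)"

definition \<mu> :: "real ^ 'n \<Rightarrow> real" where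
  "\<mu> x = sqrt (det (G x))"

text \<open>The inverse of the Gram matrix, by Cramer's rule, which shows that it is smooth.\<close>

definition Q :: "'n \<Rightarrow> 'n \<Rightarrow> real ^ 'n \<Rightarrow> real" where
  "Q i j x = det (\<chi> k l. if l = i then (if k = j then 1 else 0) else pd f k x \<bullet> pd f l x) / det (G x)"

text \<open>The basis of the tangent space dual to the coordinate vector fields.\<close>

definition E :: "'n \<Rightarrow> real ^ 'n \<Rightarrow> real ^ 'm" where
  "E j x = (\<Sum>l\<in>UNIV. Q l j x *\<^sub>R pd f l x)"

definition T :: "real ^ 'n \<Rightarrow> (real ^ 'm) set" where
  "T x = range (frechet_derivative f (at x))"

lemma f_diff: "x \<in> U \<Longrightarrow> f differentiable (at x)"
  using smooth_on_differentiable smooth_f by blast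

lemma linear_f: "x \<in> U \<Longrightarrow> linear (frechet_derivative f (at x))"
  using linear_frechet_derivative f_diff by blast

lemma df_eq: "x \<in> U \<Longrightarrow> frechet_derivative f (at x) v = (\<Sum>i\<in>UNIV. v $ i *\<^sub>R pd f i x)"
  using frechet_derivative_pd f_diff by blast

lemma G_inner: "x \<in> U \<Longrightarrow>
    v \<bullet> (G x *v w) = frechet_derivative f (at x) v \<bullet> frechet_derivative f (at x) w"
proof -
  assume x: "x \<in> U"
  have "(G x *v w) $ i = pd f i x \<bullet> frechet_derivative f (at x) w" for i
    by (simp add: df_eq[OF x] G_def matrix_vector_mult_def inner_sum_right mult.commute)
  then have "v \<bullet> (G x *v w) = (\<Sum>i\<in>UNIV. v $ i * (pd f i x \<bullet> frechet_derivative f (at x) w))"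
    by (simp add: inner_vec_def[of v])
  then show ?thesis by (simp add: df_eq[OF x, of v] inner_sum_left)
qed

lemma det_G_pos: assumes "x \<in> U" shows "det (G x) > 0"
proof (rule det_pos_of_posdef)
  fix v :: "real ^ 'n" assume "v \<noteq> 0"
  then have "frechet_derivative f (at x) v \<noteq> 0"
    using inj_f[OF assms] linear_f[OF assms] by (metis injD linear_0)
  then show "v \<bullet> (G x *v v) > 0" using G_inner[OF assms] by simp
qed

lemma \<mu>_pos: "x \<in> U \<Longrightarrow> \<mu> x > 0"
  by (simp add: \<mu>_def det_G_pos)

lemma smooth_det_G [smooth_intros]: "smooth_on U (\<lambda>x. det (G x))"
  unfolding G_def by (intro smooth_intros open_U smooth_f)

lemma smooth_\<mu> [smooth_intros]: "smooth_on U \<mu>"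
  unfolding \<mu>_def[abs_def] by (intro smooth_intros open_U det_G_pos)

lemma smooth_Q [smooth_intros]: "smooth_on U (Q i j)"
proof -
  have "smooth_on U (\<lambda>x. if l = i then (if k = j then 1 else 0) else pd f k x \<bullet> pd f l x)" for k l
    by (cases "l = i") (auto intro!: smooth_intros open_U smooth_f)
  then show ?thesis unfolding Q_def[abs_def]
    using det_G_pos by (intro smooth_intros open_U) (auto simp: less_le)
qed

lemma smooth_E [smooth_intros]: "smooth_on U (E j)"
  unfolding E_def[abs_def] by (intro smooth_intros open_U smooth_f)

lemma pd_E: assumes "x \<in> U" shows "pd f k x \<bullet> E j x = (if k = j then 1 else 0)"
proof -
  have "(\<chi> l. Q l j x) = (\<chi> l. det (\<chi> i k. if k = l then axis j 1 $ i else G x $ i $ k) / det (G x))"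
    by (simp add: Q_def G_def axis_def vec_eq_iff cong: if_cong)
  then have "G x *v (\<chi> l. Q l j x) = axis j 1"
    using cramer[of "G x" "\<chi> l. Q l j x" "axis j 1"] det_G_pos[OF assms] by simp
  then have "(G x *v (\<chi> l. Q l j x)) $ k = axis j 1 $ k" by simp
  then show ?thesis
    by (simp add: E_def matrix_vector_mult_def G_def inner_sum_right axis_def mult.commute)
qed

lemma E_E: assumes "x \<in> U" shows "E i x \<bullet> E j x = Q i j x"
proof -
  have "E i x \<bullet> E j x = E j x \<bullet> E i x" by (rule inner_commute)
  also have "\<dots> = (\<Sum>l\<in>UNIV. Q l j x * (pd f l x \<bullet> E i x))"
    by (subst E_def) (simp add: inner_sum_left)
  also have "\<dots> = Q i j x"
    by (simp add: pd_E[OF assms] if_distrib [of "\<lambda>a. _ * a"] cong: if_cong)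
  finally show ?thesis .
qed

lemma Q_sym: "x \<in> U \<Longrightarrow> Q i j x = Q j i x"
  using E_E inner_commute by metis

lemma pd_in_T: "x \<in> U \<Longrightarrow> pd f i x \<in> T x"
  unfolding pd_def T_def by blast

lemma subspace_T: "x \<in> U \<Longrightarrow> subspace (T x)"
  unfolding T_def using linear_f linear_subspace_image subspace_UNIV by blast

lemma T_expand:
  assumes "x \<in> U" "w \<in> T x"
  shows "w = (\<Sum>i\<in>UNIV. (w \<bullet> E i x) *\<^sub>R pd f i x)"
proof -
  obtain v where v: "w = (\<Sum>i\<in>UNIV. v $ i *\<^sub>R pd f i x)" using assms df_eq by (auto simp: T_def)
  have "w \<bullet> E j x = v $ j" for j
    unfolding v by (simp add: inner_sum_left pd_E[OF assms(1)] if_distrib [of "\<lambda>a. _ * a"] cong: if_cong)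
  then show ?thesis using v by simp
qed

lemma T_expand_dual:
  assumes "x \<in> U" "w \<in> T x"
  shows "w = (\<Sum>i\<in>UNIV. (w \<bullet> pd f i x) *\<^sub>R E i x)"
proof -
  have "(\<Sum>i\<in>UNIV. (w \<bullet> pd f i x) *\<^sub>R E i x) = (\<Sum>i\<in>UNIV. \<Sum>l\<in>UNIV. (Q l i x * (w \<bullet> pd f i x)) *\<^sub>R pd f l x)"
    by (simp add: E_def scaleR_sum_right mult.commute)
  also have "\<dots> = (\<Sum>l\<in>UNIV. (\<Sum>i\<in>UNIV. Q l i x * (w \<bullet> pd f i x)) *\<^sub>R pd f l x)"
    by (subst sum.swap) (simp add: scaleR_sum_left)
  also have "\<dots> = (\<Sum>l\<in>UNIV. (w \<bullet> E l x) *\<^sub>R pd f l x)"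
    by (simp add: E_def inner_sum_right Q_sym[OF assms(1)])
  finally show ?thesis using T_expand[OF assms] by simp
qed

lemma orthogonal_TI: "x \<in> U \<Longrightarrow> (\<And>i. z \<bullet> pd f i x = 0) \<Longrightarrow> w \<in> T x \<Longrightarrow> z \<bullet> w = 0"
  by (subst T_expand[of x w]) (simp_all add: inner_sum_right)

lemma pd_pd_f_sym: "x \<in> U \<Longrightarrow> pd (pd f i) j x = pd (pd f j) i x"
  using pd_symmetric smooth_f open_U by blast

text \<open>
  From \<open>Q i j = E i \<bullet> E j\<close>, where the derivatives of \<open>E i\<close> are known in tangential directions from
  \<open>E i \<bullet> pd f k = \<delta>\<^sub>i\<^sub>k\<close>.
\<close>

lemma pd_Q:
  assumes x: "x \<in> U"
  shows "pd (Q i j) l x = - (\<Sum>a\<in>UNIV. Q i a x * (pd (pd f a) l x \<bullet> E j x))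
    - (\<Sum>b\<in>UNIV. (E i x \<bullet> pd (pd f b) l x) * Q b j x)"
proof -
  have d: "E i differentiable (at x)" "pd f i differentiable (at x)" for i
    using smooth_on_differentiable[OF smooth_E x] smooth_on_differentiable[OF smooth_on_pd[OF smooth_f] x]
    by blast+
  have dE: "pd (E i) l x \<bullet> pd f k x = - (E i x \<bullet> pd (pd f k) l x)" for i k
  proof -
    have "0 = pd (\<lambda>x. if k = i then 1 else (0::real)) l x" by (simp add: pd_const)
    also have "\<dots> = pd (\<lambda>x. E i x \<bullet> pd f k x) l x"
      by (rule pd_cong[OF open_U x]) (simp_all add: pd_E inner_commute[of "E i _"])
    finally show ?thesis by (simp add: pd_inner d)
  qed
  have dEE: "pd (E i) l x \<bullet> E j x = - (\<Sum>b\<in>UNIV. (E i x \<bullet> pd (pd f b) l x) * Q b j x)" for i j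
    by (subst E_def[of j]) (simp add: inner_sum_right dE sum_negf mult.commute)
  have "pd (Q i j) l x = pd (\<lambda>x. E i x \<bullet> E j x) l x"
    by (rule pd_cong[OF open_U x]) (auto simp: E_E smooth_on_differentiable[OF smooth_Q x])
  also have "\<dots> = pd (E j) l x \<bullet> E i x + pd (E i) l x \<bullet> E j x"
    by (simp add: pd_inner d inner_commute)
  finally show ?thesis
    unfolding dEE using Q_sym[OF x] by (simp add: inner_commute mult.commute)
qed

text \<open>
  Jacobi's formula for the Gram matrix \<open>G\<close>, with \<open>C = dG G\<^sup>-\<^sup>1\<close>.
\<close>

lemma pd_\<mu>:
  assumes x: "x \<in> U"
  shows "pd \<mu> l x = \<mu> x * (\<Sum>a\<in>UNIV. pd (pd f a) l x \<bullet> E a x)"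
proof -
  let ?e = "\<lambda>i. pd f i x"
  let ?D = "\<lambda>i v. frechet_derivative (pd f i) (at x) v"
  have D: "(pd f i has_derivative ?D i) (at x)" for i
    using smooth_on_has_derivative[OF smooth_on_pd[OF smooth_f] x] .
  have M: "((\<lambda>x. pd f i x \<bullet> pd f j x) has_derivative (\<lambda>v. ?e i \<bullet> ?D j v + ?D i v \<bullet> ?e j)) (at x)" for i j
    by (rule has_derivative_inner[OF D D])
  define C where "C = (\<lambda>i k v. \<Sum>b\<in>UNIV. (?e i \<bullet> ?D b v + ?D i v \<bullet> ?e b) * Q b k x)"
  have C: "?e i \<bullet> ?D j v + ?D i v \<bullet> ?e j = (\<Sum>k\<in>UNIV. C i k v * (?e k \<bullet> ?e j))" for i j v
  proof -
    have "(\<Sum>k\<in>UNIV. C i k v * (?e k \<bullet> ?e j))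
        = (\<Sum>b\<in>UNIV. (?e i \<bullet> ?D b v + ?D i v \<bullet> ?e b) * (\<Sum>k\<in>UNIV. Q b k x * (?e k \<bullet> ?e j)))"
      unfolding C_def sum_distrib_right sum_distrib_left by (subst sum.swap) (simp add: mult.assoc)
    also have "\<dots> = (\<Sum>b\<in>UNIV. (?e i \<bullet> ?D b v + ?D i v \<bullet> ?e b) * (if j = b then 1 else 0))"
    proof (intro sum.cong refl arg_cong2[where f="(*)"])
      fix b
      have "(\<Sum>k\<in>UNIV. Q b k x * (?e k \<bullet> ?e j)) = ?e j \<bullet> E b x"
        unfolding E_def inner_sum_right
        by (intro sum.cong refl) (metis Q_sym[OF x] inner_scaleR_right inner_commute)
      then show "(\<Sum>k\<in>UNIV. Q b k x * (?e k \<bullet> ?e j)) = (if j = b then 1 else 0)"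
        by (simp add: pd_E[OF x])
    qed
    finally show ?thesis by (simp add: if_distrib [of "\<lambda>a. _ * a"] cong: if_cong)
  qed
  have dd: "((\<lambda>x. det (G x)) has_derivative (\<lambda>v. (\<Sum>i\<in>UNIV. C i i v) * det (G x))) (at x)"
    using has_derivative_det[of "\<lambda>i j x. pd f i x \<bullet> pd f j x", OF M C] by (simp add: G_def)
  have "(\<Sum>i\<in>UNIV. C i i v) = 2 * (\<Sum>a\<in>UNIV. ?D a v \<bullet> E a x)" for v
  proof -
    have "(\<Sum>i\<in>UNIV. C i i v) = (\<Sum>i\<in>UNIV. \<Sum>b\<in>UNIV. (?e i \<bullet> ?D b v) * Q b i x)
        + (\<Sum>i\<in>UNIV. \<Sum>b\<in>UNIV. (?D i v \<bullet> ?e b) * Q b i x)"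
      by (simp add: C_def distrib_right sum.distrib)
    also have "(\<Sum>i\<in>UNIV. \<Sum>b\<in>UNIV. (?D i v \<bullet> ?e b) * Q b i x) = (\<Sum>i\<in>UNIV. ?D i v \<bullet> E i x)"
      by (simp add: E_def inner_sum_right mult.commute)
    also have "(\<Sum>i\<in>UNIV. \<Sum>b\<in>UNIV. (?e i \<bullet> ?D b v) * Q b i x) = (\<Sum>b\<in>UNIV. ?D b v \<bullet> E b x)"
      by (subst sum.swap)
        (simp add: E_def inner_sum_right mult.commute inner_commute Q_sym[OF x, of _ b for b])
    finally show ?thesis by simp
  qed
  then have dd: "((\<lambda>x. det (G x)) has_derivative (\<lambda>v. 2 * (\<Sum>a\<in>UNIV. ?D a v \<bullet> E a x) * det (G x))) (at x)"
    using dd by simp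
  have "(\<mu> has_derivative (\<lambda>v. (2 * (\<Sum>a\<in>UNIV. ?D a v \<bullet> E a x) * det (G x)) * (inverse (sqrt (det (G x))) / 2))) (at x)"
    unfolding \<mu>_def[abs_def]
    by (rule has_derivative_compose[OF dd, of sqrt "\<lambda>h. h * (inverse (sqrt (det (G x))) / 2)"])
      (use DERIV_real_sqrt[OF det_G_pos[OF x]] in
        \<open>simp add: has_field_derivative_def mult_commute_abs flip: times_divide_eq_right\<close>)
  then have "pd \<mu> l x = (2 * (\<Sum>a\<in>UNIV. pd (pd f a) l x \<bullet> E a x) * det (G x)) * (inverse (sqrt (det (G x))) / 2)"
    using pd_eqI[of \<mu>] by (simp only: pd_def[of "pd f _" l x])
  moreover have "det (G x) * inverse (sqrt (det (G x))) = sqrt (det (G x))"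
    using det_G_pos[OF x] by (metis less_imp_le real_div_sqrt divide_inverse)
  ultimately show ?thesis by (simp add: \<mu>_def mult.commute mult.left_commute)
qed

text \<open>
  \<open>\<langle>d\<phi>, d\<psi>\<rangle>\<close> in the induced metric; below, \<open>flux\<close> is \<open>\<surd>g g\<^sup>i\<^sup>j \<partial>\<^sub>i \<phi>\<close> and \<open>laplacian\<close> is the
  Laplace-Beltrami operator in divergence form, applied to each component.
\<close>

definition grad_inner :: "(real ^ 'n \<Rightarrow> real ^ 'm) \<Rightarrow> (real ^ 'n \<Rightarrow> real ^ 'm) \<Rightarrow> real ^ 'n \<Rightarrow> real" where
  "grad_inner \<phi> \<psi> x = (\<Sum>i\<in>UNIV. \<Sum>j\<in>UNIV. Q i j x * (pd \<phi> i x \<bullet> pd \<psi> j x))"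

definition flux :: "(real ^ 'n \<Rightarrow> real ^ 'm) \<Rightarrow> 'n \<Rightarrow> real ^ 'n \<Rightarrow> real ^ 'm" where
  "flux \<phi> j x = (\<Sum>i\<in>UNIV. (\<mu> x * Q i j x) *\<^sub>R pd \<phi> i x)"

definition laplacian :: "(real ^ 'n \<Rightarrow> real ^ 'm) \<Rightarrow> real ^ 'n \<Rightarrow> real ^ 'm" where
  "laplacian \<phi> x = (1 / \<mu> x) *\<^sub>R (\<Sum>j\<in>UNIV. pd (flux \<phi> j) j x)"

lemma smooth_flux [smooth_intros]: "smooth_on U \<phi> \<Longrightarrow> smooth_on U (flux \<phi> j)"
  unfolding flux_def[abs_def] by (intro smooth_intros open_U)

lemma smooth_laplacian [smooth_intros]: "smooth_on U \<phi> \<Longrightarrow> smooth_on U (laplacian \<phi>)"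
  unfolding laplacian_def[abs_def] by (intro smooth_intros open_U) (use \<mu>_pos in force)

lemma smooth_grad_inner [smooth_intros]:
  "smooth_on U \<phi> \<Longrightarrow> smooth_on U \<psi> \<Longrightarrow> smooth_on U (grad_inner \<phi> \<psi>)"
  unfolding grad_inner_def[abs_def] by (intro smooth_intros open_U)

lemma flux_inner: "(\<Sum>j\<in>UNIV. flux \<phi> j x \<bullet> pd \<psi> j x) = \<mu> x * grad_inner \<phi> \<psi> x"
  unfolding flux_def grad_inner_def inner_sum_left sum_distrib_left
  by (subst sum.swap) (simp add: mult.assoc)

text \<open>Green's identity before integration: \<open>\<Delta>\<phi> \<bullet> \<psi> + \<langle>d\<phi>, d\<psi>\<rangle>\<close> is a divergence.\<close>

lemma divergence_flux:
  assumes "x \<in> U" "smooth_on U \<phi>" "\<psi> differentiable (at x)"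
  shows "(\<Sum>j\<in>UNIV. pd (\<lambda>y. flux \<phi> j y \<bullet> \<psi> y) j x) =
    \<mu> x * (laplacian \<phi> x \<bullet> \<psi> x + grad_inner \<phi> \<psi> x)"
proof -
  have "flux \<phi> j differentiable (at x)" for j
    using smooth_on_differentiable[OF smooth_flux] assms by blast
  then have "(\<Sum>j\<in>UNIV. pd (\<lambda>y. flux \<phi> j y \<bullet> \<psi> y) j x)
      = (\<Sum>j\<in>UNIV. flux \<phi> j x \<bullet> pd \<psi> j x) + (\<Sum>j\<in>UNIV. pd (flux \<phi> j) j x) \<bullet> \<psi> x"
    by (simp add: pd_inner assms sum.distrib inner_sum_left)
  also have "(\<Sum>j\<in>UNIV. pd (flux \<phi> j) j x) = \<mu> x *\<^sub>R laplacian \<phi> x"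
    using \<mu>_pos[OF assms(1)] by (simp add: laplacian_def)
  finally show ?thesis by (simp add: flux_inner distrib_left)
qed

end

text \<open>
  A parallel normal field \<open>h\<close> whose shape operator has locally constant trace. The sum in the last
  assumption is minus this trace, because the shape operator maps \<open>pd f i\<close> to \<open>- pd h i\<close>.
\<close>

locale parallel_normal_field = parametrization U f
  for U :: "(real ^ 'n::finite) set" and f :: "real ^ 'n \<Rightarrow> real ^ 'm::finite" +
  fixes h :: "real ^ 'n \<Rightarrow> real ^ 'm"
  assumes smooth_h: "smooth_on U h"
    and h_normal: "\<And>x i. x \<in> U \<Longrightarrow> h x \<bullet> pd f i x = 0"
    and h_parallel: "\<And>x i. x \<in> U \<Longrightarrow> pd h i x \<in> T x"
    and h_trace: "\<And>x l. x \<in> U \<Longrightarrow>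
      pd (\<lambda>y. \<Sum>i\<in>UNIV. \<Sum>j\<in>UNIV. Q i j y * (pd h i y \<bullet> pd f j y)) l x = 0"
begin

lemma shape_symmetric:
  assumes x: "x \<in> U" shows "pd h i x \<bullet> pd f l x = pd h l x \<bullet> pd f i x"
proof -
  have "pd h i x \<bullet> pd f l x = - (h x \<bullet> pd (pd f l) i x)" for i l
  proof -
    have d: "h differentiable (at x)" "pd f l differentiable (at x)"
      using smooth_on_differentiable[OF smooth_h x] smooth_on_differentiable[OF smooth_on_pd[OF smooth_f] x]
      by blast+
    have "0 = pd (\<lambda>y. 0::real) i x" by (simp add: pd_const)
    also have "\<dots> = pd (\<lambda>y. h y \<bullet> pd f l y) i x"
      by (rule pd_cong[OF open_U x]) (simp_all add: h_normal)
    finally show ?thesis by (simp add: pd_inner d)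
  qed
  then show ?thesis using pd_pd_f_sym[OF x, of i l] by simp
qed

lemma h_expand: "x \<in> U \<Longrightarrow> (\<Sum>i\<in>UNIV. (pd h k x \<bullet> pd f i x) *\<^sub>R E i x) = pd h k x"
  using T_expand_dual[OF _ h_parallel] by metis

text \<open>
  By the Codazzi equation the divergence of the shape operator is the differential of its trace,
  hence \<open>0\<close>. Written with second derivatives of \<open>f\<close> and \<open>h\<close> instead of covariant ones, the Codazzi
  equation is the derivative (\<open>cod\<close> below) of the symmetry of the shape operator.
\<close>

lemma trace_codazzi:
  assumes x: "x \<in> U"
  shows "(\<Sum>i\<in>UNIV. \<Sum>j\<in>UNIV. Q i j x * (pd (pd h i) j x \<bullet> pd f l x)) =
    (\<Sum>i\<in>UNIV. \<Sum>j\<in>UNIV. Q i j x * (pd h l x \<bullet> pd (pd f i) j x))"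
proof -
  let ?e = "\<lambda>i. pd f i x" and ?k = "\<lambda>i. pd h i x" and ?f = "\<lambda>i j. pd (pd f i) j x"
    and ?h = "\<lambda>i j. pd (pd h i) j x" and ?Q = "\<lambda>i j. Q i j x" and ?E = "\<lambda>i. E i x"
  let ?S = "\<lambda>t. \<Sum>i\<in>UNIV. \<Sum>j\<in>UNIV. ?Q i j * t i j"
  have d: "pd h i differentiable (at x)" "pd f i differentiable (at x)" "Q i j differentiable (at x)" for i j
    using smooth_on_differentiable[OF smooth_on_pd[OF smooth_h] x]
      smooth_on_differentiable[OF smooth_on_pd[OF smooth_f] x]
      smooth_on_differentiable[OF smooth_Q x] by blast+
  have swap: "?S t = ?S (\<lambda>i j. t j i)" for t
    by (subst sum.swap) (simp add: Q_sym[OF x])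
  have dS: "(\<lambda>y. Q i j y * (pd h i y \<bullet> pd f j y)) differentiable (at x)" for i j
    using d by (intro differentiable_mult differentiable_inner) auto
  have "(\<Sum>i\<in>UNIV. \<Sum>j\<in>UNIV. pd (Q i j) l x * (?k i \<bullet> ?e j)) = - 2 * ?S (\<lambda>i j. ?f i l \<bullet> ?k j)"
  proof -
    have 1: "(\<Sum>i\<in>UNIV. \<Sum>j\<in>UNIV. (\<Sum>a\<in>UNIV. ?Q i a * (?f a l \<bullet> ?E j)) * (?k i \<bullet> ?e j))
        = ?S (\<lambda>i j. ?f j l \<bullet> ?k i)"
    proof (rule sum.cong[OF refl])
      fix i
      have "(\<Sum>j\<in>UNIV. (\<Sum>a\<in>UNIV. ?Q i a * (?f a l \<bullet> ?E j)) * (?k i \<bullet> ?e j))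
          = (\<Sum>a\<in>UNIV. ?Q i a * (?f a l \<bullet> (\<Sum>j\<in>UNIV. (?k i \<bullet> ?e j) *\<^sub>R ?E j)))"
        unfolding sum_distrib_right inner_sum_right sum_distrib_left
        by (subst sum.swap) (simp add: mult_ac)
      then show "(\<Sum>j\<in>UNIV. (\<Sum>a\<in>UNIV. ?Q i a * (?f a l \<bullet> ?E j)) * (?k i \<bullet> ?e j))
          = (\<Sum>j\<in>UNIV. ?Q i j * (?f j l \<bullet> ?k i))" by (simp add: h_expand[OF x])
    qed
    have 2: "(\<Sum>i\<in>UNIV. \<Sum>j\<in>UNIV. (\<Sum>b\<in>UNIV. (?E i \<bullet> ?f b l) * ?Q b j) * (?k i \<bullet> ?e j))
        = ?S (\<lambda>b j. ?f b l \<bullet> ?k j)"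
    proof -
      have "(\<Sum>i\<in>UNIV. \<Sum>j\<in>UNIV. (\<Sum>b\<in>UNIV. (?E i \<bullet> ?f b l) * ?Q b j) * (?k i \<bullet> ?e j))
        = (\<Sum>j\<in>UNIV. \<Sum>i\<in>UNIV. \<Sum>b\<in>UNIV. ((?E i \<bullet> ?f b l) * ?Q b j) * (?k j \<bullet> ?e i))"
        unfolding sum_distrib_right by (subst sum.swap) (simp add: shape_symmetric[OF x])
      also have "\<dots> = (\<Sum>j\<in>UNIV. \<Sum>b\<in>UNIV. \<Sum>i\<in>UNIV. ((?E i \<bullet> ?f b l) * ?Q b j) * (?k j \<bullet> ?e i))"
        by (rule sum.cong[OF refl], rule sum.swap)
      also have "\<dots> = (\<Sum>j\<in>UNIV. \<Sum>b\<in>UNIV. ?Q b j * (?f b l \<bullet> (\<Sum>i\<in>UNIV. (?k j \<bullet> ?e i) *\<^sub>R ?E i)))"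
        by (simp add: inner_sum_right sum_distrib_left mult_ac inner_commute[of _ "?E _"])
      also have "\<dots> = (\<Sum>b\<in>UNIV. \<Sum>j\<in>UNIV. ?Q b j * (?f b l \<bullet> ?k j))"
        by (simp only: h_expand[OF x]) (rule sum.swap)
      finally show ?thesis .
    qed
    have "(\<Sum>i\<in>UNIV. \<Sum>j\<in>UNIV. pd (Q i j) l x * (?k i \<bullet> ?e j)) =
       - (\<Sum>i\<in>UNIV. \<Sum>j\<in>UNIV. (\<Sum>a\<in>UNIV. ?Q i a * (?f a l \<bullet> ?E j)) * (?k i \<bullet> ?e j))
       - (\<Sum>i\<in>UNIV. \<Sum>j\<in>UNIV. (\<Sum>b\<in>UNIV. (?E i \<bullet> ?f b l) * ?Q b j) * (?k i \<bullet> ?e j))"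
      by (simp add: pd_Q[OF x] left_diff_distrib sum_subtractf sum_negf)
    then show ?thesis unfolding 1 2 swap[of "\<lambda>i j. ?f j l \<bullet> ?k i"] by simp
  qed
  moreover have "0 = (\<Sum>i\<in>UNIV. \<Sum>j\<in>UNIV. pd (Q i j) l x * (?k i \<bullet> ?e j))
      + ?S (\<lambda>i j. ?k i \<bullet> ?f j l) + ?S (\<lambda>i j. ?h i l \<bullet> ?e j)"
  proof -
    have "0 = (\<Sum>i\<in>UNIV. \<Sum>j\<in>UNIV. pd (\<lambda>y. Q i j y * (pd h i y \<bullet> pd f j y)) l x)"
      using h_trace[OF x, of l] dS by (simp add: pd_sum differentiable_sum)
    then show ?thesis
      using d by (simp add: pd_mult pd_inner differentiable_inner distrib_left sum.distrib)
  qed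
  ultimately have A: "?S (\<lambda>i j. ?h i l \<bullet> ?e j) = ?S (\<lambda>i j. ?f i l \<bullet> ?k j)"
    using swap[of "\<lambda>i j. ?k i \<bullet> ?f j l"] by (simp add: inner_commute)
  have cod: "?h i j \<bullet> ?e l = ?h j l \<bullet> ?e i + ?k l \<bullet> ?f i j - ?k i \<bullet> ?f j l" for i j
  proof -
    have "pd (\<lambda>y. pd h i y \<bullet> pd f l y) j x = pd (\<lambda>y. pd h l y \<bullet> pd f i y) j x"
      by (rule pd_cong[OF open_U x]) (use d in \<open>auto intro: shape_symmetric differentiable_inner\<close>)
    then show ?thesis
      using d pd_pd_f_sym[OF x, of l j] pd_symmetric[OF smooth_h open_U x, of l j]
      by (simp add: pd_inner)
  qed
  have "?S (\<lambda>i j. ?h i j \<bullet> ?e l) = ?S (\<lambda>i j. ?h j l \<bullet> ?e i) + ?S (\<lambda>i j. ?k l \<bullet> ?f i j) - ?S (\<lambda>i j. ?k i \<bullet> ?f j l)"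
    by (simp add: cod distrib_left right_diff_distrib sum.distrib sum_subtractf)
  also have "?S (\<lambda>i j. ?h j l \<bullet> ?e i) = ?S (\<lambda>i j. ?h i l \<bullet> ?e j)"
    by (rule swap)
  finally show ?thesis
    using A swap[of "\<lambda>i j. ?k i \<bullet> ?f j l"] by (simp add: inner_commute)
qed

text \<open>
  Of the three terms that the derivatives of \<open>\<mu>\<close> and \<open>Q\<close> contribute, two cancel. The third one and
  the term with the second derivatives of \<open>h\<close> are the two sides of \<open>trace_codazzi\<close>.
\<close>

lemma laplacian_normal:
  assumes x: "x \<in> U"
  shows "laplacian h x \<bullet> pd f l x = 0"
proof -
  let ?e = "\<lambda>i. pd f i x" and ?k = "\<lambda>i. pd h i x" and ?f = "\<lambda>i j. pd (pd f i) j x"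
    and ?h = "\<lambda>i j. pd (pd h i) j x" and ?Q = "\<lambda>i j. Q i j x" and ?E = "\<lambda>i. E i x"
  have d: "pd h i differentiable (at x)" "Q i j differentiable (at x)" "\<mu> differentiable (at x)" for i j
    using smooth_on_differentiable[OF smooth_on_pd[OF smooth_h] x]
      smooth_on_differentiable[OF smooth_Q x] smooth_on_differentiable[OF smooth_\<mu> x] by blast+
  have Qk: "(\<Sum>i\<in>UNIV. ?Q i j * (?k i \<bullet> ?e l)) = ?k l \<bullet> ?E j" for j
    by (simp add: E_def inner_sum_right shape_symmetric[OF x, of _ l])
  have dflux: "pd (flux h j) j x = (\<Sum>i\<in>UNIV. (\<mu> x * ?Q i j) *\<^sub>R ?h i j
      + (\<mu> x * pd (Q i j) j x + pd \<mu> j x * ?Q i j) *\<^sub>R ?k i)" for j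
    unfolding flux_def[abs_def] using d
    by (simp add: pd_sum pd_scaleR pd_mult differentiable_scaleR differentiable_mult)
  have T1: "(\<Sum>j\<in>UNIV. \<Sum>i\<in>UNIV. (\<Sum>a\<in>UNIV. ?f a j \<bullet> ?E a) * (?Q i j * (?k i \<bullet> ?e l)))
      = (\<Sum>j\<in>UNIV. \<Sum>a\<in>UNIV. (?f a j \<bullet> ?E a) * (?k l \<bullet> ?E j))"
    unfolding sum_distrib_left[symmetric] Qk by (simp add: sum_distrib_right)
  have T2: "(\<Sum>j\<in>UNIV. \<Sum>i\<in>UNIV. (\<Sum>a\<in>UNIV. ?Q i a * (?f a j \<bullet> ?E j)) * (?k i \<bullet> ?e l))
      = (\<Sum>j\<in>UNIV. \<Sum>a\<in>UNIV. (?f a j \<bullet> ?E j) * (?k l \<bullet> ?E a))"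
  proof (rule sum.cong[OF refl])
    fix j
    have "(\<Sum>i\<in>UNIV. (\<Sum>a\<in>UNIV. ?Q i a * (?f a j \<bullet> ?E j)) * (?k i \<bullet> ?e l))
        = (\<Sum>a\<in>UNIV. (?f a j \<bullet> ?E j) * (\<Sum>i\<in>UNIV. ?Q i a * (?k i \<bullet> ?e l)))"
      unfolding sum_distrib_right sum_distrib_left by (subst sum.swap) (simp add: mult_ac)
    then show "(\<Sum>i\<in>UNIV. (\<Sum>a\<in>UNIV. ?Q i a * (?f a j \<bullet> ?E j)) * (?k i \<bullet> ?e l))
        = (\<Sum>a\<in>UNIV. (?f a j \<bullet> ?E j) * (?k l \<bullet> ?E a))" by (simp add: Qk)
  qed
  have T12: "(\<Sum>j\<in>UNIV. \<Sum>a\<in>UNIV. (?f a j \<bullet> ?E j) * (?k l \<bullet> ?E a))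
      = (\<Sum>j\<in>UNIV. \<Sum>a\<in>UNIV. (?f a j \<bullet> ?E a) * (?k l \<bullet> ?E j))"
    by (subst sum.swap) (intro sum.cong refl, metis pd_pd_f_sym[OF x])
  have T3: "(\<Sum>j\<in>UNIV. \<Sum>i\<in>UNIV. (\<Sum>b\<in>UNIV. (?E i \<bullet> ?f b j) * ?Q b j) * (?k i \<bullet> ?e l))
      = (\<Sum>j\<in>UNIV. \<Sum>b\<in>UNIV. ?Q b j * (?k l \<bullet> ?f b j))"
  proof (rule sum.cong[OF refl])
    fix j
    have "(\<Sum>i\<in>UNIV. (\<Sum>b\<in>UNIV. (?E i \<bullet> ?f b j) * ?Q b j) * (?k i \<bullet> ?e l))
       = (\<Sum>b\<in>UNIV. ?Q b j * ((\<Sum>i\<in>UNIV. (?k l \<bullet> ?e i) *\<^sub>R ?E i) \<bullet> ?f b j))"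
      unfolding sum_distrib_right inner_sum_left sum_distrib_left
      by (subst sum.swap) (simp add: mult_ac shape_symmetric[OF x, of _ l])
    then show "(\<Sum>i\<in>UNIV. (\<Sum>b\<in>UNIV. (?E i \<bullet> ?f b j) * ?Q b j) * (?k i \<bullet> ?e l))
      = (\<Sum>b\<in>UNIV. ?Q b j * (?k l \<bullet> ?f b j))" by (simp add: h_expand[OF x])
  qed
  define P where "P j = (\<Sum>a\<in>UNIV. ?f a j \<bullet> ?E a)" for j
  have "(\<Sum>j\<in>UNIV. pd (flux h j) j x) \<bullet> ?e l
      = \<mu> x * ((\<Sum>j\<in>UNIV. \<Sum>i\<in>UNIV. ?Q i j * (?h i j \<bullet> ?e l))
        + (\<Sum>j\<in>UNIV. \<Sum>i\<in>UNIV. pd (Q i j) j x * (?k i \<bullet> ?e l))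
        + (\<Sum>j\<in>UNIV. \<Sum>i\<in>UNIV. P j * (?Q i j * (?k i \<bullet> ?e l))))"
    unfolding dflux pd_\<mu>[OF x] P_def[symmetric]
    by (simp add: inner_sum_left inner_add_left sum.distrib distrib_left distrib_right sum_distrib_left
        mult.assoc)
  also have "(\<Sum>j\<in>UNIV. \<Sum>i\<in>UNIV. pd (Q i j) j x * (?k i \<bullet> ?e l))
      = - (\<Sum>j\<in>UNIV. \<Sum>i\<in>UNIV. (\<Sum>a\<in>UNIV. ?Q i a * (?f a j \<bullet> ?E j)) * (?k i \<bullet> ?e l))
        - (\<Sum>j\<in>UNIV. \<Sum>i\<in>UNIV. (\<Sum>b\<in>UNIV. (?E i \<bullet> ?f b j) * ?Q b j) * (?k i \<bullet> ?e l))"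
    by (simp add: pd_Q[OF x] left_diff_distrib sum_subtractf sum_negf)
  also have "(\<Sum>j\<in>UNIV. \<Sum>i\<in>UNIV. ?Q i j * (?h i j \<bullet> ?e l)) = (\<Sum>j\<in>UNIV. \<Sum>b\<in>UNIV. ?Q b j * (?k l \<bullet> ?f b j))"
    using trace_codazzi[OF x, of l] sum.swap[of "\<lambda>i j. ?Q i j * (?h i j \<bullet> ?e l)" UNIV UNIV]
      sum.swap[of "\<lambda>i j. ?Q i j * (?k l \<bullet> ?f i j)" UNIV UNIV] by simp
  finally have "(\<Sum>j\<in>UNIV. pd (flux h j) j x) \<bullet> ?e l = 0" unfolding T2 T3 T12 P_def T1 by simp
  then show ?thesis by (simp add: laplacian_def)
qed

text \<open>
  The flux of \<open>h\<close> is tangent, hence orthogonal to \<open>\<zeta>\<close>; differentiating this gives the normal part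
  of \<open>\<Delta>h\<close>.
\<close>

lemma laplacian_inner_normal:
  assumes x: "x \<in> U" and V: "open V" "x \<in> V" "V \<subseteq> U"
    and \<zeta>: "smooth_on V \<zeta>" "\<And>y i. y \<in> V \<Longrightarrow> \<zeta> y \<bullet> pd f i y = 0"
  shows "laplacian h x \<bullet> \<zeta> x = - grad_inner h \<zeta> x"
proof -
  have "pd (\<lambda>y. flux h j y \<bullet> \<zeta> y) j x = 0" for j
  proof -
    have "0 = pd (\<lambda>y. 0::real) j x" by (simp add: pd_const)
    also have "\<dots> = pd (\<lambda>y. flux h j y \<bullet> \<zeta> y) j x"
    proof (rule pd_cong[OF V(1,2)])
      fix y assume y: "y \<in> V"
      then have "pd h i y \<bullet> \<zeta> y = 0" for i
        using orthogonal_TI[of y "\<zeta> y" "pd h i y"] \<zeta>(2) h_parallel V(3)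
        by (metis inner_commute subsetD)
      then show "0 = flux h j y \<bullet> \<zeta> y" by (simp add: flux_def inner_sum_left)
    qed simp
    finally show ?thesis by simp
  qed
  moreover have "\<zeta> differentiable (at x)" using smooth_on_differentiable \<zeta>(1) V(2) by blast
  ultimately have "\<mu> x * (laplacian h x \<bullet> \<zeta> x + grad_inner h \<zeta> x) = 0"
    using divergence_flux[OF x smooth_h, of \<zeta>] by simp
  then show ?thesis using \<mu>_pos[OF x] by auto
qed

end

section \<open>Charts and differentials\<close>

locale atlas =
  fixes A :: "('p::{t2_space, second_countable_topology}, 'n::finite) chart set"
  assumes smooth_atlas: "smooth_atlas A"
begin

lemma chart_hom: "c \<in> A \<Longrightarrow> homeomorphism (fst c) (snd c ` fst c) (snd c) (chart_inv c)"
  using smooth_atlas unfolding smooth_atlas_def by blast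

lemma open_chart: "c \<in> A \<Longrightarrow> open (fst c)" and open_image: "c \<in> A \<Longrightarrow> open (snd c ` fst c)"
  using smooth_atlas unfolding smooth_atlas_def by blast+

lemma chart_inv_chart [simp]: "c \<in> A \<Longrightarrow> p \<in> fst c \<Longrightarrow> chart_inv c (snd c p) = p"
  using chart_hom homeomorphism_apply1 by blast

lemma chart_chart_inv [simp]: "c \<in> A \<Longrightarrow> x \<in> snd c ` fst c \<Longrightarrow> snd c (chart_inv c x) = x"
  using chart_hom homeomorphism_apply2 by blast

lemma continuous_chart: "c \<in> A \<Longrightarrow> continuous_on (fst c) (snd c)"
  and continuous_chart_inv: "c \<in> A \<Longrightarrow> continuous_on (snd c ` fst c) (chart_inv c)"
  using chart_hom homeomorphism_def by blast+

lemma inj_on_chart: "c \<in> A \<Longrightarrow> inj_on (snd c) (fst c)"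
  by (metis chart_inv_chart inj_onI)

lemma image_eq_preimage:
  "c \<in> A \<Longrightarrow> W \<subseteq> fst c \<Longrightarrow> snd c ` W = snd c ` fst c \<inter> chart_inv c -` W"
  by (auto simp: subset_eq)

lemma open_chart_image: "c \<in> A \<Longrightarrow> open W \<Longrightarrow> W \<subseteq> fst c \<Longrightarrow> open (snd c ` W)"
  using continuous_open_preimage[OF continuous_chart_inv open_image]
  by (subst image_eq_preimage) auto

lemma open_chart_image_Int: "c \<in> A \<Longrightarrow> open W \<Longrightarrow> open (snd c ` (fst c \<inter> W))"
  by (intro open_chart_image) (auto intro: open_chart)

lemma open_chart_preimage: "c \<in> A \<Longrightarrow> open V \<Longrightarrow> open (fst c \<inter> snd c -` V)"
  using continuous_open_preimage[OF continuous_chart open_chart] .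

lemma ex_chart: "\<exists>c\<in>A. p \<in> fst c"
  using smooth_atlas unfolding smooth_atlas_def by blast

lemma chart_at: "chart_at A p \<in> A" "p \<in> fst (chart_at A p)"
  using someI_ex[of "\<lambda>c. c \<in> A \<and> p \<in> fst c"] ex_chart[of p] unfolding chart_at_def by blast+

lemma smooth_transition:
  "c \<in> A \<Longrightarrow> d \<in> A \<Longrightarrow> smooth_on (snd c ` (fst c \<inter> fst d)) (snd d \<circ> chart_inv c)"
  using smooth_atlas unfolding smooth_atlas_def by blast

lemma smooth_map_onD: "smooth_map_on A W \<phi> \<Longrightarrow> c \<in> A \<Longrightarrow> smooth_on (snd c ` (fst c \<inter> W)) (\<phi> \<circ> chart_inv c)"
  unfolding smooth_map_on_def by blast

lemma smooth_mapD: "smooth_map A \<phi> \<Longrightarrow> c \<in> A \<Longrightarrow> smooth_on (snd c ` fst c) (\<phi> \<circ> chart_inv c)"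
  by (drule smooth_map_onD, assumption) (simp only: Int_UNIV_right)

lemma smooth_map_on_subset: "smooth_map_on A W \<phi> \<Longrightarrow> V \<subseteq> W \<Longrightarrow> smooth_map_on A V \<phi>"
  unfolding smooth_map_on_def
proof
  fix c assume *: "\<forall>c\<in>A. smooth_on (snd c ` (fst c \<inter> W)) (\<phi> \<circ> chart_inv c)" "V \<subseteq> W" "c \<in> A"
  then have "smooth_on (snd c ` (fst c \<inter> W)) (\<phi> \<circ> chart_inv c)" by blast
  then show "smooth_on (snd c ` (fst c \<inter> V)) (\<phi> \<circ> chart_inv c)"
    by (rule smooth_on_subset) (use *(2) in blast)
qed

lemma smooth_map_on_cong:
  "smooth_map_on A W \<phi> \<Longrightarrow> open W \<Longrightarrow> (\<And>p. p \<in> W \<Longrightarrow> \<phi> p = \<psi> p) \<Longrightarrow> smooth_map_on A W \<psi>"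
  unfolding smooth_map_on_def
proof
  fix c assume *: "\<forall>c\<in>A. smooth_on (snd c ` (fst c \<inter> W)) (\<phi> \<circ> chart_inv c)" "open W"
    "\<And>p. p \<in> W \<Longrightarrow> \<phi> p = \<psi> p" and c: "c \<in> A"
  show "smooth_on (snd c ` (fst c \<inter> W)) (\<psi> \<circ> chart_inv c)"
    by (rule smooth_on_cong[OF open_chart_image_Int[OF c *(2)], of "\<phi> \<circ> chart_inv c"]) (use * c in auto)
qed

lemma smooth_map_on_chartI:
  assumes c: "c \<in> A" and W: "open W" "W \<subseteq> fst c" and \<phi>: "smooth_on (snd c ` W) (\<phi> \<circ> chart_inv c)"
  shows "smooth_map_on A W \<phi>"
  unfolding smooth_map_on_def
proof
  fix d assume d: "d \<in> A"
  have o: "open (snd d ` (fst d \<inter> W))" using open_chart_image_Int d W by blast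
  have "smooth_on (snd d ` (fst d \<inter> W)) (\<lambda>x. (\<phi> \<circ> chart_inv c) ((snd c \<circ> chart_inv d) x))"
  proof (rule smooth_on_compose[OF o _ \<phi>])
    show "open (snd c ` W)" using open_chart_image c W by blast
    show "smooth_on (snd d ` (fst d \<inter> W)) (snd c \<circ> chart_inv d)"
      by (rule smooth_on_subset[OF smooth_transition[OF d c]]) (use W in blast)
    show "(snd c \<circ> chart_inv d) ` snd d ` (fst d \<inter> W) \<subseteq> snd c ` W" using d by auto
  qed
  then show "smooth_on (snd d ` (fst d \<inter> W)) (\<phi> \<circ> chart_inv d)"
    by (rule smooth_on_cong[OF o]) (use c d W in auto)
qed

lemma smooth_map_on_locally:
  assumes "\<And>p. p \<in> W \<Longrightarrow> \<exists>V. open V \<and> p \<in> V \<and> smooth_map_on A V \<phi>"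
  shows "smooth_map_on A W \<phi>"
  unfolding smooth_map_on_def
proof
  fix c assume c: "c \<in> A"
  show "smooth_on (snd c ` (fst c \<inter> W)) (\<phi> \<circ> chart_inv c)"
  proof (rule smooth_on_locally)
    fix x assume "x \<in> snd c ` (fst c \<inter> W)"
    then obtain p where p: "p \<in> fst c" "p \<in> W" "x = snd c p" by blast
    then obtain V where V: "open V" "p \<in> V" "smooth_map_on A V \<phi>" using assms by blast
    show "\<exists>T. open T \<and> x \<in> T \<and> smooth_on T (\<phi> \<circ> chart_inv c)"
      using p V open_chart_image_Int[OF c V(1)] smooth_map_onD[OF V(3) c]
      by (intro exI[of _ "snd c ` (fst c \<inter> V)"]) blast
  qed
qed

lemma smooth_map_chartsI:
  assumes "\<And>c. c \<in> A \<Longrightarrow> smooth_on (snd c ` fst c) (\<phi> \<circ> chart_inv c)"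
  shows "smooth_map A \<phi>"
  using assms by (simp add: smooth_map_on_def)

lemma smooth_map_on_continuous:
  assumes W: "open W" and "smooth_map_on A W \<phi>"
  shows "continuous_on W \<phi>"
proof -
  have "isCont \<phi> p" if p: "p \<in> W" for p
  proof -
    obtain c where c: "c \<in> A" "p \<in> fst c" using ex_chart by blast
    have "continuous_on (snd c ` (fst c \<inter> W)) (\<phi> \<circ> chart_inv c)"
      using smooth_on_continuous smooth_map_onD assms c by blast
    then have "continuous_on (fst c \<inter> W) ((\<phi> \<circ> chart_inv c) \<circ> snd c)"
      by (rule continuous_on_compose[OF continuous_on_subset[OF continuous_chart[OF c(1)]], rotated]) simp
    then have "continuous_on (fst c \<inter> W) \<phi>"
      by (rule continuous_on_eq) (use c in auto)
    then show ?thesis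
      using p c open_chart[OF c(1)] W by (simp add: continuous_on_eq_continuous_at open_Int)
  qed
  then show ?thesis by (simp add: continuous_at_imp_continuous_on)
qed

lemma chart_diff_change:
  assumes c: "c \<in> A" "p \<in> fst c" and d: "d \<in> A" "p \<in> fst d"
    and \<phi>: "(\<phi> \<circ> chart_inv d) differentiable (at (snd d p))"
  shows "chart_diff c \<phi> p v =
    chart_diff d \<phi> p (frechet_derivative (snd d \<circ> chart_inv c) (at (snd c p)) v)"
proof -
  let ?O = "snd c ` (fst c \<inter> fst d)"
  have o: "open ?O" using open_chart_image_Int c d open_chart by blast
  have x: "snd c p \<in> ?O" using c d by blast
  have t: "(snd d \<circ> chart_inv c) differentiable (at (snd c p))"
    using smooth_on_differentiable[OF smooth_transition x] c d by blast
  have \<phi>': "(\<phi> \<circ> chart_inv d) differentiable (at ((snd d \<circ> chart_inv c) (snd c p)))"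
    using \<phi> c by simp
  have "frechet_derivative (\<phi> \<circ> chart_inv c) (at (snd c p))
      = frechet_derivative ((\<phi> \<circ> chart_inv d) \<circ> (snd d \<circ> chart_inv c)) (at (snd c p))"
  proof (rule frechet_derivative_transform_within_open[symmetric, OF _ o x])
    show "((\<phi> \<circ> chart_inv d) \<circ> (snd d \<circ> chart_inv c)) differentiable (at (snd c p))"
      using differentiable_chain_at[OF t \<phi>'] .
  qed (use c d in auto)
  also have "\<dots> = frechet_derivative (\<phi> \<circ> chart_inv d) (at (snd d p))
      \<circ> frechet_derivative (snd d \<circ> chart_inv c) (at (snd c p))"
    using frechet_derivative_compose[OF t \<phi>'] unfolding o_apply[of "snd d"] chart_inv_chart[OF c] .
  finally show ?thesis by (simp add: chart_diff_def)
qed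

lemma pulled_differentiable:
  assumes "open W" "p \<in> W" "smooth_map_on A W \<phi>" "c \<in> A" "p \<in> fst c"
  shows "(\<phi> \<circ> chart_inv c) differentiable (at (snd c p))"
  using smooth_on_differentiable[OF smooth_map_onD[OF assms(3,4)], of "snd c p"] assms by blast

end

section \<open>Immersed submanifolds\<close>

locale immersed_submanifold = atlas A
  for A :: "('p::{t2_space, second_countable_topology}, 'n::finite) chart set" +
  fixes F :: "'p \<Rightarrow> real ^ 'm::finite"
  assumes immersion: "immersion A F"
begin

abbreviation loc :: "('p, 'n) chart \<Rightarrow> real ^ 'n \<Rightarrow> real ^ 'm" where
  "loc c \<equiv> F \<circ> chart_inv c"

lemma smooth_F: "smooth_map A F"
  using immersion unfolding immersion_def by blast

lemma parametrization: "c \<in> A \<Longrightarrow> parametrization (snd c ` fst c) (loc c)"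
proof
  fix x assume c: "c \<in> A" and "x \<in> snd c ` fst c"
  then obtain p where p: "p \<in> fst c" "x = snd c p" by blast
  then have "inj (chart_diff c F p)" using immersion c unfolding immersion_def by blast
  then show "inj (frechet_derivative (loc c) (at x))" by (simp add: chart_diff_def[abs_def] p)
qed (auto intro: open_image smooth_mapD[OF smooth_F])

abbreviation TM where "TM \<equiv> tangent_space A F"

lemma F_diff: "c \<in> A \<Longrightarrow> p \<in> fst c \<Longrightarrow> loc c differentiable (at (snd c p))"
  using pulled_differentiable[OF open_UNIV UNIV_I smooth_F] by blast

lemma TM_subset:
  assumes "c \<in> A" "p \<in> fst c" "d \<in> A" "p \<in> fst d"
  shows "range (chart_diff c F p) \<subseteq> range (chart_diff d F p)"
  using chart_diff_change[OF assms F_diff] assms by auto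

lemma TM_eq:
  assumes "c \<in> A" "p \<in> fst c"
  shows "TM p = parametrization.T (loc c) (snd c p)"
proof -
  have "range (chart_diff (chart_at A p) F p) = range (chart_diff c F p)"
    using TM_subset chart_at assms by (intro equalityI) blast+
  then show ?thesis
    by (simp add: tangent_space_def parametrization.T_def[OF parametrization[OF assms(1)]]
        chart_diff_def[abs_def])
qed

lemma subspace_TM: "subspace (TM p)"
  by (simp add: TM_eq[OF chart_at] parametrization.subspace_T[OF parametrization[OF chart_at(1)]] chart_at)

lemma pd_in_TM: "c \<in> A \<Longrightarrow> p \<in> fst c \<Longrightarrow> pd (loc c) i (snd c p) \<in> TM p"
  by (simp add: TM_eq parametrization.pd_in_T[OF parametrization])

lemma coords_chart_diff: "coords A F p (chart_diff (chart_at A p) F p v) = v"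
proof -
  have "inj (chart_diff (chart_at A p) F p)"
    using immersion chart_at unfolding immersion_def by blast
  then show ?thesis unfolding coords_def by (auto intro!: the_equality dest: injD)
qed

lemma nabla_chart_diff:
  assumes c: "c \<in> A" "p \<in> fst c" and \<phi>: "open W" "p \<in> W" "smooth_map_on A W \<phi>"
  shows "nabla A F (chart_diff c F p v) \<phi> p = chart_diff c \<phi> p v"
  unfolding nabla_def chart_diff_change[OF c chart_at F_diff[OF chart_at]] coords_chart_diff
    chart_diff_change[OF c chart_at pulled_differentiable[OF \<phi> chart_at]] ..

lemma nabla_pd:
  assumes "c \<in> A" "p \<in> fst c" "open W" "p \<in> W" "smooth_map_on A W \<phi>"
  shows "nabla A F (pd (loc c) i (snd c p)) \<phi> p = pd (\<phi> \<circ> chart_inv c) i (snd c p)"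
  using nabla_chart_diff[OF assms, of "axis i 1"] by (simp add: chart_diff_def pd_def)

lemma nabla_expand:
  assumes c: "c \<in> A" "p \<in> fst c" and \<phi>: "open W" "p \<in> W" "smooth_map_on A W \<phi>" and X: "X \<in> TM p"
  shows "nabla A F X \<phi> p =
    (\<Sum>i\<in>UNIV. (X \<bullet> parametrization.E (loc c) i (snd c p)) *\<^sub>R pd (\<phi> \<circ> chart_inv c) i (snd c p))"
proof -
  interpret parametrization "snd c ` fst c" "loc c" by (rule parametrization[OF c(1)])
  have x: "snd c p \<in> snd c ` fst c" using c by blast
  let ?v = "\<chi> i. X \<bullet> E i (snd c p)"
  have "X = frechet_derivative (loc c) (at (snd c p)) ?v"
    using T_expand[OF x] X by (simp add: df_eq[OF x] TM_eq[OF c])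
  then have "nabla A F X \<phi> p = chart_diff c \<phi> p ?v"
    using nabla_chart_diff[OF c \<phi>, of ?v] by (simp add: chart_diff_def)
  then show ?thesis
    using frechet_derivative_pd[OF pulled_differentiable[OF \<phi> c]] by (simp add: chart_diff_def)
qed

subsection \<open>Orthonormal frames and projections\<close>

abbreviation frm where "frm \<equiv> frame A F"

lemma frame: "frm p \<subseteq> TM p" "pairwise orthogonal (frm p)" "\<And>b. b \<in> frm p \<Longrightarrow> norm b = 1"
  "span (frm p) = TM p"
proof -
  obtain B where "B \<subseteq> TM p" "pairwise orthogonal B" "\<And>x. x \<in> B \<Longrightarrow> norm x = 1" "span B = TM p"
    using orthonormal_basis_subspace[OF subspace_TM] by metis
  then have "\<exists>B. B \<subseteq> TM p \<and> pairwise orthogonal B \<and> (\<forall>b\<in>B. norm b = 1) \<and> span B = TM p" by blast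
  from someI_ex[OF this] show "frm p \<subseteq> TM p" "pairwise orthogonal (frm p)"
    "\<And>b. b \<in> frm p \<Longrightarrow> norm b = 1" "span (frm p) = TM p"
    unfolding frame_def by blast+
qed

lemma finite_frame: "finite (frm p)"
  using pairwise_orthogonal_imp_finite[OF frame(2)] .

lemma frame_expand:
  assumes "w \<in> TM p" shows "w = (\<Sum>b\<in>frm p. (w \<bullet> b) *\<^sub>R b)"
proof -
  have "w \<in> span (frm p)" using assms frame by blast
  then obtain u where u: "w = (\<Sum>b\<in>frm p. u b *\<^sub>R b)" using span_finite[OF finite_frame] by blast
  have "w \<bullet> b = u b" if b: "b \<in> frm p" for b
  proof -
    have "w \<bullet> b = (\<Sum>a\<in>frm p. if a = b then u b else 0)"
      unfolding u inner_sum_left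
    proof (rule sum.cong[OF refl])
      fix a assume "a \<in> frm p"
      then show "(u a *\<^sub>R a) \<bullet> b = (if a = b then u b else 0)"
        using frame(2)[of p] frame(3)[of _ p] b by (auto simp: pairwise_def orthogonal_def dot_square_norm)
    qed
    then show ?thesis using b finite_frame by simp
  qed
  then show ?thesis using u by simp
qed

lemma frame_parseval: "v \<in> TM p \<Longrightarrow> (\<Sum>b\<in>frm p. (b \<bullet> v) * (b \<bullet> w)) = v \<bullet> w"
  using arg_cong[OF frame_expand[of v p], of "\<lambda>u. u \<bullet> w"] by (simp add: inner_sum_left inner_commute[of v])

lemma tan_part_in_TM: "tan_part A F p w \<in> TM p"
  unfolding tan_part_def using frame(1) by (intro subspace_sum subspace_TM subspace_scale) auto

lemma inner_tan_part: "v \<in> TM p \<Longrightarrow> v \<bullet> tan_part A F p w = v \<bullet> w"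
  using frame_parseval[of v p w] by (simp add: tan_part_def inner_sum_right inner_commute mult.commute)

lemma tan_part_ident: "w \<in> TM p \<Longrightarrow> tan_part A F p w = w"
  using frame_expand by (simp add: tan_part_def)

lemma normal_space_iff: "z \<in> normal_space A F p \<longleftrightarrow> (\<forall>w\<in>TM p. z \<bullet> w = 0)"
  by (auto simp: normal_space_def orthogonal_comp_def orthogonal_def inner_commute)

lemma nor_part_normal: "nor_part A F p w \<in> normal_space A F p"
  using inner_tan_part[of _ p w]
  by (simp add: normal_space_iff nor_part_def inner_diff_left inner_commute[of w] inner_commute[of "tan_part A F p w"])

lemma nor_part_ident: "z \<in> normal_space A F p \<Longrightarrow> nor_part A F p z = z"
  using frame(1)[of p] by (auto simp: normal_space_iff nor_part_def tan_part_def intro!: sum.neutral)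

lemma nor_part_0_iff: "nor_part A F p w = 0 \<longleftrightarrow> w \<in> TM p"
  using tan_part_in_TM tan_part_ident by (metis nor_part_def eq_iff_diff_eq_0)

lemma inner_nor_part: "z \<in> normal_space A F p \<Longrightarrow> nor_part A F p w \<bullet> z = w \<bullet> z"
  using tan_part_in_TM[of p w] 
  by (auto simp: normal_space_iff nor_part_def inner_diff_left inner_commute[of "tan_part A F p w"])

lemma normal_space_eqI:
  assumes "v \<in> normal_space A F p" "w \<in> normal_space A F p"
    and "\<And>z. z \<in> normal_space A F p \<Longrightarrow> v \<bullet> z = w \<bullet> z"
  shows "v = w"
proof -
  have "v - w \<in> normal_space A F p" using assms by (simp add: normal_space_iff inner_diff_left)
  then have "(v - w) \<bullet> (v - w) = 0" using assms(3)[of "v - w"] by (simp add: inner_diff_left)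
  then show ?thesis by simp
qed

lemma nor_part_chart:
  assumes c: "c \<in> A" "p \<in> fst c"
  shows "nor_part A F p w =
    w - (\<Sum>i\<in>UNIV. (w \<bullet> parametrization.E (loc c) i (snd c p)) *\<^sub>R pd (loc c) i (snd c p))"
proof -
  interpret parametrization "snd c ` fst c" "loc c" by (rule parametrization[OF c(1)])
  have x: "snd c p \<in> snd c ` fst c" using c by blast
  have E: "E i (snd c p) \<in> TM p" for i
    unfolding E_def using pd_in_TM[OF c] by (intro subspace_sum subspace_TM subspace_scale) auto
  have "tan_part A F p w = (\<Sum>i\<in>UNIV. (tan_part A F p w \<bullet> E i (snd c p)) *\<^sub>R pd (loc c) i (snd c p))"
    by (rule T_expand[OF x]) (use tan_part_in_TM in \<open>simp flip: TM_eq[OF c]\<close>)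
  also have "\<dots> = (\<Sum>i\<in>UNIV. (w \<bullet> E i (snd c p)) *\<^sub>R pd (loc c) i (snd c p))"
    using inner_tan_part[OF E] by (simp add: inner_commute)
  finally show ?thesis by (simp add: nor_part_def)
qed

lemma E_in_TM:
  assumes c: "c \<in> A" "p \<in> fst c" shows "parametrization.E (loc c) i (snd c p) \<in> TM p"
  unfolding parametrization.E_def[OF parametrization[OF c(1)]]
  using pd_in_TM[OF c] by (intro subspace_sum subspace_TM subspace_scale) auto

lemma smooth_nor_part: "smooth_map A \<phi> \<Longrightarrow> smooth_map A (\<lambda>p. nor_part A F p (\<phi> p))"
proof (rule smooth_map_chartsI)
  fix c assume \<phi>: "smooth_map A \<phi>" and c: "c \<in> A"
  interpret parametrization "snd c ` fst c" "loc c" by (rule parametrization[OF c])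
  have "smooth_on (snd c ` fst c) (\<lambda>x. (\<phi> \<circ> chart_inv c) x
      - (\<Sum>i\<in>UNIV. ((\<phi> \<circ> chart_inv c) x \<bullet> E i x) *\<^sub>R pd (loc c) i x))"
    by (intro smooth_intros open_U smooth_f smooth_mapD[OF \<phi> c])
  then show "smooth_on (snd c ` fst c) ((\<lambda>p. nor_part A F p (\<phi> p)) \<circ> chart_inv c)"
    by (rule smooth_on_cong[OF open_U]) (use c in \<open>auto simp: nor_part_chart[OF c]\<close>)
qed

lemma ex_normal_section:
  assumes "z \<in> normal_space A F p"
  obtains \<zeta> where "normal_section_on A F UNIV \<zeta>" "\<zeta> p = z"
proof
  have "smooth_map A (\<lambda>p. z)" by (intro smooth_map_chartsI) (auto simp: o_def intro!: smooth_intros open_image)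
  then show "normal_section_on A F UNIV (\<lambda>p. nor_part A F p z)"
    by (simp add: normal_section_on_def nor_part_normal smooth_nor_part)
qed (simp add: nor_part_ident[OF assms])

subsection \<open>Traces over the frame\<close>

text \<open>
  \<open>\<langle>d\<phi>, d\<psi>\<rangle>\<close>, the polarization of the energy density.
\<close>

definition dinner :: "('p \<Rightarrow> real ^ 'm) \<Rightarrow> ('p \<Rightarrow> real ^ 'm) \<Rightarrow> 'p \<Rightarrow> real" where
  "dinner \<phi> \<psi> p = (\<Sum>b\<in>frm p. nabla A F b \<phi> p \<bullet> nabla A F b \<psi> p)"

lemma dinner_chart:
  assumes c: "c \<in> A" "p \<in> fst c" and W: "open W" "p \<in> W"
    and \<phi>: "smooth_map_on A W \<phi>" and \<psi>: "smooth_map_on A W \<psi>"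
  shows "dinner \<phi> \<psi> p =
    parametrization.grad_inner (loc c) (\<phi> \<circ> chart_inv c) (\<psi> \<circ> chart_inv c) (snd c p)"
proof -
  interpret parametrization "snd c ` fst c" "loc c" by (rule parametrization[OF c(1)])
  let ?x = "snd c p" and ?\<phi> = "\<lambda>i. pd (\<phi> \<circ> chart_inv c) i (snd c p)"
    and ?\<psi> = "\<lambda>i. pd (\<psi> \<circ> chart_inv c) i (snd c p)"
  have x: "?x \<in> snd c ` fst c" using c by blast
  have "dinner \<phi> \<psi> p = (\<Sum>b\<in>frm p. (\<Sum>i\<in>UNIV. (b \<bullet> E i ?x) *\<^sub>R ?\<phi> i) \<bullet> (\<Sum>j\<in>UNIV. (b \<bullet> E j ?x) *\<^sub>R ?\<psi> j))"
    unfolding dinner_def using frame(1)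
    by (intro sum.cong refl) (simp add: nabla_expand[OF c W \<phi>] nabla_expand[OF c W \<psi>] subset_iff)
  also have "\<dots> = (\<Sum>b\<in>frm p. \<Sum>i\<in>UNIV. \<Sum>j\<in>UNIV. ((b \<bullet> E i ?x) * (b \<bullet> E j ?x)) * (?\<phi> i \<bullet> ?\<psi> j))"
    unfolding inner_sum_left unfolding inner_sum_right by (simp add: mult_ac)
  also have "\<dots> = (\<Sum>i\<in>UNIV. \<Sum>j\<in>UNIV. (\<Sum>b\<in>frm p. (b \<bullet> E i ?x) * (b \<bullet> E j ?x)) * (?\<phi> i \<bullet> ?\<psi> j))"
    unfolding sum_distrib_right by (subst sum.swap, rule sum.cong[OF refl], rule sum.swap)
  also have "\<dots> = grad_inner (\<phi> \<circ> chart_inv c) (\<psi> \<circ> chart_inv c) ?x"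
    by (simp add: grad_inner_def frame_parseval[OF E_in_TM[OF c]] E_E[OF x])
  finally show ?thesis .
qed

lemma trace_chart:
  assumes c: "c \<in> A" "p \<in> fst c" and W: "open W" "p \<in> W" and \<phi>: "smooth_map_on A W \<phi>"
  shows "(\<Sum>b\<in>frm p. nabla A F b \<phi> p \<bullet> b) = (\<Sum>i\<in>UNIV. \<Sum>j\<in>UNIV.
    parametrization.Q (loc c) i j (snd c p) * (pd (\<phi> \<circ> chart_inv c) i (snd c p) \<bullet> pd (loc c) j (snd c p)))"
proof -
  interpret parametrization "snd c ` fst c" "loc c" by (rule parametrization[OF c(1)])
  let ?x = "snd c p" and ?\<phi> = "\<lambda>i. pd (\<phi> \<circ> chart_inv c) i (snd c p)"
  have x: "?x \<in> snd c ` fst c" using c by blast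
  have "(\<Sum>b\<in>frm p. nabla A F b \<phi> p \<bullet> b) = (\<Sum>b\<in>frm p. \<Sum>i\<in>UNIV. (b \<bullet> E i ?x) * (b \<bullet> ?\<phi> i))"
    using frame(1)
    by (intro sum.cong refl) (simp add: nabla_expand[OF c W \<phi>] subset_iff inner_sum_left
        inner_commute[of "pd (\<phi> \<circ> chart_inv c) _ (snd c p)"])
  also have "\<dots> = (\<Sum>i\<in>UNIV. \<Sum>b\<in>frm p. (b \<bullet> E i ?x) * (b \<bullet> ?\<phi> i))"
    by (rule sum.swap)
  also have "\<dots> = (\<Sum>i\<in>UNIV. E i ?x \<bullet> ?\<phi> i)"
    by (simp add: frame_parseval[OF E_in_TM[OF c]])
  also have "\<dots> = (\<Sum>i\<in>UNIV. \<Sum>j\<in>UNIV. Q i j ?x * (?\<phi> i \<bullet> pd (loc c) j ?x))"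
    by (simp add: E_def inner_sum_left inner_sum_right inner_commute Q_sym[OF x])
  finally show ?thesis .
qed

subsection \<open>The mean curvature vector\<close>

text \<open>
  Differentiating \<open>\<langle>\<zeta>, Y\<rangle> = 0\<close> expresses \<open>n \<langle>H, \<zeta>\<rangle>\<close> by first derivatives of \<open>\<zeta>\<close>, without
  reference to the chart in which \<open>H\<close> was defined.
\<close>

lemma mean_curvature_inner:
  assumes W: "open W" "p \<in> W" and \<zeta>: "normal_section_on A F W \<zeta>"
  shows "real CARD('n) * (mean_curvature A F p \<bullet> \<zeta> p) = - (\<Sum>b\<in>frm p. nabla A F b \<zeta> p \<bullet> b)"
proof -
  let ?c = "chart_at A p"
  let ?x = "snd ?c p"
  note c = chart_at[of p]
  interpret parametrization "snd ?c ` fst ?c" "loc ?c" by (rule parametrization[OF c(1)])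
  let ?O = "snd ?c ` (fst ?c \<inter> W)"
  have O: "open ?O" "?x \<in> ?O" using open_chart_image_Int c W by auto
  have \<zeta>s: "smooth_map_on A W \<zeta>" and \<zeta>n: "\<And>q. q \<in> W \<Longrightarrow> \<zeta> q \<in> normal_space A F q"
    using \<zeta> unfolding normal_section_on_def by blast+
  have "second_fundamental_form A F p b b \<bullet> \<zeta> p = - (nabla A F b \<zeta> p \<bullet> b)" if b: "b \<in> frm p" for b
  proof -
    obtain v where v: "b = chart_diff ?c F p v"
      using b frame(1)[of p] unfolding tangent_space_def by blast
    let ?Y = "\<lambda>x. frechet_derivative (loc ?c) (at x) v"
    have Y: "smooth_on (snd ?c ` fst ?c) ?Y" by (intro smooth_intros smooth_f)
    have cv: "coords A F p b = v" by (simp add: v coords_chart_diff)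
    have ext: "(extension A F p b \<circ> chart_inv ?c) x = ?Y x" if "x \<in> snd ?c ` fst ?c" for x
      using that c by (auto simp: extension_def cv chart_diff_def)
    have Yd: "?Y differentiable (at ?x)" using smooth_on_differentiable[OF Y] c by blast
    have nY: "nabla A F b (extension A F p b) p = frechet_derivative ?Y (at ?x) v"
    proof -
      have "frechet_derivative ?Y (at ?x)
        = frechet_derivative (extension A F p b \<circ> chart_inv ?c) (at ?x)"
        by (rule frechet_derivative_transform_within_open[OF Yd open_U]) (use c ext in auto)
      then show ?thesis unfolding nabla_def v coords_chart_diff by (simp add: chart_diff_def v)
    qed
    have n\<zeta>: "nabla A F b \<zeta> p = frechet_derivative (\<zeta> \<circ> chart_inv ?c) (at ?x) v"
      unfolding nabla_def v coords_chart_diff by (simp add: chart_diff_def)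
    have \<zeta>d: "(\<zeta> \<circ> chart_inv ?c) differentiable (at ?x)"
      using pulled_differentiable[OF W \<zeta>s c] .
    have z: "(\<zeta> \<circ> chart_inv ?c) y \<bullet> ?Y y = 0" if "y \<in> ?O" for y
    proof -
      obtain q where q: "q \<in> fst ?c" "q \<in> W" "y = snd ?c q" using \<open>y \<in> ?O\<close> by blast
      then have "?Y y \<in> TM q" by (simp add: TM_eq[OF c(1)] parametrization.T_def[OF parametrization[OF c(1)]])
      then show ?thesis using \<zeta>n[OF q(2)] q c by (simp add: normal_space_iff)
    qed
    have "((\<lambda>y. (\<zeta> \<circ> chart_inv ?c) y \<bullet> ?Y y) has_derivative
        (\<lambda>h. (\<zeta> \<circ> chart_inv ?c) ?x \<bullet> frechet_derivative ?Y (at ?x) h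
          + frechet_derivative (\<zeta> \<circ> chart_inv ?c) (at ?x) h \<bullet> ?Y ?x)) (at ?x)"
      by (rule has_derivative_inner) (use \<zeta>d Yd frechet_derivative_works in blast)+
    then have "((\<lambda>y. 0) has_derivative
        (\<lambda>h. (\<zeta> \<circ> chart_inv ?c) ?x \<bullet> frechet_derivative ?Y (at ?x) h
          + frechet_derivative (\<zeta> \<circ> chart_inv ?c) (at ?x) h \<bullet> ?Y ?x)) (at ?x)"
      by (rule has_derivative_transform_within_open[OF _ O]) (rule z)
    then have "(\<lambda>h. (\<zeta> \<circ> chart_inv ?c) ?x \<bullet> frechet_derivative ?Y (at ?x) h
          + frechet_derivative (\<zeta> \<circ> chart_inv ?c) (at ?x) h \<bullet> ?Y ?x) = (\<lambda>h. 0)"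
      using has_derivative_unique has_derivative_const by blast
    from fun_cong[OF this, of v]
    have "\<zeta> p \<bullet> nabla A F b (extension A F p b) p + nabla A F b \<zeta> p \<bullet> ?Y ?x = 0"
      using c by (simp add: nY n\<zeta>)
    moreover have "?Y ?x = b" by (simp add: v chart_diff_def)
    ultimately show ?thesis
      by (simp add: second_fundamental_form_def inner_nor_part[OF \<zeta>n[OF W(2)]] inner_commute[of "\<zeta> p"])
  qed
  then show ?thesis by (simp add: mean_curvature_def inner_sum_left sum_negf)
qed

lemma mean_curvature_normal: "mean_curvature A F p \<in> normal_space A F p"
  using nor_part_normal
  by (auto simp: mean_curvature_def second_fundamental_form_def normal_space_iff inner_sum_left intro!: sum.neutral)

text \<open>
  The definition of \<open>H\<close> uses another chart at each point, which hides that \<open>H\<close> is smooth. Testing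
  against normal sections yields a formula that is valid throughout a chart.
\<close>

lemma mean_curvature_chart:
  assumes c: "c \<in> A" "p \<in> fst c"
  shows "mean_curvature A F p = (1 / real CARD('n)) *\<^sub>R nor_part A F p
    (\<Sum>i\<in>UNIV. \<Sum>j\<in>UNIV. parametrization.Q (loc c) i j (snd c p) *\<^sub>R pd (pd (loc c) j) i (snd c p))"
    (is "_ = _ *\<^sub>R nor_part A F p ?w")
proof (rule normal_space_eqI[of _ p])
  show "(1 / real CARD('n)) *\<^sub>R nor_part A F p ?w \<in> normal_space A F p"
    using nor_part_normal[of p ?w] by (simp add: normal_space_iff)
next
  interpret parametrization "snd c ` fst c" "loc c" by (rule parametrization[OF c(1)])
  let ?x = "snd c p"
  have x: "?x \<in> snd c ` fst c" using c by blast
  fix z assume z: "z \<in> normal_space A F p"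
  then obtain \<zeta> where \<zeta>: "normal_section_on A F UNIV \<zeta>" "\<zeta> p = z" using ex_normal_section by blast
  have \<zeta>s: "smooth_map A \<zeta>" and \<zeta>n: "\<And>q. \<zeta> q \<in> normal_space A F q"
    using \<zeta> unfolding normal_section_on_def by blast+
  have "pd (\<zeta> \<circ> chart_inv c) i ?x \<bullet> pd (loc c) j ?x = - (z \<bullet> pd (pd (loc c) j) i ?x)" for i j
  proof -
    have "0 = pd (\<lambda>y. 0::real) i ?x" by (simp add: pd_const)
    also have "\<dots> = pd (\<lambda>y. (\<zeta> \<circ> chart_inv c) y \<bullet> pd (loc c) j y) i ?x"
    proof (rule pd_cong[OF open_U x])
      fix y assume "y \<in> snd c ` fst c"
      then obtain q where q: "q \<in> fst c" "y = snd c q" by blast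
      then show "0 = (\<zeta> \<circ> chart_inv c) y \<bullet> pd (loc c) j y"
        using \<zeta>n[of q] pd_in_TM[OF c(1) q(1), of j] c by (simp add: normal_space_iff)
    qed simp
    also have "\<dots> = z \<bullet> pd (pd (loc c) j) i ?x + pd (\<zeta> \<circ> chart_inv c) i ?x \<bullet> pd (loc c) j ?x"
      using pd_inner[OF pulled_differentiable[OF open_UNIV UNIV_I \<zeta>s c]
        smooth_on_differentiable[OF smooth_on_pd[OF smooth_f] x], of j i] c \<zeta>(2)
      by simp
    finally show ?thesis by simp
  qed
  then have "real CARD('n) * (mean_curvature A F p \<bullet> z) = ?w \<bullet> z"
    using mean_curvature_inner[OF open_UNIV UNIV_I \<zeta>(1), of p] \<zeta>(2)
      trace_chart[OF c open_UNIV UNIV_I \<zeta>s]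
    by (simp add: inner_sum_left inner_sum_right sum_negf inner_commute)
  then show "mean_curvature A F p \<bullet> z = (1 / real CARD('n)) *\<^sub>R nor_part A F p ?w \<bullet> z"
    by (simp add: inner_nor_part[OF z] field_simps)
qed (rule mean_curvature_normal)

lemma smooth_mean_curvature: "smooth_map A (mean_curvature A F)"
proof (rule smooth_map_chartsI)
  fix c assume c: "c \<in> A"
  interpret parametrization "snd c ` fst c" "loc c" by (rule parametrization[OF c])
  let ?w = "\<lambda>x. \<Sum>i\<in>UNIV. \<Sum>j\<in>UNIV. Q i j x *\<^sub>R pd (pd (loc c) j) i x"
  have w: "smooth_on (snd c ` fst c) ?w" by (intro smooth_intros open_U smooth_f)
  have "smooth_on (snd c ` fst c) (\<lambda>x. (1 / real CARD('n)) *\<^sub>R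
      (?w x - (\<Sum>i\<in>UNIV. (?w x \<bullet> E i x) *\<^sub>R pd (loc c) i x)))"
    by (intro smooth_on_scaleR smooth_on_diff smooth_on_sum smooth_on_inner smooth_on_const
        smooth_E smooth_on_pd w open_U smooth_f)
  then show "smooth_on (snd c ` fst c) (mean_curvature A F \<circ> chart_inv c)"
    by (rule smooth_on_cong[OF open_U]) (use c in \<open>auto simp: mean_curvature_chart[OF c] nor_part_chart[OF c]\<close>)
qed

lemma parallel_pd:
  assumes "parallel_section A F \<phi>" "smooth_map A \<phi>" "c \<in> A" "p \<in> fst c"
  shows "pd (\<phi> \<circ> chart_inv c) i (snd c p) \<in> TM p"
  using assms pd_in_TM[OF assms(3,4)] nabla_pd[OF assms(3,4) open_UNIV UNIV_I assms(2)]
  by (metis nor_part_0_iff normal_connection_def parallel_section_def)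

end

section \<open>The Simons operator as a Laplacian\<close>

locale parallel_normal_submanifold = immersed_submanifold A F
  for A :: "('p::{t2_space, second_countable_topology}, 'n::finite) chart set"
    and F :: "'p \<Rightarrow> real ^ 'm::finite" +
  fixes \<eta> :: "'p \<Rightarrow> real ^ 'm"
  assumes parallel_H: "parallel_section A F (mean_curvature A F)"
    and unit_normal: "unit_normal_section A F \<eta>"
    and parallel_\<eta>: "parallel_section A F \<eta>"
begin

lemma normal_section_\<eta>: "normal_section_on A F UNIV \<eta>"
  and smooth_\<eta>: "smooth_map A \<eta>"
  and \<eta>_normal: "\<eta> p \<in> normal_space A F p"
  and norm_\<eta>: "norm (\<eta> p) = 1"
  using unit_normal unfolding unit_normal_section_def normal_section_on_def by blast+

lemma \<eta>_\<eta>: "\<eta> p \<bullet> \<eta> p = 1"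
  using norm_\<eta>[of p] by (simp add: dot_square_norm)

text \<open>
  The trace of the shape operator of \<open>\<eta>\<close> is \<open>n \<langle>H, \<eta>\<rangle>\<close>, which is locally constant because the
  derivatives of \<open>H\<close> and of \<open>\<eta>\<close> are tangential.
\<close>

lemma parallel_field:
  assumes c: "c \<in> A"
  shows "parallel_normal_field (snd c ` fst c) (loc c) (\<eta> \<circ> chart_inv c)"
proof -
  interpret parametrization "snd c ` fst c" "loc c" by (rule parametrization[OF c])
  let ?h = "\<eta> \<circ> chart_inv c" and ?H = "mean_curvature A F \<circ> chart_inv c"
  show ?thesis
  proof
    show "smooth_on (snd c ` fst c) ?h" by (rule smooth_mapD[OF smooth_\<eta> c])
  next
    fix x i assume "x \<in> snd c ` fst c"
    then obtain p where p: "p \<in> fst c" "x = snd c p" by blast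
    show "?h x \<bullet> pd (loc c) i x = 0"
      using \<eta>_normal[of p] pd_in_TM[OF c p(1)] p c by (simp add: normal_space_iff)
    show "pd ?h i x \<in> T x"
      using parallel_pd[OF parallel_\<eta> smooth_\<eta> c p(1)] p by (simp add: TM_eq[OF c])
  next
    fix x l assume x: "x \<in> snd c ` fst c"
    let ?tr = "\<lambda>y. \<Sum>i\<in>UNIV. \<Sum>j\<in>UNIV. Q i j y * (pd ?h i y \<bullet> pd (loc c) j y)"
    obtain p where p: "p \<in> fst c" "x = snd c p" using x by blast
    have tr: "?tr y = - real CARD('n) * (?H y \<bullet> ?h y)" if y: "y \<in> snd c ` fst c" for y
    proof -
      obtain q where q: "q \<in> fst c" "y = snd c q" using y by blast
      show ?thesis
        using mean_curvature_inner[OF open_UNIV UNIV_I normal_section_\<eta>, of q] q c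
          trace_chart[OF c q(1) open_UNIV UNIV_I smooth_\<eta>] by simp
    qed
    have s: "smooth_on (snd c ` fst c) ?h" "smooth_on (snd c ` fst c) ?H"
      using smooth_mapD smooth_\<eta> smooth_mean_curvature c by blast+
    have d: "?h differentiable (at x)" "?H differentiable (at x)"
      using smooth_on_differentiable[OF s(1) x] smooth_on_differentiable[OF s(2) x] .
    have "pd ?tr l x = pd (\<lambda>y. - real CARD('n) * (?H y \<bullet> ?h y)) l x"
    proof (rule pd_cong[OF open_U x tr])
      have "smooth_on (snd c ` fst c) ?tr" by (intro smooth_intros open_U smooth_f s)
      then show "?tr differentiable (at x)" using smooth_on_differentiable x by blast
    qed
    also have "\<dots> = - real CARD('n) * pd (\<lambda>y. ?H y \<bullet> ?h y) l x"
      by (subst pd_mult) (use d in \<open>auto simp: pd_const intro: differentiable_inner simp del: o_apply\<close>)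
    also have "pd (\<lambda>y. ?H y \<bullet> ?h y) l x = ?H x \<bullet> pd ?h l x + pd ?H l x \<bullet> ?h x"
      by (rule pd_inner[OF d(2,1)])
    also have "\<dots> = 0"
    proof -
      have "pd ?H l x \<in> TM p" "pd ?h l x \<in> TM p"
        using parallel_pd[OF parallel_H smooth_mean_curvature c p(1)]
          parallel_pd[OF parallel_\<eta> smooth_\<eta> c p(1)] p by auto
      then show ?thesis
        using \<eta>_normal[of p] mean_curvature_normal[of p] p c
        by (simp add: normal_space_iff inner_commute[of "pd _ _ _"])
    qed
    also have "- real CARD('n) * (0::real) = 0" by simp
    finally show "pd ?tr l x = 0" .
  qed
qed

lemma nabla_\<eta>_in_TM: "b \<in> TM p \<Longrightarrow> nabla A F b \<eta> p \<in> TM p"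
  using parallel_\<eta> by (simp add: parallel_section_def normal_connection_def nor_part_0_iff)

text \<open>
  As \<open>\<nabla>\<eta>\<close> is tangential, \<open>\<langle>S\<^sub>\<eta>, S\<^sub>\<zeta>\<rangle>\<close> does not see the difference between \<open>\<nabla>\<zeta>\<close> and its
  tangential part.
\<close>

lemma shape_inner_eq: "shape_inner A F \<eta> \<zeta> p = dinner \<eta> \<zeta> p"
  unfolding shape_inner_def dinner_def
proof (rule sum.cong[OF refl])
  fix b assume "b \<in> frm p"
  then have "nabla A F b \<eta> p \<in> TM p" using nabla_\<eta>_in_TM frame(1) by blast
  then show "shape_operator A F \<eta> p b \<bullet> shape_operator A F \<zeta> p b = nabla A F b \<eta> p \<bullet> nabla A F b \<zeta> p"
    by (simp add: shape_operator_def tan_part_ident inner_tan_part)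
qed

lemma laplacian_chart:
  assumes c: "c \<in> A" "p \<in> fst c"
  shows "parametrization.laplacian (loc c) (\<eta> \<circ> chart_inv c) (snd c p) \<in> normal_space A F p"
    and "\<lbrakk>open W; p \<in> W; normal_section_on A F W \<zeta>\<rbrakk> \<Longrightarrow>
      parametrization.laplacian (loc c) (\<eta> \<circ> chart_inv c) (snd c p) \<bullet> \<zeta> p = - dinner \<eta> \<zeta> p"
proof -
  interpret parallel_normal_field "snd c ` fst c" "loc c" "\<eta> \<circ> chart_inv c" by (rule parallel_field[OF c(1)])
  let ?x = "snd c p"
  have x: "?x \<in> snd c ` fst c" using c by blast
  show "laplacian (\<eta> \<circ> chart_inv c) ?x \<in> normal_space A F p"
    unfolding normal_space_iff TM_eq[OF c]
    using orthogonal_TI[OF x] laplacian_normal[OF x] by blast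
  assume W: "open W" "p \<in> W" and \<zeta>: "normal_section_on A F W \<zeta>"
  then have \<zeta>s: "smooth_map_on A W \<zeta>" and \<zeta>n: "\<And>q. q \<in> W \<Longrightarrow> \<zeta> q \<in> normal_space A F q"
    unfolding normal_section_on_def by blast+
  have "laplacian (\<eta> \<circ> chart_inv c) ?x \<bullet> (\<zeta> \<circ> chart_inv c) ?x
      = - grad_inner (\<eta> \<circ> chart_inv c) (\<zeta> \<circ> chart_inv c) ?x"
  proof (rule laplacian_inner_normal[OF x])
    show "open (snd c ` (fst c \<inter> W))" using open_chart_image_Int c W by blast
    show "smooth_on (snd c ` (fst c \<inter> W)) (\<zeta> \<circ> chart_inv c)" using smooth_map_onD \<zeta>s c by blast
    fix y i assume "y \<in> snd c ` (fst c \<inter> W)"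
    then obtain q where q: "q \<in> fst c" "q \<in> W" "y = snd c q" by blast
    then show "(\<zeta> \<circ> chart_inv c) y \<bullet> pd (loc c) i y = 0"
      using \<zeta>n[of q] pd_in_TM[OF c(1) q(1)] c by (simp add: normal_space_iff)
  qed (use c W in auto)
  then show "laplacian (\<eta> \<circ> chart_inv c) ?x \<bullet> \<zeta> p = - dinner \<eta> \<zeta> p"
    using dinner_chart[OF c W smooth_map_on_subset[OF smooth_\<eta> subset_UNIV] \<zeta>s] c by simp
qed

text \<open>
  The Laplacian of \<open>\<eta>\<close> is normal, and \<open>\<langle>- \<Delta>\<eta>, \<zeta>\<rangle> = \<langle>d\<eta>, d\<zeta>\<rangle> = \<langle>S\<^sub>\<eta>, S\<^sub>\<zeta>\<rangle>\<close> for local normal sections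
  \<open>\<zeta>\<close>. This property determines \<open>- \<Delta>\<eta>\<close>, since every normal vector extends to a normal section.
\<close>

lemma simons_chart:
  assumes c: "c \<in> A" "p \<in> fst c"
  shows "simons A F \<eta> p = - parametrization.laplacian (loc c) (\<eta> \<circ> chart_inv c) (snd c p)"
  unfolding simons_def
proof (rule the_equality)
  let ?L = "parametrization.laplacian (loc c) (\<eta> \<circ> chart_inv c) (snd c p)"
  have L: "- ?L \<in> normal_space A F p"
    using laplacian_chart(1)[OF c] by (simp add: normal_space_iff)
  then show "- ?L \<in> normal_space A F p \<and> (\<forall>W \<zeta>. open W \<longrightarrow> p \<in> W \<longrightarrow> normal_section_on A F W \<zeta> \<longrightarrow>
      - ?L \<bullet> \<zeta> p = shape_inner A F \<eta> \<zeta> p)"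
    using laplacian_chart(2)[OF c] by (simp add: shape_inner_eq)
  fix w assume w: "w \<in> normal_space A F p \<and> (\<forall>W \<zeta>. open W \<longrightarrow> p \<in> W \<longrightarrow> normal_section_on A F W \<zeta> \<longrightarrow>
      w \<bullet> \<zeta> p = shape_inner A F \<eta> \<zeta> p)"
  show "w = - ?L"
  proof (rule normal_space_eqI[OF _ L])
    fix z assume "z \<in> normal_space A F p"
    then obtain \<zeta> where "normal_section_on A F UNIV \<zeta>" "\<zeta> p = z" using ex_normal_section by blast
    then show "w \<bullet> z = - ?L \<bullet> z"
      using w laplacian_chart(2)[OF c open_UNIV UNIV_I, of \<zeta>] by (auto simp: shape_inner_eq)
  qed (use w in blast)
qed

abbreviation B where "B \<equiv> simons A F \<eta>"

lemma B_normal: "B p \<in> normal_space A F p"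
  using laplacian_chart(1)[OF chart_at, of p] simons_chart[OF chart_at, of p] by (simp add: normal_space_iff)

lemma B_inner_\<eta>: "B p \<bullet> \<eta> p = dinner \<eta> \<eta> p"
  using laplacian_chart(2)[OF chart_at open_UNIV UNIV_I normal_section_\<eta>, of p]
    simons_chart[OF chart_at, of p] by simp

lemma smooth_B: "smooth_map A B"
proof (rule smooth_map_chartsI)
  fix c assume c: "c \<in> A"
  interpret parallel_normal_field "snd c ` fst c" "loc c" "\<eta> \<circ> chart_inv c" by (rule parallel_field[OF c])
  have "smooth_on (snd c ` fst c) (\<lambda>x. - laplacian (\<eta> \<circ> chart_inv c) x)"
    by (intro smooth_intros open_U smooth_h)
  then show "smooth_on (snd c ` fst c) (B \<circ> chart_inv c)"
    by (rule smooth_on_cong[OF open_U]) (use c in \<open>auto simp: simons_chart\<close>)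
qed

lemma simons_eigenvector_iff:
  "simons_eigenvector A F \<eta> \<longleftrightarrow> (\<forall>p. B p = (B p \<bullet> \<eta> p) *\<^sub>R \<eta> p)"
proof
  assume "simons_eigenvector A F \<eta>"
  then obtain l where l: "\<And>p. B p = l p *\<^sub>R \<eta> p" unfolding simons_eigenvector_def by blast
  have "B p \<bullet> \<eta> p = l p" for p by (simp add: l \<eta>_\<eta>)
  then show "\<forall>p. B p = (B p \<bullet> \<eta> p) *\<^sub>R \<eta> p" using l by simp
next
  assume "\<forall>p. B p = (B p \<bullet> \<eta> p) *\<^sub>R \<eta> p"
  then show "simons_eigenvector A F \<eta>" unfolding simons_eigenvector_def by (intro exI[of _ "\<lambda>p. B p \<bullet> \<eta> p"])
qed

end

section \<open>Change of variables for nonnegative functions\<close>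

lemma has_integral_iff_set_nn_integral:
  fixes f :: "'a::euclidean_space \<Rightarrow> real"
  assumes nonneg: "\<And>x. x \<in> S \<Longrightarrow> 0 \<le> f x" and r: "0 \<le> r"
    and meas: "(\<lambda>x. indicator S x * f x) \<in> borel_measurable borel"
  shows "(f has_integral r) S \<longleftrightarrow> (\<integral>\<^sup>+x\<in>S. ennreal (f x) \<partial>lborel) = ennreal r"
proof
  assume "(\<integral>\<^sup>+x\<in>S. ennreal (f x) \<partial>lborel) = ennreal r"
  also have "(\<integral>\<^sup>+x\<in>S. ennreal (f x) \<partial>lborel) = (\<integral>\<^sup>+x. ennreal (indicator S x * f x) \<partial>lborel)"
    by (rule nn_integral_cong) (simp add: indicator_def)
  finally have "((\<lambda>x. indicator S x * f x) has_integral r) UNIV"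
    using nn_integral_has_integral[OF meas _ _ r] nonneg by (simp add: indicator_def)
  moreover have "(\<lambda>x. indicator S x * f x) = (\<lambda>x. if x \<in> S then f x else 0)"
    by (simp add: indicator_def fun_eq_iff)
  ultimately show "(f has_integral r) S" by (simp add: has_integral_restrict_UNIV)
qed (rule nn_integral_has_integral_lebesgue'[OF nonneg])

text \<open>
  The change of variables for absolutely integrable functions shows that both sides are equal as
  soon as one of them is finite.
\<close>

lemma nn_integral_change_of_variables_wellorder:
  fixes g :: "real ^ 'k::{finite,wellorder} \<Rightarrow> real ^ 'k::{finite,wellorder}" and f :: "real ^ 'k::{finite,wellorder} \<Rightarrow> real"
  assumes S: "S \<in> sets borel"
    and der: "\<And>x. x \<in> S \<Longrightarrow> (g has_derivative g' x) (at x within S)" and inj: "inj_on g S"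
    and nonneg: "\<And>y. y \<in> g ` S \<Longrightarrow> 0 \<le> f y"
    and mf: "(\<lambda>y. indicator (g ` S) y * f y) \<in> borel_measurable borel"
    and mg: "(\<lambda>x. indicator S x * (\<bar>det (matrix (g' x))\<bar> * f (g x))) \<in> borel_measurable borel"
  shows "(\<integral>\<^sup>+x\<in>S. ennreal (\<bar>det (matrix (g' x))\<bar> * f (g x)) \<partial>lborel) = (\<integral>\<^sup>+y\<in>g ` S. ennreal (f y) \<partial>lborel)"
    (is "?L = ?R")
proof -
  let ?f = "\<lambda>x. \<bar>det (matrix (g' x))\<bar> * f (g x)"
  have nn: "0 \<le> ?f x" if "x \<in> S" for x using nonneg that by simp
  have S': "S \<in> sets lebesgue" using S by simp
  have cov: "(?f has_integral r) S \<longleftrightarrow> (f has_integral r) (g ` S)" for r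
  proof -
    have "?f absolutely_integrable_on S \<and> integral S ?f = r \<longleftrightarrow>
      f absolutely_integrable_on (g ` S) \<and> integral (g ` S) f = r"
      using has_absolute_integral_change_of_variables[OF S' der inj, of "\<lambda>y. vec (f y) :: real ^ 1" "vec r"]
      unfolding absolutely_integrable_on_1_iff integral_on_1_eq
      by (simp add: vec_eq_iff)
    moreover have "h absolutely_integrable_on X \<and> integral X h = r \<longleftrightarrow> (h has_integral r) X"
      if "\<And>x. x \<in> X \<Longrightarrow> 0 \<le> h x" for h :: "real ^ 'k::{finite,wellorder} \<Rightarrow> real" and X
      using that by (auto simp: has_integral_iff absolutely_integrable_on_def
          dest: nonnegative_absolutely_integrable_1)
    ultimately show ?thesis using nn nonneg by simp
  qed
  have iff: "?L = ennreal r \<longleftrightarrow> ?R = ennreal r" if "0 \<le> r" for r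
    using has_integral_iff_set_nn_integral[OF nn that mg] has_integral_iff_set_nn_integral[OF nonneg that mf] cov
    by simp
  show ?thesis
  proof (cases ?L)
    case (real r)
    then show ?thesis using iff[of r] by simp
  next
    case top
    show ?thesis
    proof (cases ?R)
      case (real r)
      then show ?thesis using iff[of r] by simp
    next
      case top
      then show ?thesis using \<open>?L = top\<close> by simp
    qed
  qed
qed

text \<open>
  To drop the well-order on the index type, the coordinates are renamed along a bijection with
  an initial segment of the natural numbers.
\<close>

typedef ('n::finite) idx = "{..<CARD('n)}"
  by (auto intro!: exI[of _ 0])

instantiation idx :: (finite) "{finite, wellorder}"
begin

definition less_eq_idx :: "'a idx \<Rightarrow> 'a idx \<Rightarrow> bool" where
  "less_eq_idx i j \<longleftrightarrow> Rep_idx i \<le> Rep_idx j"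

definition less_idx :: "'a idx \<Rightarrow> 'a idx \<Rightarrow> bool" where
  "less_idx i j \<longleftrightarrow> Rep_idx i < Rep_idx j"

instance
proof
  fix P :: "'a idx \<Rightarrow> bool" and a
  assume *: "\<And>x. (\<And>y. y < x \<Longrightarrow> P y) \<Longrightarrow> P x"
  show "P a"
    by (induction a rule: measure_induct_rule[of Rep_idx]) (auto intro: * simp: less_idx_def)
next
  show "finite (UNIV :: 'a idx set)"
    using type_definition.univ[OF type_definition_idx] by (metis finite_imageI finite_lessThan)
qed (auto simp: less_eq_idx_def less_idx_def Rep_idx_inject)

end

lemma ex_bij_idx: "\<exists>\<pi> :: 'n::finite idx \<Rightarrow> 'n. bij \<pi>"
proof -
  have "CARD('n idx) = CARD('n)"
    using type_definition.card[OF type_definition_idx] by simp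
  then show ?thesis using finite_same_card_bij[of "UNIV :: 'n idx set" "UNIV :: 'n set"] by auto
qed

lemma det_rename:
  fixes M :: "real ^ 'n::finite ^ 'n" and \<pi> :: "'k::finite \<Rightarrow> 'n"
  assumes \<pi>: "bij \<pi>"
  shows "det (\<chi> i j. M $ \<pi> i $ \<pi> j) = det M"
  unfolding det_def
proof (rule sum.reindex_bij_witness[where i="\<lambda>q. inv \<pi> \<circ> q \<circ> \<pi>" and j="\<lambda>p. \<pi> \<circ> p \<circ> inv \<pi>"])
  have inv [simp]: "inv \<pi> (\<pi> i) = i" "\<pi> (inv \<pi> j) = j" for i j
    using \<pi> by (simp_all add: bij_is_inj bij_is_surj surj_f_inv_f)
  fix q :: "'n \<Rightarrow> 'n" assume q: "q \<in> {p. p permutes UNIV}"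
  show "\<pi> \<circ> (inv \<pi> \<circ> q \<circ> \<pi>) \<circ> inv \<pi> = q" by (simp add: fun_eq_iff)
  show "inv \<pi> \<circ> q \<circ> \<pi> \<in> {p. p permutes UNIV}"
    using q \<pi> by (auto intro!: bij_imp_permutes bij_comp bij_imp_bij_inv dest: permutes_bij)
next
  have inv [simp]: "inv \<pi> (\<pi> i) = i" "\<pi> (inv \<pi> j) = j" for i j
    using \<pi> by (simp_all add: bij_is_inj bij_is_surj surj_f_inv_f)
  fix p :: "'k \<Rightarrow> 'k" assume p: "p \<in> {p. p permutes UNIV}"
  show "inv \<pi> \<circ> (\<pi> \<circ> p \<circ> inv \<pi>) \<circ> \<pi> = p" by (simp add: fun_eq_iff)
  show "\<pi> \<circ> p \<circ> inv \<pi> \<in> {p. p permutes UNIV}"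
    using p \<pi> by (auto intro!: bij_imp_permutes bij_comp bij_imp_bij_inv dest: permutes_bij)
  have "map_permutation UNIV \<pi> p = \<pi> \<circ> p \<circ> inv \<pi>"
    using \<pi> by (simp add: map_permutation_def restrict_id_def fun_eq_iff bij_is_surj)
  then have "sign (\<pi> \<circ> p \<circ> inv \<pi>) = sign p"
    using sign_map_permutation[of \<pi> UNIV p] p \<pi> by (simp add: bij_is_inj)
  moreover have "(\<Prod>j\<in>UNIV. M $ j $ (\<pi> \<circ> p \<circ> inv \<pi>) j) = (\<Prod>i\<in>UNIV. M $ \<pi> i $ \<pi> (p i))"
    by (rule prod.reindex_bij_witness[where i=\<pi> and j="inv \<pi>"]) auto
  ultimately show "of_int (sign (\<pi> \<circ> p \<circ> inv \<pi>)) * (\<Prod>j\<in>UNIV. M $ j $ (\<pi> \<circ> p \<circ> inv \<pi>) j) =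
      of_int (sign p) * (\<Prod>i\<in>UNIV. (\<chi> i j. M $ \<pi> i $ \<pi> j) $ i $ p i)" by simp
qed

definition rename :: "('k \<Rightarrow> 'n) \<Rightarrow> real ^ 'n \<Rightarrow> real ^ 'k" where
  "rename \<pi> x = (\<chi> i. x $ \<pi> i)"

lemma linear_rename: "linear (rename (\<pi> :: 'k::finite \<Rightarrow> 'n::finite))"
  by (rule linearI) (simp_all add: rename_def vec_eq_iff)

lemma rename_inv: "bij \<pi> \<Longrightarrow> rename (inv \<pi>) (rename \<pi> x) = x" "bij \<pi> \<Longrightarrow> rename \<pi> (rename (inv \<pi>) y) = y"
  by (simp_all add: rename_def vec_eq_iff bij_is_surj surj_f_inv_f bij_is_inj)

lemma measurable_rename [measurable]: "rename (\<pi> :: 'k::finite \<Rightarrow> 'n::finite) \<in> borel \<rightarrow>\<^sub>M borel"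
  by (intro borel_measurable_continuous_onI linear_continuous_on linear_conv_bounded_linear[THEN iffD1] linear_rename)

lemma prod_Basis_vec: "(\<Prod>b\<in>Basis. (z :: real ^ 'n::finite) \<bullet> b) = (\<Prod>i\<in>UNIV. z $ i)"
proof -
  have "(Basis :: (real ^ 'n) set) = (\<lambda>i. axis i 1) ` UNIV" by (auto simp: Basis_vec_def)
  then have "(\<Prod>b\<in>Basis. z \<bullet> b) = (\<Prod>b\<in>(\<lambda>i. axis i 1) ` UNIV. z \<bullet> b)" by (simp only:)
  also have "\<dots> = (\<Prod>i\<in>UNIV. z \<bullet> axis i 1)"
    by (subst prod.reindex) (auto simp: inj_on_def axis_eq_axis)
  finally show ?thesis by (simp add: inner_axis)
qed

lemma lborel_rename:
  assumes \<pi>: "bij (\<pi> :: 'k::finite \<Rightarrow> 'n::finite)"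
  shows "(lborel :: (real ^ 'k) measure) = distr lborel borel (rename \<pi>)"
proof (rule lborel_eqI)
  fix l u :: "real ^ 'k" assume lu: "\<And>b. b \<in> Basis \<Longrightarrow> l \<bullet> b \<le> u \<bullet> b"
  let ?l = "rename (inv \<pi>) l" and ?u = "rename (inv \<pi>) u"
  have i: "inv \<pi> (\<pi> i) = i" "\<pi> (inv \<pi> j) = j" for i j
    using \<pi> by (simp_all add: bij_is_inj bij_is_surj surj_f_inv_f)
  have pre: "rename \<pi> -` box l u = box ?l ?u"
    by (auto simp: mem_box_cart rename_def) (metis i)+
  have "l $ i \<le> u $ i" for i using lu[of "axis i 1"] by (simp add: inner_axis)
  then have "\<And>b. b \<in> Basis \<Longrightarrow> ?l \<bullet> b \<le> ?u \<bullet> b"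
    by (auto simp: Basis_vec_def inner_axis rename_def)
  then have "emeasure lborel (box ?l ?u) = (\<Prod>b\<in>Basis. (?u - ?l) \<bullet> b)"
    by (rule emeasure_lborel_box)
  also have "(\<Prod>b\<in>Basis. (?u - ?l) \<bullet> b) = (\<Prod>i\<in>UNIV. (u - l) $ inv \<pi> i)"
    by (simp add: prod_Basis_vec rename_def)
  also have "\<dots> = (\<Prod>i\<in>UNIV. (u - l) $ i)"
    using i by (intro prod.reindex_bij_witness[where i=\<pi> and j="inv \<pi>"]) auto
  also have "\<dots> = (\<Prod>b\<in>Basis. (u - l) \<bullet> b)" by (simp add: prod_Basis_vec)
  finally show "emeasure (distr lborel borel (rename \<pi>)) (box l u) = (\<Prod>b\<in>Basis. (u - l) \<bullet> b)"
    by (simp add: emeasure_distr pre)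
qed simp

theorem nn_integral_change_of_variables:
  fixes g :: "real ^ 'n::finite \<Rightarrow> real ^ 'n" and f :: "real ^ 'n \<Rightarrow> real"
  assumes S: "S \<in> sets borel"
    and der: "\<And>x. x \<in> S \<Longrightarrow> (g has_derivative g' x) (at x within S)" and inj: "inj_on g S"
    and nonneg: "\<And>y. y \<in> g ` S \<Longrightarrow> 0 \<le> f y"
    and mf: "(\<lambda>y. indicator (g ` S) y * f y) \<in> borel_measurable borel"
    and mg: "(\<lambda>x. indicator S x * (\<bar>det (matrix (g' x))\<bar> * f (g x))) \<in> borel_measurable borel"
    and gS: "g ` S \<in> sets borel"
  shows "(\<integral>\<^sup>+x\<in>S. ennreal (\<bar>det (matrix (g' x))\<bar> * f (g x)) \<partial>lborel) = (\<integral>\<^sup>+y\<in>g ` S. ennreal (f y) \<partial>lborel)"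
proof -
  obtain \<pi> :: "'n idx \<Rightarrow> 'n" where \<pi>: "bij \<pi>" using ex_bij_idx by blast
  let ?R = "rename \<pi>" and ?R' = "rename (inv \<pi>)"
  let ?S = "?R ` S" and ?g = "\<lambda>x. ?R (g (?R' x))" and ?g' = "\<lambda>x v. ?R (g' (?R' x) (?R' v))"
    and ?f = "\<lambda>y. f (?R' y)"
  note [simp] = rename_inv[OF \<pi>]
  have img: "?R ` X = ?R' -` X" for X
    by (auto simp: image_iff) (metis rename_inv(2)[OF \<pi>])
  have S': "?S \<in> sets borel"
    unfolding img using measurable_sets[OF measurable_rename S, of "inv \<pi>"] by simp
  have gimg: "?g ` ?S = ?R ` g ` S" by (simp add: image_image)
  have det': "det (matrix (?g' x)) = det (matrix (g' (?R' x)))" for x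
  proof -
    have "?R' (axis j 1) = axis (\<pi> j) 1" for j
      using \<pi> by (auto simp: rename_def vec_eq_iff axis_def bij_is_inj bij_is_surj surj_f_inv_f)
    then have "matrix (?g' x) = (\<chi> i j. matrix (g' (?R' x)) $ \<pi> i $ \<pi> j)"
      by (simp add: matrix_def vec_eq_iff) (simp add: rename_def)
    then show ?thesis using det_rename[OF \<pi>] by simp
  qed
  have ind: "indicator (?R ` X) x = (indicator X (?R' x) :: 'z::zero_neq_one)" for X x
    unfolding img by (simp add: indicator_def)
  have bl: "bounded_linear ?R" "bounded_linear ?R'"
    using linear_rename linear_conv_bounded_linear by blast+
  have main: "(\<integral>\<^sup>+x\<in>?S. ennreal (\<bar>det (matrix (?g' x))\<bar> * ?f (?g x)) \<partial>lborel) = (\<integral>\<^sup>+y\<in>?g ` ?S. ennreal (?f y) \<partial>lborel)"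
  proof (rule nn_integral_change_of_variables_wellorder[OF S'])
    fix x assume x: "x \<in> ?S"
    then have "?R' x \<in> S" by auto
    then have gd: "(g has_derivative g' (?R' x)) (at (?R' x) within S)" by (rule der)
    have "((\<lambda>x. g (?R' x)) has_derivative (\<lambda>v. g' (?R' x) (?R' v))) (at x within ?S)"
      by (rule has_derivative_in_compose[OF bounded_linear_imp_has_derivative[OF bl(2)]])
        (use gd in \<open>simp add: image_image\<close>)
    then show "(?g has_derivative ?g' x) (at x within ?S)"
      by (rule bounded_linear.has_derivative[OF bl(1)])
  next
    show "inj_on ?g ?S" using inj by (auto simp: inj_on_def) (metis rename_inv(1)[OF \<pi>])
  next
    show "(\<lambda>y. indicator (?g ` ?S) y * ?f y) \<in> borel_measurable borel"
      unfolding gimg ind using measurable_compose[OF measurable_rename mf] by simp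
    show "(\<lambda>x. indicator ?S x * (\<bar>det (matrix (?g' x))\<bar> * ?f (?g x))) \<in> borel_measurable borel"
      unfolding ind det' using measurable_compose[OF measurable_rename mg, of "inv \<pi>"] by simp
  qed (use nonneg in auto)
  have transfer: "(\<integral>\<^sup>+y. h (?R' y) \<partial>lborel) = (\<integral>\<^sup>+x. h x \<partial>lborel)"
    if [measurable]: "h \<in> borel_measurable borel" for h :: "real ^ 'n \<Rightarrow> ennreal"
    by (subst lborel_rename[OF \<pi>]) (simp add: nn_integral_distr)
  have m: "(\<lambda>y. ennreal (f y) * indicator (g ` S) y) \<in> borel_measurable borel"
    "(\<lambda>x. ennreal (\<bar>det (matrix (g' x))\<bar> * f (g x)) * indicator S x) \<in> borel_measurable borel"
  proof -
    have "(\<lambda>y. ennreal (f y) * indicator (g ` S) y) = (\<lambda>y. ennreal (indicator (g ` S) y * f y))"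
      "(\<lambda>x. ennreal (\<bar>det (matrix (g' x))\<bar> * f (g x)) * indicator S x)
        = (\<lambda>x. ennreal (indicator S x * (\<bar>det (matrix (g' x))\<bar> * f (g x))))"
      by (auto simp: fun_eq_iff indicator_def)
    then show "(\<lambda>y. ennreal (f y) * indicator (g ` S) y) \<in> borel_measurable borel"
      "(\<lambda>x. ennreal (\<bar>det (matrix (g' x))\<bar> * f (g x)) * indicator S x) \<in> borel_measurable borel"
      using mf mg by simp_all
  qed
  show ?thesis
    using main unfolding gimg ind det' using transfer[OF m(1)] transfer[OF m(2)] by simp
qed

section \<open>The Riemannian volume\<close>

context atlas begin

lemma borel_chart_image:
  assumes c: "c \<in> A" and B: "B \<in> sets borel" "B \<subseteq> fst c"
  shows "snd c ` B \<in> sets borel"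
proof -
  have U: "snd c ` fst c \<in> sets borel" using open_image[OF c] by simp
  have "chart_inv c \<in> borel_measurable (restrict_space borel (snd c ` fst c))"
    by (rule borel_measurable_continuous_on_restrict[OF continuous_chart_inv[OF c]])
  from measurable_sets[OF this B(1)] show ?thesis
    using U by (simp add: sets_restrict_space_iff space_restrict_space image_eq_preimage[OF c B(2)] Int_commute)
qed

end

context immersed_submanifold begin

text \<open>
  The density \<open>\<surd>g\<close> of the volume in the chart \<open>c\<close>, continued by \<open>0\<close>.
\<close>

definition vdens :: "('p, 'n) chart \<Rightarrow> real ^ 'n \<Rightarrow> real" where
  "vdens c x = indicator (snd c ` fst c) x * sqrt (det (gram F c (chart_inv c x)))"

lemma vdens_eq:
  assumes "c \<in> A" "x \<in> snd c ` fst c" shows "vdens c x = parametrization.\<mu> (loc c) x"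
proof -
  interpret parametrization "snd c ` fst c" "loc c" by (rule parametrization[OF assms(1)])
  show ?thesis
    using assms by (simp add: vdens_def \<mu>_def G_def gram_def chart_diff_def pd_def del: o_apply)
qed

lemma vdens_nonneg: "c \<in> A \<Longrightarrow> 0 \<le> vdens c x"
  using vdens_eq parametrization.\<mu>_pos[OF parametrization]
  by (cases "x \<in> snd c ` fst c") (auto simp: less_imp_le vdens_def)

lemma measurable_vdens [measurable]: "c \<in> A \<Longrightarrow> vdens c \<in> borel_measurable borel"
proof -
  assume c: "c \<in> A"
  interpret parametrization "snd c ` fst c" "loc c" by (rule parametrization[OF c])
  have "(\<lambda>x. indicator (snd c ` fst c) x *\<^sub>R \<mu> x) \<in> borel_measurable borel"
    by (rule borel_measurable_continuous_on_indicator) (use open_U smooth_on_continuous smooth_\<mu> in auto)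
  moreover have "(\<lambda>x. indicator (snd c ` fst c) x *\<^sub>R \<mu> x) = vdens c"
  proof
    fix x
    show "indicator (snd c ` fst c) x *\<^sub>R \<mu> x = vdens c x"
      by (cases "x \<in> snd c ` fst c") (simp add: vdens_eq[OF c], simp add: vdens_def)
  qed
  ultimately show ?thesis by simp
qed

text \<open>
  The Gram matrices are related by \<open>G\<^sub>c = J\<^sup>T G\<^sub>d J\<close>, where \<open>J\<close> is the Jacobian matrix of the
  transition map.
\<close>

lemma vdens_change:
  assumes c: "c \<in> A" "p \<in> fst c" and d: "d \<in> A" "p \<in> fst d"
  shows "\<bar>det (matrix (frechet_derivative (snd d \<circ> chart_inv c) (at (snd c p))))\<bar> * vdens d (snd d p)
    = vdens c (snd c p)"
proof -
  interpret C: parametrization "snd c ` fst c" "loc c" by (rule parametrization[OF c(1)])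
  interpret D: parametrization "snd d ` fst d" "loc d" by (rule parametrization[OF d(1)])
  have x: "snd c p \<in> snd c ` fst c" "snd d p \<in> snd d ` fst d" using c d by auto
  let ?J = "frechet_derivative (snd d \<circ> chart_inv c) (at (snd c p))"
  have "snd c p \<in> snd c ` (fst c \<inter> fst d)" using c d by blast
  then have lin: "linear ?J"
    using linear_frechet_derivative smooth_on_differentiable smooth_transition c d by blast
  define M where "M = matrix ?J"
  have J: "?J v = M *v v" for v unfolding M_def using matrix_works[of ?J v] lin by (simp add: linear_matrix_vector_mul_eq)
  have adj: "(M *v a) \<bullet> y = a \<bullet> (transpose M *v y)" for a y
    by (metis dot_lmul_matrix vector_transpose_matrix)
  have "C.G (snd c p) $ i $ j = (transpose (M) ** D.G (snd d p) ** M) $ i $ j" for i j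
  proof -
    have "C.G (snd c p) $ i $ j = chart_diff c F p (axis i 1) \<bullet> chart_diff c F p (axis j 1)"
      by (simp add: C.G_def chart_diff_def pd_def)
    also have "\<dots> = ?J (axis i 1) \<bullet> (D.G (snd d p) *v ?J (axis j 1))"
      by (simp add: chart_diff_change[OF c d F_diff[OF d]] D.G_inner[OF x(2)]) (simp add: chart_diff_def)
    also have "\<dots> = axis i 1 \<bullet> (transpose (M) *v (D.G (snd d p) *v (M *v axis j 1)))"
      unfolding J adj ..
    also have "\<dots> = axis i 1 \<bullet> ((transpose (M) ** D.G (snd d p) ** M) *v axis j 1)"
      by (simp only: matrix_vector_mul_assoc matrix_mul_assoc)
    also have "\<dots> = (transpose (M) ** D.G (snd d p) ** M) $ i $ j"
      unfolding matrix_vector_mult_basis by (simp add: inner_axis' column_def)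
    finally show ?thesis .
  qed
  then have "C.G (snd c p) = transpose (M) ** D.G (snd d p) ** M"
    by (simp add: vec_eq_iff)
  then have "det (C.G (snd c p)) = (det (M))\<^sup>2 * det (D.G (snd d p))"
    by (simp add: det_mul det_transpose power2_eq_square)
  then show ?thesis
    by (simp add: vdens_eq[OF c(1) x(1)] vdens_eq[OF d(1) x(2)] C.\<mu>_def D.\<mu>_def real_sqrt_mult flip: M_def)
qed

definition chart_measure :: "('p, 'n) chart \<Rightarrow> (real ^ 'n) measure" where
  "chart_measure c = density lborel (\<lambda>x. ennreal (vdens c x))"

lemma chart_measure:
  "c \<in> A \<Longrightarrow> X \<in> sets borel \<Longrightarrow> emeasure (chart_measure c) X = (\<integral>\<^sup>+x\<in>X. ennreal (vdens c x) \<partial>lborel)"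
  by (simp add: chart_measure_def emeasure_density)

lemma chart_measure_change:
  assumes c: "c \<in> A" and d: "d \<in> A" and B: "B \<in> sets borel" "B \<subseteq> fst c" "B \<subseteq> fst d"
  shows "emeasure (chart_measure c) (snd c ` B) = emeasure (chart_measure d) (snd d ` B)"
proof -
  let ?g = "snd d \<circ> chart_inv c" and ?S = "snd c ` B"
  let ?g' = "\<lambda>x. frechet_derivative ?g (at x)"
  have S: "?S \<in> sets borel" "snd d ` B \<in> sets borel" using borel_chart_image c d B by blast+
  have gS: "?g ` ?S = snd d ` B" using c B by (auto simp: image_image subset_iff intro!: image_cong)
  have ch: "\<bar>det (matrix (?g' x))\<bar> * vdens d (?g x) = vdens c x" if "x \<in> ?S" for x
  proof -
    obtain p where p: "p \<in> B" "x = snd c p" using \<open>x \<in> ?S\<close> by blast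
    then have "p \<in> fst c" "p \<in> fst d" using B by blast+
    then show ?thesis using vdens_change[OF c _ d, of p] p c by simp
  qed
  have "(\<integral>\<^sup>+x\<in>?S. ennreal (vdens c x) \<partial>lborel)
      = (\<integral>\<^sup>+x\<in>?S. ennreal (\<bar>det (matrix (?g' x))\<bar> * vdens d (?g x)) \<partial>lborel)"
    by (rule nn_integral_cong) (auto simp: indicator_def ch simp del: o_apply)
  also have "\<dots> = (\<integral>\<^sup>+y\<in>?g ` ?S. ennreal (vdens d y) \<partial>lborel)"
  proof (rule nn_integral_change_of_variables[OF S(1)])
    fix x assume "x \<in> ?S"
    then have "x \<in> snd c ` (fst c \<inter> fst d)" using B by blast
    then show "(?g has_derivative ?g' x) (at x within ?S)"
      using smooth_on_has_derivative[OF smooth_transition[OF c d]] has_derivative_at_withinI by blast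
  next
    show "inj_on ?g ?S"
      using inj_on_chart[OF d] B c by (auto simp: inj_on_def subset_iff)
    show "(\<lambda>y. indicator (?g ` ?S) y * vdens d y) \<in> borel_measurable borel"
      unfolding gS using S(2) d by measurable
    have "(\<lambda>x. indicator ?S x * (\<bar>det (matrix (?g' x))\<bar> * vdens d (?g x))) = (\<lambda>x. indicator ?S x * vdens c x)"
      by (auto simp: fun_eq_iff indicator_def ch simp del: o_apply)
    moreover have "(\<lambda>x. indicator ?S x * vdens c x) \<in> borel_measurable borel" using S(1) c by measurable
    ultimately show "(\<lambda>x. indicator ?S x * (\<bar>det (matrix (?g' x))\<bar> * vdens d (?g x))) \<in> borel_measurable borel" by simp
  qed (use gS S d vdens_nonneg in auto)
  finally show ?thesis unfolding gS chart_measure[OF c S(1)] chart_measure[OF d S(2)] .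
qed

lemma suminf_chart_measure:
  assumes c: "c \<in> A" and B: "range B \<subseteq> sets borel" "disjoint_family B" "\<And>i. B i \<subseteq> fst c"
  shows "(\<Sum>i. emeasure (chart_measure c) (snd c ` B i)) = emeasure (chart_measure c) (snd c ` (\<Union>i::nat. B i))"
  unfolding image_UN
proof (rule suminf_emeasure)
  show "range (\<lambda>i. snd c ` B i) \<subseteq> sets (chart_measure c)"
    using borel_chart_image[OF c] B by (auto simp: chart_measure_def)
  show "disjoint_family (\<lambda>i. snd c ` B i)"
    using B inj_on_chart[OF c] unfolding disjoint_family_on_def
    by (metis Int_subset_iff image_empty inj_on_image_Int)
qed

text \<open>
  Countably many charts cover \<open>M\<close>; cut their domains into disjoint pieces and add up the
  chart measures.
\<close>

lemma ex_volume:
  "\<exists>V :: 'p measure. sets V = sets borel \<and> (\<forall>c\<in>A. \<forall>B\<in>sets borel. B \<subseteq> fst c \<longrightarrow>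
    emeasure V B = emeasure (chart_measure c) (snd c ` B))"
proof -
  obtain \<F> where \<F>: "\<F> \<subseteq> fst ` A" "countable \<F>" "\<Union>\<F> = \<Union>(fst ` A)"
    using Lindelof[of "fst ` A"] open_chart by (metis imageE)
  have cover: "\<Union>\<F> = UNIV" using \<F>(3) ex_chart by auto
  then have "\<F> \<noteq> {}" by auto
  define s where "s k = inv_into A fst (from_nat_into \<F> k)" for k
  have s: "s k \<in> A" "fst (s k) = from_nat_into \<F> k" for k
  proof -
    have "from_nat_into \<F> k \<in> fst ` A" using from_nat_into[OF \<open>\<F> \<noteq> {}\<close>, of k] \<F>(1) by blast
    then show "s k \<in> A" "fst (s k) = from_nat_into \<F> k"
      by (simp_all only: s_def inv_into_into f_inv_into_f)
  qed
  define W where "W = disjointed (\<lambda>k. fst (s k))"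
  have W: "W k \<subseteq> fst (s k)" "W k \<in> sets borel" for k
  proof -
    show "W k \<subseteq> fst (s k)" unfolding W_def by (rule disjointed_subset)
    have "range (\<lambda>k. fst (s k)) \<subseteq> sets borel" using open_chart[OF s(1)] by auto
    from sets.range_disjointed_sets[OF this] show "W k \<in> sets borel" by (auto simp: W_def)
  qed
  have W_disj: "disjoint_family W" unfolding W_def by (rule disjoint_family_disjointed)
  have W_UN: "(\<Union>k. W k) = UNIV"
    using cover range_from_nat_into[OF \<open>\<F> \<noteq> {}\<close> \<F>(2)] by (simp add: W_def UN_disjointed_eq s)
  define m where "m B = (\<Sum>k. emeasure (chart_measure (s k)) (snd (s k) ` (B \<inter> W k)))" for B
  define V where "V = measure_of UNIV (sets (borel :: 'p measure)) m"
  have sV: "sets V = sets borel"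
    unfolding V_def by (metis sets.sigma_sets_eq sets_measure_of space_borel top_greatest Pow_UNIV)
  have ca: "countably_additive (sets V) m"
    unfolding countably_additive_def
  proof safe
    fix B :: "nat \<Rightarrow> 'p set" assume B: "range B \<subseteq> sets V" "disjoint_family B"
    have "(\<Sum>i. m (B i)) = (\<Sum>i. \<integral>\<^sup>+k. emeasure (chart_measure (s k)) (snd (s k) ` (B i \<inter> W k)) \<partial>count_space UNIV)"
      by (simp add: m_def nn_integral_count_space_nat)
    also have "\<dots> = (\<integral>\<^sup>+k. (\<Sum>i. emeasure (chart_measure (s k)) (snd (s k) ` (B i \<inter> W k))) \<partial>count_space UNIV)"
      by (rule nn_integral_suminf[symmetric]) simp
    also have "\<dots> = (\<integral>\<^sup>+k. emeasure (chart_measure (s k)) (snd (s k) ` (\<Union>i. B i \<inter> W k)) \<partial>count_space UNIV)"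
    proof (rule nn_integral_cong)
      fix k
      show "(\<Sum>i. emeasure (chart_measure (s k)) (snd (s k) ` (B i \<inter> W k)))
          = emeasure (chart_measure (s k)) (snd (s k) ` (\<Union>i. B i \<inter> W k))"
        by (rule suminf_chart_measure[OF s(1)]) (use B W sV in \<open>auto simp: disjoint_family_on_def subset_iff\<close>)
    qed
    also have "\<dots> = m (\<Union>i. B i)"
      by (simp add: m_def nn_integral_count_space_nat)
    finally show "(\<Sum>i. m (B i)) = m (\<Union>i. B i)" .
  qed
  have V: "emeasure V B = m B" if "B \<in> sets borel" for B
    by (rule emeasure_measure_of[OF V_def]) (use that sV ca in \<open>auto simp: positive_def m_def\<close>)
  have "emeasure V B = emeasure (chart_measure c) (snd c ` B)" if c: "c \<in> A" and B: "B \<in> sets borel" "B \<subseteq> fst c" for c B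
  proof -
    have "emeasure V B = (\<Sum>k. emeasure (chart_measure c) (snd c ` (B \<inter> W k)))"
      unfolding V[OF B(1)] m_def
      by (intro suminf_cong chart_measure_change s c) (use B W in auto)
    also have "\<dots> = emeasure (chart_measure c) (snd c ` (\<Union>k. B \<inter> W k))"
    proof (rule suminf_chart_measure[OF c])
      show "disjoint_family (\<lambda>k. B \<inter> W k)" using W_disj unfolding disjoint_family_on_def by blast
    qed (use B W in auto)
    also have "(\<Union>k. B \<inter> W k) = B" using W_UN by blast
    finally show ?thesis .
  qed
  then show ?thesis using sV by blast
qed

abbreviation vol :: "'p measure" where "vol \<equiv> volume A F"

lemma volume: "sets vol = sets borel"
  "\<lbrakk>c \<in> A; B \<in> sets borel; B \<subseteq> fst c\<rbrakk> \<Longrightarrow> emeasure vol B = emeasure (chart_measure c) (snd c ` B)"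
proof -
  have e: "emeasure (chart_measure c) (snd c ` B) =
      (\<integral>\<^sup>+x\<in>snd c ` B. ennreal (sqrt (det (gram F c (chart_inv c x)))) \<partial>lborel)"
    if "c \<in> A" "B \<in> sets borel" "B \<subseteq> fst c" for c B
    unfolding chart_measure[OF that(1) borel_chart_image[OF that]]
  proof (rule nn_integral_cong)
    fix x
    show "ennreal (vdens c x) * indicator (snd c ` B) x
        = ennreal (sqrt (det (gram F c (chart_inv c x)))) * indicator (snd c ` B) x"
      using image_mono[OF that(3), of "snd c"]
      by (cases "x \<in> snd c ` B") (auto simp: vdens_def indicator_def)
  qed
  obtain V0 :: "'p measure" where V0: "sets V0 = sets borel"
    "\<forall>c\<in>A. \<forall>B\<in>sets borel. B \<subseteq> fst c \<longrightarrow> emeasure V0 B = emeasure (chart_measure c) (snd c ` B)"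
    using ex_volume by blast
  have "sets V0 = sets borel \<and> (\<forall>c\<in>A. \<forall>B\<in>sets borel. B \<subseteq> fst c \<longrightarrow> emeasure V0 B =
      (\<integral>\<^sup>+x\<in>snd c ` B. ennreal (sqrt (det (gram F c (chart_inv c x)))) \<partial>lborel))"
    using V0 e by simp
  from someI[of "\<lambda>V. sets V = sets borel \<and> (\<forall>c\<in>A. \<forall>B\<in>sets borel. B \<subseteq> fst c \<longrightarrow> emeasure V B =
      (\<integral>\<^sup>+x\<in>snd c ` B. ennreal (sqrt (det (gram F c (chart_inv c x)))) \<partial>lborel))", OF this]
  have *: "sets vol = sets borel \<and> (\<forall>c\<in>A. \<forall>B\<in>sets borel. B \<subseteq> fst c \<longrightarrow> emeasure vol B =
      (\<integral>\<^sup>+x\<in>snd c ` B. ennreal (sqrt (det (gram F c (chart_inv c x)))) \<partial>lborel))"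
    unfolding volume_def .
  then show "sets vol = sets borel" by blast
  assume "c \<in> A" "B \<in> sets borel" "B \<subseteq> fst c"
  then show "emeasure vol B = emeasure (chart_measure c) (snd c ` B)" using * e by simp
qed

lemma space_vol [simp]: "space vol = UNIV"
  using sets_eq_imp_space_eq[OF volume(1)] by simp

lemma measurable_vol [simp]: "borel_measurable vol = borel_measurable borel"
  using measurable_cong_sets[OF volume(1) refl] .

lemma integral_vol_chart:
  fixes \<phi> :: "'p \<Rightarrow> real"
  assumes c: "c \<in> A" and \<phi> [measurable]: "\<phi> \<in> borel_measurable borel" and z: "\<And>p. p \<notin> fst c \<Longrightarrow> \<phi> p = 0"
  shows "integral\<^sup>L vol \<phi> = (\<integral>x. vdens c x * \<phi> (chart_inv c x) \<partial>lborel)"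
proof -
  let ?U = "snd c ` fst c"
  define t where "t x = (if x \<in> ?U then chart_inv c x else undefined)" for x
  have U: "?U \<in> sets borel" "fst c \<in> sets borel" using open_image[OF c] open_chart[OF c] by simp_all
  have t [measurable]: "t \<in> borel \<rightarrow>\<^sub>M borel"
    unfolding t_def
    by (rule measurable_If_restrict_space_iff[THEN iffD2])
      (use U borel_measurable_continuous_on_restrict[OF continuous_chart_inv[OF c]] in auto)
  have eq: "density vol (\<lambda>p. ennreal (indicator (fst c) p)) = distr (chart_measure c) borel t"
  proof (rule measure_eqI)
    fix B assume "B \<in> sets (density vol (\<lambda>p. ennreal (indicator (fst c) p)))"
    then have B: "B \<in> sets borel" by (simp add: volume(1))
    have "emeasure (density vol (\<lambda>p. ennreal (indicator (fst c) p))) B = emeasure vol (fst c \<inter> B)"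
      using B U volume(1) by (simp add: emeasure_density ennreal_indicator nn_integral_indicator
          flip: indicator_inter_arith)
    also have "\<dots> = emeasure (chart_measure c) (snd c ` (fst c \<inter> B))"
      by (rule volume(2)[OF c]) (use U B in auto)
    also have "\<dots> = (\<integral>\<^sup>+x. ennreal (vdens c x) * indicator (snd c ` (fst c \<inter> B)) x \<partial>lborel)"
      by (rule chart_measure[OF c borel_chart_image[OF c]]) (use U B in auto)
    also have "\<dots> = (\<integral>\<^sup>+x. ennreal (vdens c x) * indicator (t -` B) x \<partial>lborel)"
    proof (rule nn_integral_cong)
      fix x
      show "ennreal (vdens c x) * indicator (snd c ` (fst c \<inter> B)) x = ennreal (vdens c x) * indicator (t -` B) x"
        by (cases "x \<in> ?U") (use c in \<open>auto simp: t_def indicator_def vdens_def\<close>)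
    qed
    also have "\<dots> = emeasure (chart_measure c) (t -` B)"
      by (rule chart_measure[OF c, symmetric]) (use measurable_sets[OF t B] in simp)
    also have "\<dots> = emeasure (distr (chart_measure c) borel t) B"
      by (subst emeasure_distr) (use B in \<open>auto simp: chart_measure_def\<close>)
    finally show "emeasure (density vol (\<lambda>p. ennreal (indicator (fst c) p))) B = \<dots>" .
  qed (simp add: volume(1))
  have "integral\<^sup>L vol \<phi> = (\<integral>p. indicator (fst c) p *\<^sub>R \<phi> p \<partial>vol)"
    by (rule Bochner_Integration.integral_cong) (auto simp: indicator_def z)
  also have "\<dots> = integral\<^sup>L (density vol (\<lambda>p. ennreal (indicator (fst c) p))) \<phi>"
    by (rule integral_density[symmetric]) (use U in auto)
  also have "\<dots> = (\<integral>x. \<phi> (t x) \<partial>chart_measure c)"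
    unfolding eq by (rule integral_distr) (auto simp: chart_measure_def)
  also have "\<dots> = (\<integral>x. vdens c x *\<^sub>R \<phi> (t x) \<partial>lborel)"
    unfolding chart_measure_def using c vdens_nonneg by (intro integral_density) auto
  also have "\<dots> = (\<integral>x. vdens c x * \<phi> (chart_inv c x) \<partial>lborel)"
    by (rule Bochner_Integration.integral_cong) (auto simp: t_def vdens_def)
  finally show ?thesis .
qed

end

section \<open>Integration by parts\<close>

lemma smooth_on_extend_zero:
  assumes U: "open U" and K: "compact K" "K \<subseteq> U" and f: "smooth_on U f" and z: "\<And>x. x \<notin> K \<Longrightarrow> f x = 0"
  shows "smooth_on UNIV f"
proof -
  have K': "open (- K)" using K compact_imp_closed by blast
  have "smooth_on (- K) f"
    by (rule smooth_on_cong[OF K' smooth_on_const[OF K', of 0]]) (simp add: z)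
  from smooth_on_Un[OF U K' f this] have "smooth_on (U \<union> - K) f" .
  moreover have "U \<union> - K = UNIV" using K by blast
  ultimately show ?thesis by simp
qed

text \<open>
  By translation invariance the difference quotients of \<open>\<psi>\<close> integrate to \<open>0\<close>; so does their limit.
\<close>

lemma integral_pd_eq_0:
  fixes \<psi> :: "real ^ 'n::finite \<Rightarrow> real"
  assumes \<psi>: "smooth_on UNIV \<psi>" and K: "compact K" and z: "\<And>x. x \<notin> K \<Longrightarrow> \<psi> x = 0"
  shows "integrable lborel (pd \<psi> j)" "(\<integral>x. pd \<psi> j x \<partial>lborel) = 0"
proof -
  define e :: "real ^ 'n" where "e = axis j 1"
  have pd_e: "pd \<psi> j x = frechet_derivative \<psi> (at x) e" for x by (simp add: pd_def e_def)
  define t where "t n = 1 / real (Suc n)" for n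
  have t: "0 < t n" "t n \<le> 1" for n by (simp_all add: t_def)
  have t0: "t \<longlonglongrightarrow> 0" unfolding t_def by (rule LIMSEQ_inverse_real_of_nat[unfolded inverse_eq_divide])
  have c\<psi>: "continuous_on UNIV \<psi>" "continuous_on UNIV (pd \<psi> j)"
    using \<psi> smooth_on_continuous smooth_on_pd by blast+
  have m [measurable]: "\<psi> \<in> borel_measurable borel" "pd \<psi> j \<in> borel_measurable borel"
    using c\<psi> borel_measurable_continuous_onI by blast+
  have pd0: "pd \<psi> j x = 0" if x: "x \<notin> K" for x
  proof -
    have "pd (\<lambda>x. 0::real) j x = pd \<psi> j x"
      by (rule pd_cong[of "- K"]) (use K x z compact_imp_closed in auto)
    then show ?thesis by (simp add: pd_const)
  qed
  obtain R where R: "K \<subseteq> cball 0 R" using compact_imp_bounded[OF K] unfolding bounded_iff by (auto simp: subset_iff)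
  obtain C where C: "\<And>x. \<bar>pd \<psi> j x\<bar> \<le> C"
  proof -
    have "bounded (pd \<psi> j ` K)"
      using compact_imp_bounded[OF compact_continuous_image] K c\<psi> continuous_on_subset by blast
    then obtain C where "\<And>x. x \<in> K \<Longrightarrow> \<bar>pd \<psi> j x\<bar> \<le> C" unfolding bounded_iff by auto
    then show thesis using pd0 by (intro that[of "max C 0"]) (metis abs_zero le_max_iff_disj order_refl)
  qed
  then have C0: "C \<ge> 0" using abs_ge_zero order_trans by blast
  have int\<psi>: "integrable lborel \<psi>"
  proof -
    have "integrable lborel (\<lambda>x. indicator K x *\<^sub>R \<psi> x)"
      using borel_integrable_compact K c\<psi>(1) continuous_on_subset by blast
    moreover have "(\<lambda>x. indicator K x *\<^sub>R \<psi> x) = \<psi>" using z by (auto simp: indicator_def fun_eq_iff)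
    ultimately show ?thesis by simp
  qed
  have der: "((\<lambda>s. \<psi> (x + s *\<^sub>R e)) has_real_derivative pd \<psi> j (x + s *\<^sub>R e)) (at s)" for x s
  proof -
    have D: "(\<psi> has_derivative frechet_derivative \<psi> (at (x + s *\<^sub>R e))) (at (x + s *\<^sub>R e))"
      using smooth_on_has_derivative[OF \<psi>] by blast
    have "((\<lambda>s. x + s *\<^sub>R e) has_derivative (\<lambda>h. h *\<^sub>R e)) (at s)" by (auto intro!: derivative_eq_intros)
    from has_derivative_compose[OF this D] show ?thesis
      by (simp add: has_field_derivative_def linear_cmul[OF has_derivative_linear[OF D]] mult_commute_abs pd_e)
  qed
  define D where "D n x = (\<psi> (x + t n *\<^sub>R e) - \<psi> x) / t n" for n x
  have mv: "\<exists>s. 0 < s \<and> s < t n \<and> D n x = pd \<psi> j (x + s *\<^sub>R e)" for n x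
    using MVT2[OF t(1)[of n], of "\<lambda>s. \<psi> (x + s *\<^sub>R e)" "\<lambda>s. pd \<psi> j (x + s *\<^sub>R e)"] der t(1)[of n]
    by (auto simp: D_def)
  have bound: "norm (D n x) \<le> C * indicator (cball 0 (R + 1)) x" for n x
  proof (cases "x \<in> cball 0 (R + 1)")
    case True
    then show ?thesis using mv[of n x] C by auto
  next
    case False
    have "\<psi> (x + s *\<^sub>R e) = 0" if "0 \<le> s" "s \<le> 1" for s
    proof -
      have "norm x \<le> norm (x + s *\<^sub>R e) + norm (s *\<^sub>R e)" using norm_triangle_ineq4[of "x + s *\<^sub>R e" "s *\<^sub>R e"] by simp
      also have "norm (s *\<^sub>R e) \<le> 1" using that by (simp add: e_def)
      finally have "norm (x + s *\<^sub>R e) > R" using False by simp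
      then show ?thesis using R by (intro z) (auto simp: subset_iff)
    qed
    from this[of 0] this[of "t n"] show ?thesis using t[of n] C0 by (simp add: D_def less_imp_le)
  qed
  have lim: "(\<lambda>n. D n x) \<longlonglongrightarrow> pd \<psi> j x" for x
  proof -
    have "((\<lambda>h. (\<psi> (x + (0 + h) *\<^sub>R e) - \<psi> (x + 0 *\<^sub>R e)) / h) \<longlongrightarrow> pd \<psi> j (x + 0 *\<^sub>R e)) (at 0)"
      using der[of x 0] unfolding DERIV_def .
    moreover have "filterlim t (at 0) sequentially"
      using t0 t(1) by (auto simp: filterlim_at less_imp_neq[symmetric])
    ultimately have "(\<lambda>n. (\<psi> (x + (0 + t n) *\<^sub>R e) - \<psi> (x + 0 *\<^sub>R e)) / t n) \<longlonglongrightarrow> pd \<psi> j (x + 0 *\<^sub>R e)"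
      by (rule filterlim_compose)
    then show ?thesis by (simp add: D_def)
  qed
  have w: "integrable lborel (\<lambda>x. C * indicator (cball (0 :: real ^ 'n) (R + 1)) x)"
    by (intro integrable_mult_right integrable_real_indicator)
      (use emeasure_lborel_cball_finite[of "0 :: real ^ 'n" "R + 1"] in auto)
  have mD: "D n \<in> borel_measurable lborel" for n unfolding D_def by measurable
  have trans: "integrable lborel (\<lambda>x. \<psi> (x + a))" "(\<integral>x. \<psi> (x + a) \<partial>lborel) = (\<integral>x. \<psi> x \<partial>lborel)" for a
  proof -
    have "integrable (distr lborel borel ((+) a)) \<psi>" using int\<psi> by (simp add: lborel_distr_plus)
    then show "integrable lborel (\<lambda>x. \<psi> (x + a))"
      by (subst (asm) integrable_distr_eq) (auto simp: add.commute)
    have "(\<integral>x. \<psi> x \<partial>lborel) = (\<integral>x. \<psi> x \<partial>distr lborel borel ((+) a))" by (simp add: lborel_distr_plus)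
    also have "\<dots> = (\<integral>x. \<psi> (x + a) \<partial>lborel)" by (subst integral_distr) (auto simp: add.commute)
    finally show "(\<integral>x. \<psi> (x + a) \<partial>lborel) = (\<integral>x. \<psi> x \<partial>lborel)" by simp
  qed
  have D0: "(\<integral>x. D n x \<partial>lborel) = 0" for n
    using trans[of "t n *\<^sub>R e"] int\<psi> by (simp add: D_def)
  show "integrable lborel (pd \<psi> j)"
    by (rule integrable_dominated_convergence[of _ lborel D "\<lambda>x. C * indicator (cball 0 (R + 1)) x"])
      (use w mD lim bound in auto)
  have "(\<lambda>n. \<integral>x. D n x \<partial>lborel) \<longlonglongrightarrow> (\<integral>x. pd \<psi> j x \<partial>lborel)"
    by (rule integral_dominated_convergence[where w="\<lambda>x. C * indicator (cball 0 (R + 1)) x"])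
      (use w mD lim bound in auto)
  then show "(\<integral>x. pd \<psi> j x \<partial>lborel) = 0" using D0 LIMSEQ_unique[OF tendsto_const] by fastforce
qed

context atlas begin

lemma smooth_map_extend_zero:
  assumes W: "open W" "smooth_map_on A W \<phi>" and K: "closed K" "K \<subseteq> W" and z: "\<And>p. p \<notin> K \<Longrightarrow> \<phi> p = 0"
  shows "smooth_map A \<phi>"
proof (rule smooth_map_on_locally)
  fix p
  show "\<exists>V. open V \<and> p \<in> V \<and> smooth_map_on A V \<phi>"
  proof (cases "p \<in> K")
    case True then show ?thesis using W K by blast
  next
    case False
    have o: "open (- K)" using K by blast
    have "smooth_map_on A (- K) (\<lambda>p. 0)"
      unfolding smooth_map_on_def o_def using open_chart_image_Int[OF _ o] smooth_on_const by blast
    then have "smooth_map_on A (- K) \<phi>"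
      by (rule smooth_map_on_cong[OF _ o]) (simp add: z)
    then show ?thesis using o False by blast
  qed
qed

lemma compact_chart_cball:
  assumes c: "c \<in> A" and r: "cball x r \<subseteq> snd c ` fst c"
  shows "compact (chart_inv c ` cball x r)" "chart_inv c ` cball x r \<subseteq> fst c"
proof -
  show "compact (chart_inv c ` cball x r)"
    by (rule compact_continuous_image[OF continuous_on_subset[OF continuous_chart_inv[OF c] r]]) simp
  show "chart_inv c ` cball x r \<subseteq> fst c" using r c by auto
qed

lemma ex_chart_ball:
  assumes c: "c \<in> A" "p \<in> fst c" "open W" "p \<in> W"
  obtains r where "r > 0" "cball (snd c p) r \<subseteq> snd c ` (fst c \<inter> W)"
  using open_chart_image_Int[OF c(1,3)] c open_contains_cball by (metis Int_iff image_eqI)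

definition chart_bump :: "('p, 'n) chart \<Rightarrow> real ^ 'n \<Rightarrow> real \<Rightarrow> 'p \<Rightarrow> real" where
  "chart_bump c x r q = (if q \<in> fst c then bump x r (snd c q) else 0)"

lemma chart_bump:
  assumes c: "c \<in> A" and r: "r > 0" "cball x r \<subseteq> snd c ` fst c"
  shows "smooth_map A (chart_bump c x r)" "\<And>q. 0 \<le> chart_bump c x r q"
    "\<And>q. q \<in> chart_inv c ` ball x r \<Longrightarrow> 0 < chart_bump c x r q"
    "\<And>q. q \<notin> chart_inv c ` ball x r \<Longrightarrow> chart_bump c x r q = 0"
proof -
  have b: "ball x r \<subseteq> snd c ` fst c" using r by (meson ball_subset_cball order_trans)
  show nn: "0 \<le> chart_bump c x r q" for q by (simp add: chart_bump_def bump_nonneg)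
  show "0 < chart_bump c x r q" if q: "q \<in> chart_inv c ` ball x r" for q
  proof -
    obtain y where y: "y \<in> ball x r" "q = chart_inv c y" using q by blast
    then obtain p where "p \<in> fst c" "y = snd c p" using b by blast
    then show ?thesis using y c bump_pos[OF y(1)] by (simp add: chart_bump_def)
  qed
  show z: "chart_bump c x r q = 0" if q: "q \<notin> chart_inv c ` ball x r" for q
  proof (cases "q \<in> fst c")
    case True
    then have "snd c q \<notin> ball x r" using q c by (metis chart_inv_chart image_eqI)
    then show ?thesis by (simp add: chart_bump_def bump_zero r)
  qed (simp add: chart_bump_def)
  show "smooth_map A (chart_bump c x r)"
  proof (rule smooth_map_extend_zero[OF open_chart[OF c]])
    have "smooth_on (snd c ` fst c) (chart_bump c x r \<circ> chart_inv c)"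
      by (rule smooth_on_cong[OF open_image[OF c] smooth_on_subset[OF smooth_on_bump subset_UNIV]])
        (use c in \<open>auto simp: chart_bump_def\<close>)
    then show "smooth_map_on A (fst c) (chart_bump c x r)"
      using smooth_map_on_chartI[OF c open_chart[OF c]] by blast
    show "closed (chart_inv c ` cball x r)" "chart_inv c ` cball x r \<subseteq> fst c"
      using compact_chart_cball[OF c r(2)] compact_imp_closed by blast+
    show "chart_bump c x r p = 0" if "p \<notin> chart_inv c ` cball x r" for p
      using z that ball_subset_cball by blast
  qed
qed

end

context immersed_submanifold begin

lemma nabla_add:
  assumes \<phi>: "open W" "p \<in> W" "smooth_map_on A W \<phi>" and \<psi>: "smooth_map_on A W \<psi>"
  shows "nabla A F X (\<lambda>p. \<phi> p + \<psi> p) p = nabla A F X \<phi> p + nabla A F X \<psi> p"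
proof -
  let ?c = "chart_at A p"
  have "((\<lambda>x. (\<phi> \<circ> chart_inv ?c) x + (\<psi> \<circ> chart_inv ?c) x) has_derivative
      (\<lambda>h. frechet_derivative (\<phi> \<circ> chart_inv ?c) (at (snd ?c p)) h
        + frechet_derivative (\<psi> \<circ> chart_inv ?c) (at (snd ?c p)) h)) (at (snd ?c p))"
    by (rule has_derivative_add)
      (use pulled_differentiable[OF \<phi> chart_at] pulled_differentiable[OF \<phi>(1,2) \<psi> chart_at]
        frechet_derivative_works in blast)+
  from frechet_derivative_at[OF this, symmetric] show ?thesis
    by (simp add: nabla_def chart_diff_def o_def)
qed

lemma nabla_sum:
  assumes "open W" "p \<in> W" "\<And>i. i \<in> I \<Longrightarrow> smooth_map_on A W (\<phi> i)"
  shows "nabla A F X (\<lambda>p. \<Sum>i\<in>I. \<phi> i p) p = (\<Sum>i\<in>I. nabla A F X (\<phi> i) p)"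
proof -
  have "((\<lambda>x. \<Sum>i\<in>I. (\<phi> i \<circ> chart_inv (chart_at A p)) x) has_derivative
      (\<lambda>h. \<Sum>i\<in>I. frechet_derivative (\<phi> i \<circ> chart_inv (chart_at A p)) (at (snd (chart_at A p) p)) h))
      (at (snd (chart_at A p) p))"
    by (rule has_derivative_sum)
      (use pulled_differentiable[OF assms(1,2) assms(3) chart_at] frechet_derivative_works in blast)
  from frechet_derivative_at[OF this, symmetric] show ?thesis
    by (simp add: nabla_def chart_diff_def o_def)
qed

lemma nabla_locally_0:
  assumes "open W" "p \<in> W" "\<And>q. q \<in> W \<Longrightarrow> \<phi> q = 0"
  shows "nabla A F X \<phi> p = 0"
proof -
  let ?c = "chart_at A p"
  note c = chart_at[of p]
  have "frechet_derivative (\<lambda>x. 0) (at (snd ?c p)) = frechet_derivative (\<phi> \<circ> chart_inv ?c) (at (snd ?c p))"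
    by (rule frechet_derivative_transform_within_open[OF _ open_chart_image_Int[OF c(1) assms(1)]])
      (use assms c in auto)
  then have "frechet_derivative (\<phi> \<circ> chart_inv ?c) (at (snd ?c p)) = (\<lambda>v. 0)"
    by (simp only: frechet_derivative_const)
  then show ?thesis by (simp add: nabla_def chart_diff_def)
qed

lemma dinner_locally_0: "open W \<Longrightarrow> p \<in> W \<Longrightarrow> (\<And>q. q \<in> W \<Longrightarrow> \<psi> q = 0) \<Longrightarrow> dinner \<phi> \<psi> p = 0"
  using nabla_locally_0 by (simp add: dinner_def)

lemma dinner_nonneg: "0 \<le> dinner \<phi> \<phi> p"
  by (simp add: dinner_def sum_nonneg)

lemma energy_density_eq: "energy_density A F \<phi> p = dinner \<phi> \<phi> p"
  by (simp add: energy_density_def dinner_def dot_square_norm)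

lemma smooth_dinner:
  assumes \<phi>: "smooth_map A \<phi>" and \<psi>: "smooth_map A \<psi>"
  shows "smooth_map A (dinner \<phi> \<psi>)"
proof (rule smooth_map_chartsI)
  fix c assume c: "c \<in> A"
  interpret parametrization "snd c ` fst c" "loc c" by (rule parametrization[OF c])
  have "smooth_on (snd c ` fst c) (grad_inner (\<phi> \<circ> chart_inv c) (\<psi> \<circ> chart_inv c))"
    by (intro smooth_intros smooth_mapD \<phi> \<psi> c)
  then show "smooth_on (snd c ` fst c) (dinner \<phi> \<psi> \<circ> chart_inv c)"
    by (rule smooth_on_cong[OF open_U]) (use c in \<open>auto simp: dinner_chart[OF c _ open_UNIV UNIV_I \<phi> \<psi>]\<close>)
qed

lemma continuous_smooth_map: "smooth_map A \<phi> \<Longrightarrow> continuous_on UNIV \<phi>"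
  by (rule smooth_map_on_continuous[OF open_UNIV])

lemma smooth_map_inner:
  fixes \<phi> :: "'p \<Rightarrow> 'b::euclidean_space"
  shows "smooth_map A \<phi> \<Longrightarrow> smooth_map A \<psi> \<Longrightarrow> smooth_map A (\<lambda>p. \<phi> p \<bullet> \<psi> p)"
  unfolding smooth_map_on_def o_def by (auto intro!: smooth_intros open_image)

lemma smooth_map_scaleR:
  fixes \<phi> :: "'p \<Rightarrow> 'b::euclidean_space"
  shows "smooth_map A a \<Longrightarrow> smooth_map A \<phi> \<Longrightarrow> smooth_map A (\<lambda>p. a p *\<^sub>R \<phi> p)"
  unfolding smooth_map_on_def o_def by (auto intro!: smooth_intros open_image)

lemma smooth_map_diff:
  fixes \<phi> :: "'p \<Rightarrow> 'b::euclidean_space"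
  shows "smooth_map A \<phi> \<Longrightarrow> smooth_map A \<psi> \<Longrightarrow> smooth_map A (\<lambda>p. \<phi> p - \<psi> p)"
  unfolding smooth_map_on_def o_def by (auto intro!: smooth_intros open_image)

lemma smooth_map_sum:
  fixes \<phi> :: "'i \<Rightarrow> 'p \<Rightarrow> 'b::euclidean_space"
  shows "(\<And>i. i \<in> I \<Longrightarrow> smooth_map A (\<phi> i)) \<Longrightarrow> smooth_map A (\<lambda>p. \<Sum>i\<in>I. \<phi> i p)"
  unfolding smooth_map_on_def o_def by (auto intro!: smooth_intros open_image)

lemma vol_compact:
  assumes "compact K" shows "emeasure vol K < \<infinity>"
proof -
  have "\<exists>N. open N \<and> p \<in> N \<and> emeasure vol N < \<infinity>" for p
  proof -
    obtain c where c: "c \<in> A" "p \<in> fst c" using ex_chart by blast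
    obtain r where r: "r > 0" "cball (snd c p) r \<subseteq> snd c ` (fst c \<inter> UNIV)"
      using ex_chart_ball[OF c open_UNIV UNIV_I] by blast
    let ?B = "ball (snd c p) r" and ?K = "cball (snd c p) r"
    let ?O = "fst c \<inter> snd c -` ?B"
    interpret parametrization "snd c ` fst c" "loc c" by (rule parametrization[OF c(1)])
    have K: "?K \<subseteq> snd c ` fst c" using r by simp
    have "bounded (\<mu> ` ?K)"
      by (intro compact_imp_bounded compact_continuous_image continuous_on_subset[OF smooth_on_continuous[OF smooth_\<mu>]] K compact_cball)
    then obtain C where "\<forall>y\<in>\<mu> ` ?K. norm y \<le> C" unfolding bounded_iff by blast
    then have C: "\<bar>\<mu> x\<bar> \<le> C" if "x \<in> ?K" for x using that by auto
    have "emeasure vol ?O = emeasure (chart_measure c) (snd c ` ?O)"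
      by (rule volume(2)[OF c(1)]) (use open_chart_preimage[OF c(1)] in auto)
    also have "\<dots> = (\<integral>\<^sup>+x. ennreal (vdens c x) * indicator (snd c ` ?O) x \<partial>lborel)"
      by (rule chart_measure[OF c(1) borel_chart_image[OF c(1)]]) (use open_chart_preimage[OF c(1)] in auto)
    also have "\<dots> \<le> (\<integral>\<^sup>+x. ennreal C * indicator ?K x \<partial>lborel)"
    proof (rule nn_integral_mono)
      fix x
      show "ennreal (vdens c x) * indicator (snd c ` ?O) x \<le> ennreal C * indicator ?K x"
      proof (cases "x \<in> snd c ` ?O")
        case True
        then have x: "x \<in> ?K" by auto
        then have "vdens c x \<le> C" using C[OF x] K vdens_eq[OF c(1), of x] by auto
        then show ?thesis using True x by (simp add: ennreal_leI)
      qed simp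
    qed
    also have "\<dots> = ennreal C * emeasure lborel ?K" by (rule nn_integral_cmult_indicator) simp
    also have "\<dots> < \<infinity>" using emeasure_lborel_cball_finite[of "snd c p" r] by (simp add: ennreal_mult_less_top)
    finally have "emeasure vol ?O < \<infinity>" .
    then show ?thesis using open_chart_preimage[OF c(1)] c r by (intro exI[of _ ?O]) auto
  qed
  then obtain N where N: "\<And>p. open (N p)" "\<And>p. p \<in> N p" "\<And>p. emeasure vol (N p) < \<infinity>" by metis
  have "K \<subseteq> (\<Union>p\<in>UNIV. N p)" using N(2) by blast
  with assms N(1) obtain P where P: "finite P" "K \<subseteq> (\<Union>p\<in>P. N p)"
    by (rule compactE_image)
  have m: "N p \<in> sets vol" for p using N(1) by (simp add: volume(1))
  have "emeasure vol K \<le> emeasure vol (\<Union>p\<in>P. N p)"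
    using P m by (intro emeasure_mono) auto
  also have "\<dots> \<le> (\<Sum>p\<in>P. emeasure vol (N p))" using P m by (intro emeasure_subadditive_finite) auto
  also have "\<dots> < \<infinity>" using N(3) P by (simp add: less_top)
  finally show ?thesis .
qed

lemma integrable_vol:
  fixes \<phi> :: "'p \<Rightarrow> real"
  assumes \<phi>: "continuous_on UNIV \<phi>" and K: "compact K" and z: "\<And>p. p \<notin> K \<Longrightarrow> \<phi> p = 0"
  shows "integrable vol \<phi>"
proof -
  have "bounded (\<phi> ` K)"
    using compact_imp_bounded[OF compact_continuous_image] K \<phi> continuous_on_subset by blast
  then obtain C where C: "\<And>p. p \<in> K \<Longrightarrow> norm (\<phi> p) \<le> C" unfolding bounded_iff by auto
  show ?thesis
  proof (rule integrableI_bounded_set[of K])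
    show "K \<in> sets vol" using K by (simp add: volume(1) compact_imp_closed borel_closed)
    show "\<phi> \<in> borel_measurable vol" using borel_measurable_continuous_onI[OF \<phi>] by simp
  qed (use vol_compact[OF K] C z in auto)
qed

end

context parallel_normal_submanifold begin

text \<open>
  If \<open>W\<close> is supported in a chart, the integrand is a divergence by \<open>divergence_flux\<close>.
\<close>

lemma green_chart:
  assumes c: "c \<in> A" and W: "smooth_map A W" and K: "compact K" "K \<subseteq> fst c" and z: "\<And>p. p \<notin> K \<Longrightarrow> W p = 0"
  shows "(\<integral>p. dinner \<eta> W p - B p \<bullet> W p \<partial>vol) = 0"
proof -
  interpret parallel_normal_field "snd c ` fst c" "loc c" "\<eta> \<circ> chart_inv c" by (rule parallel_field[OF c])
  let ?U = "snd c ` fst c" and ?h = "\<eta> \<circ> chart_inv c" and ?w = "W \<circ> chart_inv c"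
  let ?K = "snd c ` K"
  define \<psi> where "\<psi> j x = (if x \<in> ?U then flux ?h j x \<bullet> ?w x else 0)" for j x
  have w: "smooth_on ?U ?w" by (rule smooth_mapD[OF W c])
  have K': "compact ?K" "?K \<subseteq> ?U"
    using K compact_continuous_image[OF continuous_on_subset[OF continuous_chart[OF c]]] by auto
  have \<psi>U: "smooth_on ?U (\<psi> j)" for j
  proof -
    have "smooth_on ?U (\<lambda>x. flux ?h j x \<bullet> ?w x)" by (intro smooth_intros open_U smooth_h w)
    then show ?thesis by (rule smooth_on_cong[OF open_U]) (simp add: \<psi>_def)
  qed
  have \<psi>0: "\<psi> j x = 0" if "x \<notin> ?K" for j x
  proof (cases "x \<in> ?U")
    case True
    then obtain p where p: "p \<in> fst c" "x = snd c p" by blast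
    then have "W p = 0" using z that by blast
    then show ?thesis using p c by (simp add: \<psi>_def)
  qed (simp add: \<psi>_def)
  have \<psi>s: "smooth_on UNIV (\<psi> j)" for j
    by (rule smooth_on_extend_zero[OF open_U K' \<psi>U \<psi>0])
  have eq: "vdens c x * (dinner \<eta> W (chart_inv c x) - B (chart_inv c x) \<bullet> W (chart_inv c x))
      = (\<Sum>j\<in>UNIV. pd (\<psi> j) j x)" for x
  proof (cases "x \<in> ?U")
    case True
    then obtain p where p: "p \<in> fst c" "x = snd c p" by blast
    have wd: "?w differentiable (at x)" using smooth_on_differentiable[OF w True] .
    have "pd (\<psi> j) j x = pd (\<lambda>y. flux ?h j y \<bullet> ?w y) j x" for j
      by (rule pd_cong[OF open_U True]) (auto simp: \<psi>_def smooth_on_differentiable[OF \<psi>U True])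
    then have "(\<Sum>j\<in>UNIV. pd (\<psi> j) j x) = \<mu> x * (laplacian ?h x \<bullet> ?w x + grad_inner ?h ?w x)"
      using divergence_flux[OF True smooth_h wd] by simp
    also have "grad_inner ?h ?w x = dinner \<eta> W p"
      using dinner_chart[OF c p(1) open_UNIV UNIV_I smooth_\<eta> W] p by simp
    also have "laplacian ?h x = - B p" using simons_chart[OF c p(1)] p by simp
    finally have s: "(\<Sum>j\<in>UNIV. pd (\<psi> j) j x) = \<mu> x * (- B p \<bullet> ?w x + dinner \<eta> W p)" .
    have "?w x = W p" "chart_inv c x = p" using p c by simp_all
    then show ?thesis unfolding s vdens_eq[OF c True] by (simp only:) (simp add: algebra_simps)
  next
    case False
    have "pd (\<psi> j) j x = 0" for j
    proof -
      have "pd (\<lambda>y. 0::real) j x = pd (\<psi> j) j x"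
        by (rule pd_cong[of "- ?K"]) (use K' False \<psi>0 in \<open>auto simp: open_Compl compact_imp_closed\<close>)
      then show ?thesis by (simp add: pd_const)
    qed
    then show ?thesis using False by (simp add: vdens_def)
  qed
  have "(\<integral>p. dinner \<eta> W p - B p \<bullet> W p \<partial>vol) =
      (\<integral>x. vdens c x * (dinner \<eta> W (chart_inv c x) - B (chart_inv c x) \<bullet> W (chart_inv c x)) \<partial>lborel)"
  proof (rule integral_vol_chart[OF c])
    show "(\<lambda>p. dinner \<eta> W p - B p \<bullet> W p) \<in> borel_measurable borel"
      by (intro borel_measurable_continuous_onI continuous_on_diff continuous_on_inner continuous_smooth_map
          smooth_dinner smooth_\<eta> smooth_B W)
    fix p assume "p \<notin> fst c"
    then have p: "p \<in> - K" using K by blast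
    have "dinner \<eta> W p = 0"
      by (rule dinner_locally_0[OF _ p]) (use K z compact_imp_closed in auto)
    then show "dinner \<eta> W p - B p \<bullet> W p = 0" using z p by simp
  qed
  also have "\<dots> = (\<integral>x. (\<Sum>j\<in>UNIV. pd (\<psi> j) j x) \<partial>lborel)" by (simp only: eq)
  also have "\<dots> = (\<Sum>j\<in>UNIV. \<integral>x. pd (\<psi> j) j x \<partial>lborel)"
    by (rule Bochner_Integration.integral_sum) (rule integral_pd_eq_0(1)[OF \<psi>s K'(1) \<psi>0])
  also have "\<dots> = 0" using integral_pd_eq_0(2)[OF \<psi>s K'(1) \<psi>0] by simp
  finally show ?thesis .
qed

text \<open>
  Green's identity \<open>\<integral>\<langle>d\<eta>, dW\<rangle> = - \<integral>\<langle>\<Delta>\<eta>, W\<rangle>\<close> follows from the case of a single chart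
  by a partition of unity on the compact set \<open>K\<close>. The sum \<open>\<beta>\<close> of the bump functions may vanish
  outside \<open>K\<close>, but there \<open>W / \<beta> = 0\<close> in any case.
\<close>

lemma green:
  assumes W: "smooth_map A W" and K: "compact K" and z: "\<And>p. p \<notin> K \<Longrightarrow> W p = 0"
  shows "(\<integral>p. dinner \<eta> W p - B p \<bullet> W p \<partial>vol) = 0"
proof -
  have "\<exists>b S c. smooth_map A b \<and> (\<forall>q. 0 \<le> b q) \<and> 0 < (b p :: real) \<and> c \<in> A \<and> compact S \<and> S \<subseteq> fst c \<and> (\<forall>q. q \<notin> S \<longrightarrow> b q = 0)" for p
  proof -
    obtain c where c: "c \<in> A" "p \<in> fst c" using ex_chart by blast
    obtain r where r: "r > 0" "cball (snd c p) r \<subseteq> snd c ` (fst c \<inter> UNIV)"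
      using ex_chart_ball[OF c open_UNIV UNIV_I] by blast
    then have r2: "cball (snd c p) r \<subseteq> snd c ` fst c" by simp
    have "p \<in> chart_inv c ` ball (snd c p) r"
      using c r(1) by (intro image_eqI[of _ _ "snd c p"]) auto
    moreover have "chart_inv c ` ball (snd c p) r \<subseteq> chart_inv c ` cball (snd c p) r"
      by (rule image_mono[OF ball_subset_cball])
    ultimately show ?thesis
      using chart_bump[OF c(1) r(1) r2] compact_chart_cball[OF c(1) r2] c(1)
      by (intro exI[of _ "chart_bump c (snd c p) r"] exI[of _ "chart_inv c ` cball (snd c p) r"] exI[of _ c]) blast
  qed
  then obtain b S c where b: "\<And>p. smooth_map A (b p)" "\<And>p q. 0 \<le> b p q" "\<And>p. 0 < (b p p :: real)"
    and S: "\<And>p. c p \<in> A" "\<And>p. compact (S p)" "\<And>p. S p \<subseteq> fst (c p)" "\<And>p q. q \<notin> S p \<Longrightarrow> b p q = 0"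
    by metis
  have cb: "open {q. 0 < b p q}" for p
    using continuous_smooth_map[OF b(1)] by (intro open_Collect_less continuous_on_const)
  have "K \<subseteq> (\<Union>p\<in>UNIV. {q. 0 < b p q})" using b(3) by blast
  with K cb obtain P where P: "finite P" "K \<subseteq> (\<Union>p\<in>P. {q. 0 < b p q})"
    by (rule compactE_image)
  define \<beta> where "\<beta> q = (\<Sum>p\<in>P. b p q)" for q
  have \<beta>: "smooth_map A \<beta>" unfolding \<beta>_def[abs_def] by (intro smooth_map_sum b)
  have \<beta>_pos: "0 < \<beta> q" if q: "q \<in> K" for q
  proof -
    obtain p where "p \<in> P" "0 < b p q" using P q by blast
    then show ?thesis unfolding \<beta>_def using P b(2) by (intro sum_pos2[of P p]) auto
  qed
  define W' where "W' q = inverse (\<beta> q) *\<^sub>R W q" for q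
  have W'z: "W' q = 0" if "q \<notin> K" for q using z[OF that] by (simp add: W'_def)
  have W': "smooth_map A W'"
  proof (rule smooth_map_extend_zero)
    let ?V = "{q. 0 < \<beta> q}"
    show V: "open ?V" using continuous_smooth_map[OF \<beta>] by (intro open_Collect_less continuous_on_const)
    show "smooth_map_on A ?V W'"
      unfolding smooth_map_on_def
    proof
      fix c assume c: "c \<in> A"
      have o: "open (snd c ` (fst c \<inter> ?V))" using open_chart_image_Int[OF c V] .
      have s: "smooth_on (snd c ` (fst c \<inter> ?V)) (\<beta> \<circ> chart_inv c)" "smooth_on (snd c ` (fst c \<inter> ?V)) (W \<circ> chart_inv c)"
        using smooth_map_onD[OF smooth_map_on_subset[OF \<beta> subset_UNIV] c]
          smooth_map_onD[OF smooth_map_on_subset[OF W subset_UNIV] c] by blast+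
      have "smooth_on (snd c ` (fst c \<inter> ?V)) (\<lambda>x. inverse ((\<beta> \<circ> chart_inv c) x) *\<^sub>R (W \<circ> chart_inv c) x)"
        by (intro smooth_on_scaleR smooth_on_inverse o s) (use c in auto)
      then show "smooth_on (snd c ` (fst c \<inter> ?V)) (W' \<circ> chart_inv c)" by (simp add: W'_def o_def)
    qed
    show "closed K" "K \<subseteq> ?V" using K compact_imp_closed \<beta>_pos by auto
  qed (rule W'z)
  define Wp where "Wp p q = b p q *\<^sub>R W' q" for p q
  have Wp: "smooth_map A (Wp p)" for p unfolding Wp_def[abs_def] by (intro smooth_map_scaleR b W')
  have Wsum: "W = (\<lambda>q. \<Sum>p\<in>P. Wp p q)"
  proof
    fix q
    show "W q = (\<Sum>p\<in>P. Wp p q)"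
    proof (cases "q \<in> K")
      case True
      have "(\<Sum>p\<in>P. Wp p q) = \<beta> q *\<^sub>R W' q" by (simp add: Wp_def \<beta>_def scaleR_sum_left)
      then show ?thesis using \<beta>_pos[OF True] by (simp add: W'_def)
    next
      case False
      then show ?thesis by (simp add: z Wp_def W'z)
    qed
  qed
  have "dinner \<eta> W q - B q \<bullet> W q = (\<Sum>p\<in>P. dinner \<eta> (Wp p) q - B q \<bullet> Wp p q)" for q
  proof -
    have "dinner \<eta> W q = (\<Sum>p\<in>P. dinner \<eta> (Wp p) q)"
      unfolding dinner_def Wsum using nabla_sum[OF open_UNIV UNIV_I, of P Wp _ q] Wp
      by (simp add: inner_sum_right) (rule sum.swap)
    moreover have "B q \<bullet> W q = (\<Sum>p\<in>P. B q \<bullet> Wp p q)" by (subst Wsum) (simp add: inner_sum_right)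
    ultimately show ?thesis by (simp add: sum_subtractf)
  qed
  then have "(\<integral>q. dinner \<eta> W q - B q \<bullet> W q \<partial>vol) = (\<integral>q. (\<Sum>p\<in>P. dinner \<eta> (Wp p) q - B q \<bullet> Wp p q) \<partial>vol)"
    by simp
  also have "\<dots> = (\<Sum>p\<in>P. \<integral>q. dinner \<eta> (Wp p) q - B q \<bullet> Wp p q \<partial>vol)"
  proof (rule Bochner_Integration.integral_sum, rule integrable_vol[OF _ S(2)])
    fix p q assume q: "q \<notin> S p"
    have "dinner \<eta> (Wp p) q = 0"
      by (rule dinner_locally_0[of "- S p"]) (use S q in \<open>auto simp: Wp_def open_Compl compact_imp_closed\<close>)
    then show "dinner \<eta> (Wp p) q - B q \<bullet> Wp p q = 0" using S(4)[OF q] by (simp add: Wp_def)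
  qed (intro continuous_on_diff continuous_on_inner continuous_smooth_map smooth_dinner smooth_\<eta> smooth_B Wp)
  also have "\<dots> = 0"
  proof (intro sum.neutral ballI)
    fix p
    show "(\<integral>q. dinner \<eta> (Wp p) q - B q \<bullet> Wp p q \<partial>vol) = 0"
      by (rule green_chart[OF S(1)[of p] Wp S(2)[of p] S(3)[of p]]) (simp add: Wp_def S(4)[of _ p])
  qed
  finally show ?thesis .
qed

text \<open>
  The energy is quadratic; Green's identity is applied to its mixed term.
\<close>

lemma energy_expand:
  assumes W: "smooth_map A W" and D: "compact D" and z: "\<And>p. p \<notin> D \<Longrightarrow> W p = 0"
  shows "energy A F D (\<lambda>p. \<eta> p + W p) = energy A F D \<eta> + (\<integral>p. 2 * (B p \<bullet> W p) + dinner W W p \<partial>vol)"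
proof -
  have Dm: "D \<in> sets borel" using D by (simp add: compact_imp_closed borel_closed)
  have out: "dinner \<eta> W p = 0" "dinner W W p = 0" if "p \<notin> D" for p
    using dinner_locally_0[of "- D" p W] that z D compact_imp_closed by auto
  have i: "integrable vol (\<lambda>p. dinner \<eta> W p - B p \<bullet> W p)" "integrable vol (\<lambda>p. B p \<bullet> W p)"
    "integrable vol (\<lambda>p. dinner W W p)" "integrable vol (\<lambda>p. dinner \<eta> W p)"
    by (rule integrable_vol[OF _ D]; (simp add: out z)?;
        intro continuous_on_diff continuous_on_inner continuous_smooth_map smooth_dinner smooth_\<eta> smooth_B W)+
  have e: "dinner (\<lambda>p. \<eta> p + W p) (\<lambda>p. \<eta> p + W p) p = dinner \<eta> \<eta> p + (2 * dinner \<eta> W p + dinner W W p)" for p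
    unfolding dinner_def nabla_add[OF open_UNIV UNIV_I smooth_\<eta> W]
    by (simp add: inner_add_left inner_add_right sum.distrib sum_distrib_left inner_commute)
  have e\<eta>: "set_integrable vol D (dinner \<eta> \<eta>)"
  proof -
    have "bounded (dinner \<eta> \<eta> ` D)"
      by (intro compact_imp_bounded compact_continuous_image D continuous_on_subset[OF continuous_smooth_map] smooth_dinner smooth_\<eta>) simp
    then obtain C where "\<And>p. p \<in> D \<Longrightarrow> norm (dinner \<eta> \<eta> p) \<le> C" unfolding bounded_iff by auto
    moreover have "dinner \<eta> \<eta> \<in> borel_measurable borel"
      by (intro borel_measurable_continuous_onI continuous_smooth_map smooth_dinner smooth_\<eta>)
    ultimately show ?thesis unfolding set_integrable_def
      using vol_compact[OF D] Dm by (intro integrableI_bounded_set[of D]) (auto simp: volume(1))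
  qed
  have "energy A F D (\<lambda>p. \<eta> p + W p) = (\<integral>p. indicator D p * dinner \<eta> \<eta> p + (2 * dinner \<eta> W p + dinner W W p) \<partial>vol)"
    unfolding energy_def set_lebesgue_integral_def energy_density_eq e
    by (rule Bochner_Integration.integral_cong) (auto simp: indicator_def out)
  also have "\<dots> = energy A F D \<eta> + (\<integral>p. 2 * dinner \<eta> W p + dinner W W p \<partial>vol)"
    unfolding energy_def set_lebesgue_integral_def energy_density_eq
    using e\<eta> i by (subst Bochner_Integration.integral_add) (auto simp: set_integrable_def)
  also have "(\<integral>p. 2 * dinner \<eta> W p + dinner W W p \<partial>vol)
      = (\<integral>p. 2 * (dinner \<eta> W p - B p \<bullet> W p) + (2 * (B p \<bullet> W p) + dinner W W p) \<partial>vol)"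
    by (rule Bochner_Integration.integral_cong) auto
  also have "\<dots> = (\<integral>p. 2 * (B p \<bullet> W p) + dinner W W p \<partial>vol)"
    using i green[OF W D z] by (subst Bochner_Integration.integral_add) auto
  finally show ?thesis .
qed

end

section \<open>Variations\<close>

lemma has_real_derivative_0_quadratic:
  fixes f :: "real \<Rightarrow> real"
  assumes "\<delta> > 0" "\<And>t. \<bar>t\<bar> < \<delta> \<Longrightarrow> \<bar>f t - f 0\<bar> \<le> M * t\<^sup>2"
  shows "(f has_real_derivative 0) (at 0)"
  unfolding DERIV_def
proof (rule Lim_null_comparison)
  show "\<forall>\<^sub>F h in at 0. norm ((f (0 + h) - f 0) / h) \<le> M * \<bar>h\<bar>"
    unfolding eventually_at
  proof (intro exI[of _ \<delta>] conjI ballI impI)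
    fix h :: real assume "h \<noteq> 0 \<and> dist h 0 < \<delta>"
    then have "\<bar>f h - f 0\<bar> \<le> M * (\<bar>h\<bar> * \<bar>h\<bar>)" "\<bar>h\<bar> > 0"
      using assms(2)[of h] by (auto simp: power2_eq_square)
    then show "norm ((f (0 + h) - f 0) / h) \<le> M * \<bar>h\<bar>" by (simp add: divide_le_eq mult.assoc)
  qed (rule assms)
  show "((\<lambda>h. M * \<bar>h\<bar>) \<longlongrightarrow> 0) (at 0)" by (intro tendsto_eq_intros) auto
qed

lemma slice_bound:
  fixes g :: "real \<times> 'a::euclidean_space \<Rightarrow> 'b::euclidean_space"
  assumes g: "smooth_on S g" and S: "\<And>s. \<bar>s\<bar> \<le> d \<Longrightarrow> (s, x) \<in> S"
    and K: "\<And>s. \<bar>s\<bar> \<le> d \<Longrightarrow> norm (frechet_derivative g (at (s, x)) (1, 0)) \<le> K"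
    and t: "\<bar>t\<bar> \<le> d"
  shows "norm (g (t, x) - g (0, x)) \<le> K * \<bar>t\<bar>"
proof -
  let ?D = "\<lambda>s. frechet_derivative g (at (s, x))"
  have "norm (g (t, x) - g (0, x)) \<le> K * norm (t - 0)"
  proof (rule differentiable_bound[of "{-d..d}" "\<lambda>s. g (s, x)" "\<lambda>s h. ?D s (h, 0)"])
    fix s assume s: "s \<in> {-d..d}"
    then have "(s, x) \<in> S" using S by auto
    then have D: "(g has_derivative ?D s) (at (s, x))" by (rule smooth_on_has_derivative[OF g])
    have "((\<lambda>s. (s, x)) has_derivative (\<lambda>h. (h, 0))) (at s within {-d..d})"
      by (auto intro!: derivative_eq_intros)
    from has_derivative_compose[OF this D]
    show "((\<lambda>s. g (s, x)) has_derivative (\<lambda>h. ?D s (h, 0))) (at s within {-d..d})" .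
    have lin: "?D s (h, 0) = h *\<^sub>R ?D s (1, 0)" for h
      using linear_cmul[OF has_derivative_linear[OF D], of h "(1, 0)"] by simp
    show "onorm (\<lambda>h. ?D s (h, 0)) \<le> K"
    proof (rule onorm_le)
      fix h
      have "norm (?D s (h, 0)) = norm (?D s (1, 0)) * norm h"
        by (subst lin) (simp add: mult.commute)
      also have "\<dots> \<le> K * norm h" using K[of s] s by (intro mult_right_mono) auto
      finally show "norm (?D s (h, 0)) \<le> K * norm h" .
    qed
  qed (use t in auto)
  then show ?thesis by simp
qed

context immersed_submanifold begin

text \<open>
  By the mean value theorem in \<open>t\<close>, for the map and for its partial derivatives, a smooth variation
  changes by \<open>O(t)\<close> in \<open>C\<^sup>1\<close>, locally uniformly.
\<close>

lemma smooth_family_bound_local: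
  assumes \<Phi>: "smooth_family A \<epsilon> \<Phi>" "\<epsilon> > 0" "\<And>t. \<bar>t\<bar> < \<epsilon> \<Longrightarrow> smooth_map A (\<Phi> t)"
  shows "\<exists>N K. open N \<and> p0 \<in> N \<and> 0 \<le> K \<and> (\<forall>p\<in>N. \<forall>t. \<bar>t\<bar> \<le> \<epsilon> / 2 \<longrightarrow>
    norm (\<Phi> t p - \<Phi> 0 p) \<le> K * \<bar>t\<bar> \<and>
    dinner (\<lambda>p. \<Phi> t p - \<Phi> 0 p) (\<lambda>p. \<Phi> t p - \<Phi> 0 p) p \<le> K * t\<^sup>2)"
proof -
  obtain c where c: "c \<in> A" "p0 \<in> fst c" using ex_chart by blast
  obtain r where r: "r > 0" "cball (snd c p0) r \<subseteq> snd c ` (fst c \<inter> UNIV)"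
    using ex_chart_ball[OF c open_UNIV UNIV_I] by blast
  interpret parametrization "snd c ` fst c" "loc c" by (rule parametrization[OF c(1)])
  let ?U = "snd c ` fst c" and ?B = "cball (snd c p0) r" and ?d = "\<epsilon> / 2"
  let ?S = "{-\<epsilon><..<\<epsilon>} \<times> ?U" and ?C = "{-?d..?d} \<times> ?B"
  have B: "?B \<subseteq> ?U" using r by simp
  have S: "open ?S" using open_U by (intro open_Times) auto
  have CS: "?C \<subseteq> ?S" using B \<Phi>(2) by (intro Sigma_mono) auto
  have C: "compact ?C" by (intro compact_Times) auto
  define g where "g = (\<lambda>(t, x). \<Phi> t (chart_inv c x))"
  have g: "smooth_on ?S g" using \<Phi>(1) c unfolding smooth_family_def g_def by blast
  let ?D = "\<lambda>g z. frechet_derivative g (at z)"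
  let ?gi = "\<lambda>i z. ?D g z (0, axis i 1)"
  have gi: "smooth_on ?S (?gi i)" for i by (intro smooth_intros g)
  have bdd: "\<exists>K\<ge>0. \<forall>z\<in>X. \<bar>h z\<bar> \<le> K" if "compact X" "continuous_on X h" for X and h :: "'z::metric_space \<Rightarrow> real"
  proof -
    have "bounded (h ` X)" by (intro compact_imp_bounded compact_continuous_image that)
    then obtain K where "\<forall>y\<in>h ` X. norm y \<le> K" unfolding bounded_iff by blast
    then show ?thesis by (intro exI[of _ "max K 0"]) auto
  qed
  have "continuous_on ?C (\<lambda>z. norm (?D g z (1, 0)))"
    by (intro continuous_on_norm continuous_on_subset[OF _ CS] smooth_on_continuous smooth_intros g)
  from bdd[OF C this] obtain K1 where K1: "K1 \<ge> 0" "\<And>z. z \<in> ?C \<Longrightarrow> norm (?D g z (1, 0)) \<le> K1" by auto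
  have "continuous_on ?C (\<lambda>z. \<Sum>i\<in>UNIV. norm (?D (?gi i) z (1, 0)))"
    by (intro continuous_on_sum continuous_on_norm continuous_on_subset[OF _ CS] smooth_on_continuous smooth_intros g)
  from bdd[OF C this] obtain K2 where K2: "K2 \<ge> 0"
    "\<And>z. z \<in> ?C \<Longrightarrow> \<bar>\<Sum>i\<in>UNIV. norm (?D (?gi i) z (1, 0))\<bar> \<le> K2" by blast
  have K2': "norm (?D (?gi i) z (1, 0)) \<le> K2" if "z \<in> ?C" for z i
  proof -
    have "norm (?D (?gi i) z (1, 0)) \<le> (\<Sum>i\<in>UNIV. norm (?D (?gi i) z (1, 0)))"
      by (rule member_le_sum) auto
    then show ?thesis using K2(2)[OF that] by linarith
  qed
  have "continuous_on ?B (\<lambda>x. \<Sum>i\<in>UNIV. \<Sum>j\<in>UNIV. \<bar>Q i j x\<bar>)"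
    by (intro continuous_on_sum continuous_on_rabs continuous_on_subset[OF _ B] smooth_on_continuous smooth_Q)
  from bdd[OF compact_cball this] obtain K3 where K3: "K3 \<ge> 0"
    "\<And>x. x \<in> ?B \<Longrightarrow> \<bar>\<Sum>i\<in>UNIV. \<Sum>j\<in>UNIV. \<bar>Q i j x\<bar>\<bar> \<le> K3" by blast
  define K where "K = max K1 (K3 * K2\<^sup>2)"
  have main: "norm (\<Phi> t p - \<Phi> 0 p) \<le> K * \<bar>t\<bar> \<and>
    dinner (\<lambda>p. \<Phi> t p - \<Phi> 0 p) (\<lambda>p. \<Phi> t p - \<Phi> 0 p) p \<le> K * t\<^sup>2"
    if p: "p \<in> fst c" "snd c p \<in> ball (snd c p0) r" and t: "\<bar>t\<bar> \<le> ?d" for p t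
  proof
    let ?x = "snd c p"
    have xB: "?x \<in> ?B" using p by auto
    have xU: "?x \<in> ?U" using p by blast
    have sC: "(s, ?x) \<in> ?C" if "\<bar>s\<bar> \<le> ?d" for s using xB that by auto
    have sS: "(s, ?x) \<in> ?S" if "\<bar>s\<bar> \<le> ?d" for s using sC[OF that] CS by blast
    have "norm (g (t, ?x) - g (0, ?x)) \<le> K1 * \<bar>t\<bar>"
      by (rule slice_bound[OF g sS K1(2)[OF sC] t])
    also have "\<dots> \<le> K * \<bar>t\<bar>" by (intro mult_right_mono) (auto simp: K_def)
    finally show "norm (\<Phi> t p - \<Phi> 0 p) \<le> K * \<bar>t\<bar>" using c p by (simp add: g_def)
    have te: "\<bar>t\<bar> < \<epsilon>" "\<bar>0::real\<bar> < \<epsilon>" using t \<Phi>(2) by auto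
    let ?W = "\<lambda>p. \<Phi> t p - \<Phi> 0 p"
    have W: "smooth_map A ?W" by (intro smooth_map_diff \<Phi>(3) te)
    have pdg: "((\<lambda>x. g (s, x)) has_derivative (\<lambda>v. ?D g (s, ?x) (0, v))) (at ?x)" if "\<bar>s\<bar> \<le> ?d" for s
    proof -
      have "((\<lambda>x. (s, x)) has_derivative (\<lambda>v. (0, v))) (at ?x)" by (auto intro!: derivative_eq_intros)
      from has_derivative_compose[OF this smooth_on_has_derivative[OF g sS[OF that]]] show ?thesis .
    qed
    have "((\<lambda>x. g (t, x) - g (0, x)) has_derivative (\<lambda>v. ?D g (t, ?x) (0, v) - ?D g (0, ?x) (0, v))) (at ?x)"
      by (intro has_derivative_diff pdg t) (use \<Phi>(2) in simp)
    moreover have "?W \<circ> chart_inv c = (\<lambda>x. g (t, x) - g (0, x))" by (simp add: g_def o_def)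
    ultimately have "pd (?W \<circ> chart_inv c) i ?x = ?gi i (t, ?x) - ?gi i (0, ?x)" for i
      by (simp add: pd_eqI)
    then have pdW: "norm (pd (?W \<circ> chart_inv c) i ?x) \<le> K2 * \<bar>t\<bar>" for i
      using slice_bound[OF gi sS K2'[OF sC] t, of i] by simp
    have "dinner ?W ?W p = (\<Sum>i\<in>UNIV. \<Sum>j\<in>UNIV. Q i j ?x * (pd (?W \<circ> chart_inv c) i ?x \<bullet> pd (?W \<circ> chart_inv c) j ?x))"
      using dinner_chart[OF c(1) p(1) open_UNIV UNIV_I W W] by (simp add: grad_inner_def)
    also have "\<dots> \<le> (\<Sum>i\<in>UNIV. \<Sum>j\<in>UNIV. \<bar>Q i j ?x\<bar> * (K2 * \<bar>t\<bar>)\<^sup>2)"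
    proof (intro sum_mono)
      fix i j
      have "\<bar>pd (?W \<circ> chart_inv c) i ?x \<bullet> pd (?W \<circ> chart_inv c) j ?x\<bar>
          \<le> norm (pd (?W \<circ> chart_inv c) i ?x) * norm (pd (?W \<circ> chart_inv c) j ?x)"
        by (rule Cauchy_Schwarz_ineq2)
      also have "\<dots> \<le> (K2 * \<bar>t\<bar>) * (K2 * \<bar>t\<bar>)"
        by (intro mult_mono pdW) (use K2(1) in auto)
      finally have "\<bar>pd (?W \<circ> chart_inv c) i ?x \<bullet> pd (?W \<circ> chart_inv c) j ?x\<bar> \<le> (K2 * \<bar>t\<bar>)\<^sup>2"
        by (simp only: power2_eq_square)
      then have "\<bar>Q i j ?x * (pd (?W \<circ> chart_inv c) i ?x \<bullet> pd (?W \<circ> chart_inv c) j ?x)\<bar> \<le> \<bar>Q i j ?x\<bar> * (K2 * \<bar>t\<bar>)\<^sup>2"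
        unfolding abs_mult by (intro mult_left_mono) auto
      then show "Q i j ?x * (pd (?W \<circ> chart_inv c) i ?x \<bullet> pd (?W \<circ> chart_inv c) j ?x) \<le> \<bar>Q i j ?x\<bar> * (K2 * \<bar>t\<bar>)\<^sup>2"
        by linarith
    qed
    also have "\<dots> = (\<Sum>i\<in>UNIV. \<Sum>j\<in>UNIV. \<bar>Q i j ?x\<bar>) * (K2\<^sup>2 * t\<^sup>2)"
      by (simp add: sum_distrib_right power_mult_distrib)
    also have "\<dots> \<le> K3 * (K2\<^sup>2 * t\<^sup>2)"
      using K3(2)[OF xB] by (intro mult_right_mono) auto
    also have "\<dots> \<le> K * t\<^sup>2"
      unfolding mult.assoc[symmetric] by (intro mult_right_mono) (auto simp: K_def)
    finally show "dinner ?W ?W p \<le> K * t\<^sup>2" .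
  qed
  have "K \<ge> 0" using K1(1) by (simp add: K_def)
  moreover have "open (fst c \<inter> snd c -` ball (snd c p0) r)" by (rule open_chart_preimage[OF c(1)]) simp
  ultimately show ?thesis
    using main c r(1) by (intro exI[of _ "fst c \<inter> snd c -` ball (snd c p0) r"] exI[of _ K]) auto
qed

lemma smooth_family_bound:
  assumes \<Phi>: "smooth_family A \<epsilon> \<Phi>" "\<epsilon> > 0" "\<And>t. \<bar>t\<bar> < \<epsilon> \<Longrightarrow> smooth_map A (\<Phi> t)" and D: "compact D"
  obtains K where "K \<ge> 0" "\<And>p t. p \<in> D \<Longrightarrow> \<bar>t\<bar> \<le> \<epsilon> / 2 \<Longrightarrow> norm (\<Phi> t p - \<Phi> 0 p) \<le> K * \<bar>t\<bar>"
    "\<And>p t. p \<in> D \<Longrightarrow> \<bar>t\<bar> \<le> \<epsilon> / 2 \<Longrightarrow> dinner (\<lambda>p. \<Phi> t p - \<Phi> 0 p) (\<lambda>p. \<Phi> t p - \<Phi> 0 p) p \<le> K * t\<^sup>2"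
proof -
  have "\<forall>p0. \<exists>N K. open N \<and> p0 \<in> N \<and> 0 \<le> K \<and> (\<forall>p\<in>N. \<forall>t. \<bar>t\<bar> \<le> \<epsilon> / 2 \<longrightarrow>
    norm (\<Phi> t p - \<Phi> 0 p) \<le> K * \<bar>t\<bar> \<and>
    dinner (\<lambda>p. \<Phi> t p - \<Phi> 0 p) (\<lambda>p. \<Phi> t p - \<Phi> 0 p) p \<le> K * t\<^sup>2)"
    using smooth_family_bound_local[OF \<Phi>] by blast
  then obtain N k where N: "\<And>q. open (N q)" "\<And>q. q \<in> N q" and k: "\<And>q. 0 \<le> k q"
    and b: "\<And>q p t. p \<in> N q \<Longrightarrow> \<bar>t\<bar> \<le> \<epsilon> / 2 \<Longrightarrow> norm (\<Phi> t p - \<Phi> 0 p) \<le> k q * \<bar>t\<bar> \<and>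
      dinner (\<lambda>p. \<Phi> t p - \<Phi> 0 p) (\<lambda>p. \<Phi> t p - \<Phi> 0 p) p \<le> k q * t\<^sup>2"
    unfolding choice_iff by blast
  have "D \<subseteq> (\<Union>p\<in>UNIV. N p)" using N(2) by blast
  with D N(1) obtain P where P: "finite P" "D \<subseteq> (\<Union>p\<in>P. N p)" by (rule compactE_image)
  let ?K = "\<Sum>q\<in>P. k q"
  have *: "norm (\<Phi> t p - \<Phi> 0 p) \<le> ?K * \<bar>t\<bar>"
    "dinner (\<lambda>p. \<Phi> t p - \<Phi> 0 p) (\<lambda>p. \<Phi> t p - \<Phi> 0 p) p \<le> ?K * t\<^sup>2" if pt: "p \<in> D" "\<bar>t\<bar> \<le> \<epsilon> / 2" for p t
  proof -
    obtain q where q: "q \<in> P" "p \<in> N q" using P pt by blast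
    have "k q \<le> ?K" using q P k by (intro member_le_sum) auto
    then have "k q * \<bar>t\<bar> \<le> ?K * \<bar>t\<bar>" "k q * t\<^sup>2 \<le> ?K * t\<^sup>2" by (auto intro: mult_right_mono)
    then show "norm (\<Phi> t p - \<Phi> 0 p) \<le> ?K * \<bar>t\<bar>"
      "dinner (\<lambda>p. \<Phi> t p - \<Phi> 0 p) (\<lambda>p. \<Phi> t p - \<Phi> 0 p) p \<le> ?K * t\<^sup>2"
      using b[OF q(2) pt(2)] by linarith+
  qed
  show ?thesis by (rule that[OF _ *]) (auto intro: sum_nonneg k)
qed

lemma integral_vol_bound:
  fixes \<phi> :: "'p \<Rightarrow> real"
  assumes \<phi>: "continuous_on UNIV \<phi>" and D: "compact D" and z: "\<And>p. p \<notin> D \<Longrightarrow> \<phi> p = 0"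
    and C: "\<And>p. p \<in> D \<Longrightarrow> \<bar>\<phi> p\<bar> \<le> C"
  shows "\<bar>\<integral>p. \<phi> p \<partial>vol\<bar> \<le> C * measure vol D"
proof -
  have Dm: "D \<in> sets vol" using D by (simp add: volume(1) compact_imp_closed borel_closed)
  have i: "integrable vol \<phi>" by (rule integrable_vol[OF \<phi> D z])
  have "\<bar>\<integral>p. \<phi> p \<partial>vol\<bar> \<le> (\<integral>p. \<bar>\<phi> p\<bar> \<partial>vol)" by (rule integral_abs_bound)
  also have "\<dots> \<le> (\<integral>p. C * indicator D p \<partial>vol)"
  proof (rule integral_mono)
    show "integrable vol (\<lambda>p. C * indicator D p)"
      using Dm vol_compact[OF D] by (intro integrable_mult_right integrable_real_indicator) auto
  qed (use i C z in \<open>auto simp: indicator_def\<close>)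
  also have "\<dots> = C * measure vol D" using Dm by simp
  finally show ?thesis .
qed

text \<open>
  A null set of the volume has no interior, since the density is positive in every chart.
\<close>

lemma integral_vol_pos:
  fixes \<phi> :: "'p \<Rightarrow> real"
  assumes \<phi>: "continuous_on UNIV \<phi>" and D: "compact D" and z: "\<And>p. p \<notin> D \<Longrightarrow> \<phi> p = 0"
    and nonneg: "\<And>p. 0 \<le> \<phi> p" and pos: "0 < \<phi> p0"
  shows "0 < (\<integral>p. \<phi> p \<partial>vol)"
proof (rule ccontr)
  assume neg: "\<not> 0 < (\<integral>p. \<phi> p \<partial>vol)"
  have i: "integrable vol \<phi>" by (rule integrable_vol[OF \<phi> D z])
  have "0 \<le> (\<integral>p. \<phi> p \<partial>vol)" using nonneg by (rule Bochner_Integration.integral_nonneg)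
  then have "(\<integral>p. \<phi> p \<partial>vol) = 0" using neg by linarith
  then have ae: "AE p in vol. \<phi> p = 0"
    using integral_nonneg_eq_0_iff_AE[OF i] nonneg by simp
  obtain c where c: "c \<in> A" "p0 \<in> fst c" using ex_chart by blast
  let ?N = "fst c \<inter> {p. 0 < \<phi> p}"
  have o: "open ?N" using \<phi> open_chart[OF c(1)] by (intro open_Int open_Collect_less continuous_on_const)
  then have Nm: "?N \<in> sets vol" by (simp add: volume(1))
  have "AE p in vol. p \<notin> ?N" using ae by eventually_elim auto
  then have "emeasure vol ?N = 0" using AE_iff_null_sets[OF Nm] by auto
  let ?X = "snd c ` ?N"
  have X: "open ?X" using open_chart_image[OF c(1) o] by blast
  have "emeasure (chart_measure c) ?X = 0"
    using volume(2)[OF c(1), of ?N] o \<open>emeasure vol ?N = 0\<close> by auto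
  then have "(\<integral>\<^sup>+x. ennreal (vdens c x) * indicator ?X x \<partial>lborel) = 0"
    using chart_measure[OF c(1), of ?X] X by simp
  then have "AE x in lborel. ennreal (vdens c x) * indicator ?X x = 0"
    using c X by (subst (asm) nn_integral_0_iff_AE) auto
  then have "AE x in lborel. x \<notin> ?X"
  proof eventually_elim
    case (elim x)
    have "0 < vdens c x" if "x \<in> ?X"
      using that parametrization.\<mu>_pos[OF parametrization[OF c(1)], of x] vdens_eq[OF c(1), of x] by auto
    then show ?case using elim by (auto simp: indicator_def)
  qed
  then have "?X \<in> null_sets lborel" using AE_iff_null_sets[of ?X lborel] X by simp
  then have "negligible ?X" by (simp add: negligible_iff_null_sets null_sets_completionI)
  then show False using open_not_negligible[OF X] c pos by blast
qed

end

section \<open>Harmonicity and eigenvectors\<close>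

context parallel_normal_submanifold begin

lemma \<eta>_sphere: "\<eta> \<in> sphere_maps A"
  using smooth_\<eta> norm_\<eta> by (auto simp: sphere_maps_def)

lemma unit_normal_subset_sphere: "{\<zeta>. unit_normal_section A F \<zeta>} \<subseteq> sphere_maps A"
  by (auto simp: sphere_maps_def unit_normal_section_def normal_section_on_def)

lemma critical_among_mono: "critical_among A F C f \<Longrightarrow> C' \<subseteq> C \<Longrightarrow> critical_among A F C' f"
  unfolding critical_among_def[of A F C']
proof (intro allI impI)
  fix D \<epsilon> \<Phi>
  assume crit: "critical_among A F C f" and "C' \<subseteq> C" and \<Phi>: "compact D" "closure (interior D) = D" "\<epsilon> > 0"
    "smooth_family A \<epsilon> \<Phi>" "\<forall>t\<in>{-\<epsilon><..<\<epsilon>}. \<Phi> t \<in> C'" "\<Phi> 0 = f" "\<forall>t\<in>{-\<epsilon><..<\<epsilon>}. \<forall>p. p \<notin> D \<longrightarrow> \<Phi> t p = f p"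
  then have "\<forall>t\<in>{-\<epsilon><..<\<epsilon>}. \<Phi> t \<in> C" by blast
  with crit \<Phi> show "((\<lambda>t. energy A F D (\<Phi> t)) has_real_derivative 0) (at 0)"
    unfolding critical_among_def by blast
qed

text \<open>
  If \<open>B = l \<eta>\<close> and \<open>W = \<Phi>\<^sub>t - \<eta>\<close>, then \<open>2 \<langle>B, W\<rangle> = - l \<parallel>W\<parallel>\<^sup>2\<close> since \<open>\<eta>\<close> and \<open>\<eta> + W\<close> are unit
  vectors. So the energy changes by \<open>O(t\<^sup>2)\<close> only.
\<close>

lemma critical_if_eigenvector:
  assumes eigen: "simons_eigenvector A F \<eta>"
  shows "critical_among A F (sphere_maps A) \<eta>"
  unfolding critical_among_def
proof (intro allI impI)
  fix D \<epsilon> \<Phi>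
  assume D: "compact D" and \<epsilon>: "\<epsilon> > 0" and fam: "smooth_family A \<epsilon> \<Phi>"
    and sph: "\<forall>t\<in>{-\<epsilon><..<\<epsilon>}. \<Phi> t \<in> sphere_maps A" and \<Phi>0: "\<Phi> 0 = \<eta>"
    and out: "\<forall>t\<in>{-\<epsilon><..<\<epsilon>}. \<forall>p. p \<notin> D \<longrightarrow> \<Phi> t p = \<eta> p"
  have \<Phi>s: "smooth_map A (\<Phi> t)" and \<Phi>n: "\<And>p. norm (\<Phi> t p) = 1" if "\<bar>t\<bar> < \<epsilon>" for t
    using sph that by (auto simp: sphere_maps_def abs_less_iff image_subset_iff)
  obtain K where K: "K \<ge> 0" and K1: "\<And>p t. p \<in> D \<Longrightarrow> \<bar>t\<bar> \<le> \<epsilon> / 2 \<Longrightarrow> norm (\<Phi> t p - \<Phi> 0 p) \<le> K * \<bar>t\<bar>"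
    and K2: "\<And>p t. p \<in> D \<Longrightarrow> \<bar>t\<bar> \<le> \<epsilon> / 2 \<Longrightarrow> dinner (\<lambda>p. \<Phi> t p - \<Phi> 0 p) (\<lambda>p. \<Phi> t p - \<Phi> 0 p) p \<le> K * t\<^sup>2"
    using smooth_family_bound[OF fam \<epsilon> \<Phi>s D] by blast
  define l where "l p = B p \<bullet> \<eta> p" for p
  have lB: "B p = l p *\<^sub>R \<eta> p" for p using eigen unfolding simons_eigenvector_iff l_def by blast
  have "smooth_map A l" unfolding l_def[abs_def] by (intro smooth_map_inner smooth_B smooth_\<eta>)
  then have "bounded (l ` D)"
    by (intro compact_imp_bounded compact_continuous_image D continuous_on_subset[OF continuous_smooth_map]) auto
  then obtain L where "\<forall>y\<in>l ` D. norm y \<le> L" unfolding bounded_iff by blast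
  then have L: "\<bar>l p\<bar> \<le> L" if "p \<in> D" for p using that by auto
  have "\<bar>energy A F D (\<Phi> t) - energy A F D (\<Phi> 0)\<bar> \<le> ((L * K\<^sup>2 + K) * measure vol D) * t\<^sup>2"
    if t: "\<bar>t\<bar> < \<epsilon> / 2" for t
  proof -
    define W where "W p = \<Phi> t p - \<eta> p" for p
    have te: "\<bar>t\<bar> < \<epsilon>" using t \<epsilon> by linarith
    have W: "smooth_map A W" unfolding W_def[abs_def] by (intro smooth_map_diff \<Phi>s te smooth_\<eta>)
    have Wz: "W p = 0" if "p \<notin> D" for p using out te that by (auto simp: W_def abs_less_iff)
    have \<Phi>t: "\<Phi> t = (\<lambda>p. \<eta> p + W p)" by (simp add: W_def)
    have BW: "2 * (B p \<bullet> W p) = - (l p * (W p \<bullet> W p))" for p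
    proof -
      have "\<Phi> t p \<bullet> \<Phi> t p = 1" using \<Phi>n[OF te] by (simp add: dot_square_norm)
      then have "2 * (\<eta> p \<bullet> W p) = - (W p \<bullet> W p)"
        using \<eta>_\<eta>[of p] by (simp add: \<Phi>t inner_add_left inner_add_right inner_commute)
      then have "l p * (2 * (\<eta> p \<bullet> W p)) = l p * (- (W p \<bullet> W p))" by (rule arg_cong)
      then show ?thesis by (simp add: lB[of p])
    qed
    have "\<bar>\<integral>p. 2 * (B p \<bullet> W p) + dinner W W p \<partial>vol\<bar> \<le> ((L * K\<^sup>2 + K) * t\<^sup>2) * measure vol D"
    proof (rule integral_vol_bound[OF _ D])
      show "continuous_on UNIV (\<lambda>p. 2 * (B p \<bullet> W p) + dinner W W p)"
        by (intro continuous_on_add continuous_on_mult continuous_on_const continuous_on_inner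
            continuous_smooth_map smooth_dinner smooth_B W)
      show "2 * (B p \<bullet> W p) + dinner W W p = 0" if "p \<notin> D" for p
        using dinner_locally_0[of "- D" p W W] that Wz D by (simp add: open_Compl compact_imp_closed)
      fix p assume p: "p \<in> D"
      have "norm (W p) \<le> K * \<bar>t\<bar>" "dinner W W p \<le> K * t\<^sup>2"
        using K1[OF p, of t] K2[OF p, of t] t unfolding W_def[abs_def] \<Phi>0 by auto
      then have "W p \<bullet> W p \<le> (K * \<bar>t\<bar>)\<^sup>2" by (simp add: dot_square_norm power_mono)
      then have "\<bar>l p\<bar> * (W p \<bullet> W p) \<le> L * (K\<^sup>2 * t\<^sup>2)"
        using L[OF p] by (intro mult_mono) (auto simp: power_mult_distrib)
      then have "\<bar>2 * (B p \<bullet> W p)\<bar> \<le> L * (K\<^sup>2 * t\<^sup>2)" unfolding BW by (simp add: abs_mult)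
      then show "\<bar>2 * (B p \<bullet> W p) + dinner W W p\<bar> \<le> (L * K\<^sup>2 + K) * t\<^sup>2"
        using \<open>dinner W W p \<le> K * t\<^sup>2\<close> dinner_nonneg[of W p] by (simp add: algebra_simps abs_le_iff)
    qed
    then show ?thesis using energy_expand[OF W D Wz] by (simp add: \<Phi>0 \<Phi>t mult_ac)
  qed
  then show "((\<lambda>t. energy A F D (\<Phi> t)) has_real_derivative 0) (at 0)"
    using \<epsilon> by (intro has_real_derivative_0_quadratic[of "\<epsilon> / 2"]) auto
qed

text \<open>
  Where \<open>\<eta>\<close> is not an eigenvector, push it in the direction of \<open>V = b (B - \<langle>B, \<eta>\<rangle> \<eta>)\<close> for a bump
  function \<open>b\<close> and normalize. Along this variation the energy grows at least linearly in \<open>t > 0\<close>,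
  because \<open>\<langle>B, V\<rangle> = b \<parallel>B - \<langle>B, \<eta>\<rangle> \<eta>\<parallel>\<^sup>2\<close>; a bound from below for \<open>0 < t < 1\<close> is enough to contradict
  criticality.
\<close>

lemma eigenvector_if_critical:
  assumes crit: "critical_among A F {\<zeta>. unit_normal_section A F \<zeta>} \<eta>"
  shows "simons_eigenvector A F \<eta>"
proof (rule ccontr)
  define l where "l p = B p \<bullet> \<eta> p" for p
  define V0 where "V0 p = B p - l p *\<^sub>R \<eta> p" for p
  assume "\<not> simons_eigenvector A F \<eta>"
  then obtain p0 where p0: "V0 p0 \<noteq> 0" unfolding simons_eigenvector_iff V0_def l_def by auto
  have l: "smooth_map A l" unfolding l_def[abs_def] by (intro smooth_map_inner smooth_B smooth_\<eta>)
  have l0: "0 \<le> l p" for p using B_inner_\<eta> dinner_nonneg by (simp add: l_def)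
  have V0: "smooth_map A V0"
    unfolding V0_def[abs_def] by (intro smooth_map_diff smooth_map_scaleR smooth_B smooth_\<eta> l)
  have V0_normal: "V0 p \<in> normal_space A F p" for p
    using B_normal[of p] \<eta>_normal[of p] by (simp add: V0_def normal_space_iff inner_diff_left)
  have V0_\<eta>: "V0 p \<bullet> \<eta> p = 0" for p by (simp add: V0_def l_def inner_diff_left \<eta>_\<eta>)
  have B_V0: "B p \<bullet> V0 p = V0 p \<bullet> V0 p" for p
  proof -
    have "B p = V0 p + l p *\<^sub>R \<eta> p" by (simp add: V0_def)
    then show ?thesis using V0_\<eta>[of p] by (simp add: inner_add_left inner_add_right inner_commute)
  qed
  obtain c where c: "c \<in> A" "p0 \<in> fst c" using ex_chart by blast
  obtain r where r: "r > 0" "cball (snd c p0) r \<subseteq> snd c ` (fst c \<inter> UNIV)"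
    using ex_chart_ball[OF c open_UNIV UNIV_I] by blast
  then have r2: "cball (snd c p0) r \<subseteq> snd c ` fst c" by simp
  let ?N = "chart_inv c ` ball (snd c p0) r" and ?D = "chart_inv c ` cball (snd c p0) r"
  define b where "b = chart_bump c (snd c p0) r"
  note bump = chart_bump[OF c(1) r(1) r2, folded b_def]
  have D: "compact ?D" "?D \<subseteq> fst c" using compact_chart_cball[OF c(1) r2] by blast+
  have ND: "?N \<subseteq> ?D" by (rule image_mono[OF ball_subset_cball])
  have p0N: "p0 \<in> ?N" using c r(1) by (intro image_eqI[of _ _ "snd c p0"]) auto
  have bz: "b p = 0" if "p \<notin> ?D" for p using bump(4) that ND by blast
  have cl: "closure (interior ?D) = ?D"
  proof
    show "closure (interior ?D) \<subseteq> ?D"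
      using D(1) compact_imp_closed closure_minimal interior_subset by blast
    have "?N = fst c \<inter> snd c -` ball (snd c p0) r"
    proof (intro equalityI subsetI)
      fix q assume "q \<in> ?N"
      then obtain y where y: "y \<in> ball (snd c p0) r" "q = chart_inv c y" by blast
      then have "y \<in> snd c ` fst c" using r2 ball_subset_cball by blast
      then show "q \<in> fst c \<inter> snd c -` ball (snd c p0) r" using y c by auto
    next
      fix q assume q: "q \<in> fst c \<inter> snd c -` ball (snd c p0) r"
      then have "q = chart_inv c (snd c q)" using c by simp
      then show "q \<in> ?N" using q by blast
    qed
    then have "open ?N" using open_chart_preimage[OF c(1)] by simp
    then have "?N \<subseteq> closure (interior ?D)" using interior_maximal[OF ND] closure_subset by blast
    then have "chart_inv c ` closure (ball (snd c p0) r) \<subseteq> closure (interior ?D)"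
      using r by (intro image_closure_subset continuous_on_subset[OF continuous_chart_inv[OF c(1)]]) auto
    then show "?D \<subseteq> closure (interior ?D)" using r(1) by simp
  qed
  define V where "V p = b p *\<^sub>R V0 p" for p
  have V: "smooth_map A V" unfolding V_def[abs_def] by (intro smooth_map_scaleR bump V0)
  have Vz: "V p = 0" if "p \<notin> ?D" for p using bz[OF that] by (simp add: V_def)
  have V_\<eta>: "V p \<bullet> \<eta> p = 0" "\<eta> p \<bullet> V p = 0" for p using V0_\<eta>[of p] by (simp_all add: V_def inner_commute)
  define s where "s t p = sqrt (1 + t\<^sup>2 * (V p \<bullet> V p))" for t p
  define \<Phi> where "\<Phi> t p = inverse (s t p) *\<^sub>R (\<eta> p + t *\<^sub>R V p)" for t p
  have arg: "1 \<le> 1 + t\<^sup>2 * (V p \<bullet> V p)" for t p by simp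
  then have s1: "1 \<le> s t p" for t p unfolding s_def using real_sqrt_le_mono[OF arg] by simp
  have s_sq: "s t p * s t p = 1 + t\<^sup>2 * (V p \<bullet> V p)" for t p using arg[of t p] by (simp add: s_def)
  have \<Phi>0: "\<Phi> 0 = \<eta>" by (simp add: \<Phi>_def s_def fun_eq_iff)
  have \<Phi>_out: "\<Phi> t p = \<eta> p" if "p \<notin> ?D" for t p using Vz[OF that] by (simp add: \<Phi>_def s_def)
  have fam: "smooth_family A 1 \<Phi>"
    unfolding smooth_family_def
  proof
    fix d assume d: "d \<in> A"
    let ?S = "{-1<..<1::real} \<times> snd d ` fst d"
    have S: "open ?S" using open_image[OF d] by (intro open_Times) auto
    have lift: "smooth_on ?S (\<lambda>z. \<phi> (chart_inv d (snd z)))" if "smooth_map A \<phi>" for \<phi> :: "'p \<Rightarrow> real ^ 'm"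
    proof -
      have "smooth_on ?S (\<lambda>z. (\<phi> \<circ> chart_inv d) (snd z))"
        by (rule smooth_on_compose[OF S open_image[OF d] smooth_mapD[OF that d]])
          (use smooth_on_bounded_linear[OF S bounded_linear_snd] in auto)
      then show ?thesis by simp
    qed
    have f: "smooth_on ?S fst" by (rule smooth_on_bounded_linear[OF S bounded_linear_fst])
    have "smooth_on ?S (\<lambda>z. inverse (sqrt (1 + (fst z * fst z) * (V (chart_inv d (snd z)) \<bullet> V (chart_inv d (snd z))))) *\<^sub>R
        (\<eta> (chart_inv d (snd z)) + fst z *\<^sub>R V (chart_inv d (snd z))))"
      by (intro smooth_on_scaleR smooth_on_inverse smooth_on_sqrt smooth_on_add smooth_on_mult smooth_on_inner
          smooth_on_const lift f V smooth_\<eta> S)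
        (use arg in \<open>auto simp: power2_eq_square intro: add_pos_nonneg dest: add_nonneg_eq_0_iff[THEN iffD1, rotated 2]\<close>)
    then show "smooth_on ?S (\<lambda>(t, x). \<Phi> t (chart_inv d x))"
      by (simp add: \<Phi>_def s_def case_prod_unfold power2_eq_square)
  qed
  have unit: "unit_normal_section A F (\<Phi> t)" if t: "\<bar>t\<bar> < 1" for t
    unfolding unit_normal_section_def normal_section_on_def
  proof (intro conjI ballI allI)
    show "smooth_map A (\<Phi> t)"
    proof (rule smooth_map_chartsI)
      fix d assume d: "d \<in> A"
      have "smooth_on (snd d ` fst d) (\<lambda>x. (\<lambda>(t, x). \<Phi> t (chart_inv d x)) (t, x))"
      proof (rule smooth_on_compose[where T="{-1<..<1} \<times> snd d ` fst d"])
        show "smooth_on ({-1<..<1} \<times> snd d ` fst d) (\<lambda>(t, x). \<Phi> t (chart_inv d x))"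
          using fam d unfolding smooth_family_def by blast
      qed (use t open_image[OF d] in \<open>auto intro!: smooth_intros open_Times simp: abs_less_iff\<close>)
      then show "smooth_on (snd d ` fst d) (\<Phi> t \<circ> chart_inv d)" by (simp add: o_def)
    qed
    fix p
    show "\<Phi> t p \<in> normal_space A F p"
      using \<eta>_normal[of p] V0_normal[of p] by (simp add: \<Phi>_def V_def normal_space_iff inner_add_left)
    have "\<Phi> t p \<bullet> \<Phi> t p = inverse (s t p) * inverse (s t p) * (1 + t\<^sup>2 * (V p \<bullet> V p))"
      using \<eta>_\<eta>[of p] V_\<eta>[of p] by (simp add: \<Phi>_def inner_add_left inner_add_right power2_eq_square algebra_simps)
    also have "\<dots> = 1"
    proof -
      have "s t p \<noteq> 0" using s1[of t p] by auto
      then show ?thesis unfolding s_sq[symmetric] by (simp add: field_simps)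
    qed
    finally show "norm (\<Phi> t p) = 1" by (simp add: norm_eq_1)
  qed
  have der: "((\<lambda>t. energy A F ?D (\<Phi> t)) has_real_derivative 0) (at 0)"
    using crit[unfolded critical_among_def, rule_format, of ?D 1 \<Phi>] D(1) cl fam unit \<Phi>0 \<Phi>_out
    by (auto simp: abs_less_iff)
  define g where "g p = b p * (V0 p \<bullet> V0 p) / (1 + V p \<bullet> V p)" for p
  define k where "k p = l p * (V p \<bullet> V p)" for p
  have g_cont: "continuous_on UNIV g" unfolding g_def[abs_def]
    by (intro continuous_on_divide continuous_on_mult continuous_on_inner continuous_on_add continuous_on_const
        continuous_smooth_map V0 V bump) (metis inner_ge_zero add_nonneg_eq_0_iff zero_le_one zero_neq_one)
  have k_cont: "continuous_on UNIV k" unfolding k_def[abs_def]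
    by (intro continuous_on_mult continuous_on_inner continuous_smooth_map V l)
  have gz: "g p = 0" and kz: "k p = 0" if "p \<notin> ?D" for p
    using bz[OF that] Vz[OF that] by (simp_all add: g_def k_def)
  have gi: "integrable vol g" and ki: "integrable vol k"
    using integrable_vol[OF g_cont D(1) gz] integrable_vol[OF k_cont D(1) kz] by blast+
  let ?a = "\<integral>p. g p \<partial>vol" and ?k = "\<integral>p. k p \<partial>vol"
  have a: "0 < ?a"
  proof (rule integral_vol_pos[OF g_cont D(1) gz])
    show "0 \<le> g p" for p unfolding g_def
      by (intro divide_nonneg_nonneg mult_nonneg_nonneg bump add_nonneg_nonneg) auto
    show "0 < g p0" unfolding g_def
      using p0 by (intro divide_pos_pos mult_pos_pos bump p0N add_pos_nonneg) auto
  qed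
  have lower: "2 * (t * ?a - t\<^sup>2 * ?k) \<le> energy A F ?D (\<Phi> t) - energy A F ?D (\<Phi> 0)"
    if t: "0 < t" "t < 1" for t
  proof -
    define W where "W p = \<Phi> t p - \<eta> p" for p
    have W: "smooth_map A W" unfolding W_def[abs_def]
      using unit[of t] t by (intro smooth_map_diff smooth_\<eta>) (auto simp: unit_normal_section_def normal_section_on_def)
    have Wz: "W p = 0" if "p \<notin> ?D" for p using \<Phi>_out[OF that] by (simp add: W_def)
    have \<Phi>t: "\<Phi> t = (\<lambda>p. \<eta> p + W p)" by (simp add: W_def)
    have pointwise: "t * g p - t\<^sup>2 * k p \<le> B p \<bullet> W p" for p
    proof -
      let ?v = "V p \<bullet> V p"
      have W_eq: "W p = (inverse (s t p) - 1) *\<^sub>R \<eta> p + (inverse (s t p) * t) *\<^sub>R V p"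
        by (simp add: W_def \<Phi>_def algebra_simps)
      \<comment> \<open>The coefficient of \<open>\<eta>\<close> is negative, but only of order \<open>t\<^sup>2\<close>.\<close>
      have BW: "B p \<bullet> W p = (inverse (s t p) - 1) * l p + inverse (s t p) * t * (b p * (V0 p \<bullet> V0 p))"
        unfolding W_eq inner_add_right by (simp add: l_def V_def B_V0)
      have "s t p * 1 \<le> s t p * s t p" using s1[of t p] by (intro mult_left_mono) auto
      then have s2: "s t p \<le> 1 + t\<^sup>2 * ?v" by (simp add: s_sq)
      then have "1 - t\<^sup>2 * ?v \<le> inverse (s t p)"
      proof -
        have "(1 - t\<^sup>2 * ?v) * (1 + t\<^sup>2 * ?v) \<le> 1"
          by (simp add: algebra_simps)
        then have "1 - t\<^sup>2 * ?v \<le> inverse (1 + t\<^sup>2 * ?v)"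
          unfolding inverse_eq_divide by (subst pos_le_divide_eq[OF less_le_trans[OF zero_less_one arg]])
        also have "\<dots> \<le> inverse (s t p)" using s1[of t p] s2 by (intro le_imp_inverse_le) auto
        finally show ?thesis .
      qed
      then have 1: "- (t\<^sup>2 * k p) \<le> (inverse (s t p) - 1) * l p"
        using mult_right_mono[OF _ l0, of "- (t\<^sup>2 * ?v)" "inverse (s t p) - 1" p] by (simp add: k_def mult_ac)
      have "t\<^sup>2 \<le> 1" using t by (simp add: power_le_one)
      then have "t\<^sup>2 * ?v \<le> 1 * ?v" by (intro mult_right_mono) auto
      then have "inverse (1 + ?v) \<le> inverse (s t p)" using s1[of t p] s2 by (intro le_imp_inverse_le) auto
      then have "inverse (1 + ?v) * (t * (b p * (V0 p \<bullet> V0 p))) \<le> inverse (s t p) * (t * (b p * (V0 p \<bullet> V0 p)))"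
        using t bump(2) by (intro mult_right_mono mult_nonneg_nonneg) auto
      then have 2: "t * g p \<le> inverse (s t p) * t * (b p * (V0 p \<bullet> V0 p))"
        by (simp add: g_def divide_inverse mult_ac)
      show ?thesis unfolding BW using 1 2 by linarith
    qed
    have "2 * (t * ?a - t\<^sup>2 * ?k) = (\<integral>p. 2 * (t * g p - t\<^sup>2 * k p) \<partial>vol)"
      using gi ki by simp
    also have "\<dots> \<le> (\<integral>p. 2 * (B p \<bullet> W p) + dinner W W p \<partial>vol)"
    proof (rule integral_mono)
      show "integrable vol (\<lambda>p. 2 * (t * g p - t\<^sup>2 * k p))" using gi ki by simp
      show "integrable vol (\<lambda>p. 2 * (B p \<bullet> W p) + dinner W W p)"
      proof (rule integrable_vol[OF _ D(1)])
        show "continuous_on UNIV (\<lambda>p. 2 * (B p \<bullet> W p) + dinner W W p)"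
          by (intro continuous_on_add continuous_on_mult continuous_on_const continuous_on_inner
              continuous_smooth_map smooth_dinner smooth_B W)
        show "2 * (B p \<bullet> W p) + dinner W W p = 0" if "p \<notin> ?D" for p
          using dinner_locally_0[of "- ?D" p W W] that Wz D(1) by (simp add: open_Compl compact_imp_closed)
      qed
      show "2 * (t * g p - t\<^sup>2 * k p) \<le> 2 * (B p \<bullet> W p) + dinner W W p" for p
        using mult_left_mono[OF pointwise[of p], of 2] dinner_nonneg[of W p]
        by (auto intro: add_increasing2)
    qed
    finally show ?thesis using energy_expand[OF W D(1) Wz] by (simp add: \<Phi>0 \<Phi>t)
  qed
  have "((\<lambda>h. (energy A F ?D (\<Phi> (0 + h)) - energy A F ?D (\<Phi> 0)) / h) \<longlongrightarrow> 0) (at_right 0)"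
    using der unfolding DERIV_def by (rule filterlim_mono) (auto simp: at_within_le_at)
  moreover have "((\<lambda>h. 2 * (?a - h * ?k)) \<longlongrightarrow> 2 * (?a - 0 * ?k)) (at_right 0)"
    by (intro tendsto_intros)
  moreover have "\<forall>\<^sub>F h in at_right 0. 2 * (?a - h * ?k) \<le> (energy A F ?D (\<Phi> (0 + h)) - energy A F ?D (\<Phi> 0)) / h"
    unfolding eventually_at_right_field
  proof (intro exI[of _ 1] conjI allI impI)
    fix h :: real assume h: "0 < h" "h < 1"
    have "2 * (?a - h * ?k) * h = 2 * (h * ?a - h\<^sup>2 * ?k)" by (simp add: algebra_simps power2_eq_square)
    then show "2 * (?a - h * ?k) \<le> (energy A F ?D (\<Phi> (0 + h)) - energy A F ?D (\<Phi> 0)) / h"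
      using lower[OF h] h by (simp add: pos_le_divide_eq)
  qed simp
  ultimately have "2 * (?a - 0 * ?k) \<le> 0" by (intro tendsto_le[of "at_right (0::real)"]) auto
  then show False using a by simp
qed

end

theorem theorem1p4:
  fixes A :: "('p::{t2_space, second_countable_topology}, 'n::finite) chart set"
    and F :: "'p \<Rightarrow> real ^ 'm::finite"
    and \<eta> :: "'p \<Rightarrow> real ^ 'm"
  assumes "smooth_atlas A"
    and "immersion A F"
    and "parallel_section A F (mean_curvature A F)"
    and "unit_normal_section A F \<eta>"
    and "parallel_section A F \<eta>"
  shows "(harmonic_sphere_map A F (gauss_map \<eta>) \<longleftrightarrow> harmonic_unit_normal_section A F \<eta>) \<and>
         (harmonic_unit_normal_section A F \<eta> \<longleftrightarrow> simons_eigenvector A F \<eta>)"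
proof -
  interpret parallel_normal_submanifold A F \<eta>
    by unfold_locales (rule assms)+
  have "gauss_map \<eta> = \<eta>" by (simp add: gauss_map_def fun_eq_iff)
  moreover have "harmonic_unit_normal_section A F \<eta>" if "harmonic_sphere_map A F \<eta>"
    using that critical_among_mono[OF _ unit_normal_subset_sphere] assms(4)
    by (auto simp: harmonic_sphere_map_def harmonic_unit_normal_section_def)
  moreover have "simons_eigenvector A F \<eta>" if "harmonic_unit_normal_section A F \<eta>"
    using that eigenvector_if_critical by (simp add: harmonic_unit_normal_section_def)
  moreover have "harmonic_sphere_map A F \<eta>" if "simons_eigenvector A F \<eta>"
    using that critical_if_eigenvector \<eta>_sphere by (simp add: harmonic_sphere_map_def)
  ultimately show ?thesis by auto
qed

end
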